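(* Fix $m\in\mathbb N$ and $s_0\in\mathbb C\setminus\{0,1\}$. Then the limit $$\zeta_{[m]}(s_0)=\lim_{\min\{p_1,\dots,p_m\}\to\infty}\zeta^{\approx}_{\{p_1,\dots,p_m\}}(s_0),$$ taken over sets $\{p_1,\dots,p_m\}$ of $m$ distinct primes, exists and $$\zeta_{[m]}(s_0)=\frac{1}{s_0^m(1-s_0)^m g(s_0)}\cdot\frac1{2\pi i}\int_{(|\mathrm{Re}\,s_0|+2)} s^m(1-s)^m g(s)\,a(s,s_0)\,ds,$$ where $$a(s,s_0)=\frac1{s-s_0}+\frac1{s-1+s_0}$$ and $\int_{(c)}$ denotes integration upward along the vertical line $\mathrm{Re}\,s=c$.
   Context: $\mathbb N$ denotes the positive integers. Let $g(s)=\tfrac{s(s-1)}{2}\pi^{-s/2}\Gamma(s/2)$ (with the removable singularity at $s=0$ filled in); $1/g$ is taken to be $0$ at the poles $s=-2n$ ($n\ge1$) of $g$. Let $\mathfrak B$ be a finite set of primes with $m=|\mathfrak B|$ elements. Define the meromorphic functions $$\zeta_{\mathfrak B}(s)=\prod_{p\in\mathfrak B}\frac1{1-p^{-s}},\quad \xi_{\mathfrak B}(s)=g(s)\zeta_{\mathfrak B}(s),\quad \zeta^{:}_{\mathfrak B}(s)=s^m(1-s)^m\zeta_{\mathfrak B}(s),\quad \xi^{:}_{\mathfrak B}(s)=s^m(1-s)^m\xi_{\mathfrak B}(s)$$ (empty product $=1$, removable singularities filled in; for a set of a different cardinality, $m$ is replaced by that cardinality). The poles of $\xi^{:}_{\mathfrak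 B}$ are simple, located at $2\pi i n/\log p$ ($p\in\mathfrak B$, $n\in\mathbb Z\setminus\{0\}$) and possibly at $-2n$ ($n\ge1$). The sum of its principal parts is $$\xi^{:\mathrm{pp}}_{\mathfrak B}(s)=\sum_{p\in\mathfrak B}\ \sum_{n=-\infty}^{\infty}\frac{\frac{2n\pi i}{\log p}\left(1-\frac{2n\pi i}{\log p}\right)\xi^{:}_{\mathfrak B\setminus\{p\}}\left(\frac{2n\pi i}{\log p}\right)}{\log p\,\left(s-\frac{2n\pi i}{\log p}\right)}+\sum_{n=1}^{\infty}(-1)^n\frac{2\pi^n(2n+1)\,\zeta^{:}_{\mathfrak B}(-2n)}{\Gamma(n)(s+2n)}$$ (the term $n=0$ of the first sum is $0$). Put $\xi^{:\mathrm{reg}}_{\mathfrak B}(s)=\xi^{:}_{\mathfrak B}(s)-\xi^{:\mathrm{pp}}_{\mathfrak B}(s)$, which extends to an entire function, and, for $s\ne0,1$, $$\xi^{\approx}_{\mathfrak B}(s)=\frac{\xi^{:\mathrm{reg}}_{\mathfrak B}(s)+\xi^{:\mathrm{reg}}_{\mathfrak B}(1-s)}{s^m(1-s)^m},\qquad \zeta^{\approx}_{\mathfrak B}(s)=\frac{\xi^{\approx}_{\mathfrak B}(s)}{g(s)}.$$ *)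

theory Defs
  imports "HOL-Complex_Analysis.Complex_Analysis"
begin

text \<open>
  Removable singularities are filled in with the library operator \<^const>\<open>remove_sings\<close>,
  which takes the value \<open>0\<close> at poles. Only its values at regular points matter below, except
  for \<open>g_fun\<close>: there \<open>g_fun s = 0\<close> at the poles \<open>s = -2 n\<close>, so that division by \<open>g_fun s\<close> yields
  \<open>0\<close>, which is the convention \<open>1/g = 0\<close> at the poles of \<open>g\<close>.
\<close>

definition g_fun :: "complex \<Rightarrow> complex" where
  "g_fun = remove_sings (\<lambda>s. s * (s - 1) / 2 * of_real pi powr (- s / 2) * Gamma (s / 2))"

text \<open>The functions \<open>\<zeta>\<^sub>B\<close> and \<open>\<xi>\<^sub>B\<close> have no removable singularities other than that of \<open>g\<close> at \<open>0\<close>.\<close>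

definition zeta_B :: "nat set \<Rightarrow> complex \<Rightarrow> complex" where
  "zeta_B B s = (\<Prod>p\<in>B. 1 / (1 - of_nat p powr (- s)))"

definition xi_B :: "nat set \<Rightarrow> complex \<Rightarrow> complex" where
  "xi_B B s = g_fun s * zeta_B B s"

definition zeta_colon :: "nat set \<Rightarrow> complex \<Rightarrow> complex" where
  "zeta_colon B = remove_sings (\<lambda>s. s ^ card B * (1 - s) ^ card B * zeta_B B s)"

definition xi_colon :: "nat set \<Rightarrow> complex \<Rightarrow> complex" where
  "xi_colon B = remove_sings (\<lambda>s. s ^ card B * (1 - s) ^ card B * xi_B B s)"

definition imag_pole :: "nat \<Rightarrow> int \<Rightarrow> complex" where
  "imag_pole p n = 2 * of_int n * of_real pi * \<i> / of_real (ln (real p))"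

text \<open>
  The series are unordered (that is, absolutely convergent) sums. When \<open>s\<close> is one of the poles,
  the value of \<open>xi_colon_pp B s\<close> is not meaningful, since one summand is then \<open>x / 0 = 0\<close>.
\<close>

definition xi_colon_pp :: "nat set \<Rightarrow> complex \<Rightarrow> complex" where
  "xi_colon_pp B s =
     (\<Sum>p\<in>B. \<Sum>\<^sub>\<infinity>n\<in>(UNIV :: int set).
        imag_pole p n * (1 - imag_pole p n) * xi_colon (B - {p}) (imag_pole p n) /
        (of_real (ln (real p)) * (s - imag_pole p n)))
   + (\<Sum>\<^sub>\<infinity>n\<in>{1 :: nat..}.
        (-1) ^ n * (2 * of_real pi ^ n * (2 * of_nat n + 1) * zeta_colon B (- 2 * of_nat n)) /
        (Gamma (of_nat n) * (s + 2 * of_nat n)))"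

definition xi_colon_reg :: "nat set \<Rightarrow> complex \<Rightarrow> complex" where
  "xi_colon_reg B = remove_sings (\<lambda>s. xi_colon B s - xi_colon_pp B s)"

text \<open>The next two functions are only meaningful for \<open>s \<noteq> 0, 1\<close>.\<close>

definition xi_approx :: "nat set \<Rightarrow> complex \<Rightarrow> complex" where
  "xi_approx B s = (xi_colon_reg B s + xi_colon_reg B (1 - s)) / (s ^ card B * (1 - s) ^ card B)"

definition zeta_approx :: "nat set \<Rightarrow> complex \<Rightarrow> complex" where
  "zeta_approx B s = xi_approx B s / g_fun s"

text \<open>The filter of \<open>m\<close>-element sets of primes whose least element tends to infinity (\<open>m \<ge> 1\<close>).\<close>

definition prime_sets_at_top :: "nat \<Rightarrow> nat set filter" where
  "prime_sets_at_top m =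
     inf (filtercomap Min at_top) (principal {B. finite B \<and> card B = m \<and> (\<forall>p\<in>B. prime p)})"

lemma eventually_prime_sets_at_top:
  "eventually P (prime_sets_at_top m) \<longleftrightarrow>
     (\<exists>N. \<forall>B. finite B \<and> card B = m \<and> (\<forall>p\<in>B. prime p) \<and> N \<le> Min B \<longrightarrow> P B)"
  unfolding prime_sets_at_top_def eventually_inf_principal eventually_filtercomap_at_top_linorder
  by auto

lemma prime_sets_at_top_neq_bot:
  assumes "m \<ge> 1"
  shows "prime_sets_at_top m \<noteq> bot"
proof
  assume "prime_sets_at_top m = bot"
  then have "eventually (\<lambda>_. False) (prime_sets_at_top m)"
    by simp
  then obtain N where
    N: "\<forall>B :: nat set. finite B \<and> card B = m \<and> (\<forall>p\<in>B. prime p) \<and> N \<le> Min B \<longrightarrow> False"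
    unfolding eventually_prime_sets_at_top by blast
  have "infinite ({p :: nat. prime p} - {..<N})"
    using primes_infinite by (intro Diff_infinite_finite) auto
  then obtain B where B: "B \<subseteq> {p. prime p} - {..<N}" "finite B" "card B = m"
    using infinite_arbitrarily_large by blast
  then have "B \<noteq> {}"
    using assms by auto
  then have "N \<le> Min B"
    using B by (auto simp: Min_ge_iff)
  then show False
    using N B by blast
qed

definition zeta_bracket :: "nat \<Rightarrow> complex \<Rightarrow> complex" where
  "zeta_bracket m s = Lim (prime_sets_at_top m) (\<lambda>B. zeta_approx B s)"

text \<open>Integration upward along the line \<open>Re s = c\<close>, parametrised by \<open>s = c + i t\<close>.\<close>

definition vertical_line_integral :: "real \<Rightarrow> (complex \<Rightarrow> complex) \<Rightarrow> complex" where
  "vertical_line_integral c f = (LINT t|lborel. f (Complex c t) * \<i>)"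

definition a_fun :: "complex \<Rightarrow> complex \<Rightarrow> complex" where
  "a_fun s s0 = 1 / (s - s0) + 1 / (s - 1 + s0)"

end

theory Submission
  imports Defs "Jordan_Normal_Form.Determinant" "HOL-Number_Theory.Cong" "HOL-Real_Asymp.Real_Asymp"
    "HOL-Probability.Sinc_Integral"
begin

text \<open>
  Write \<open>F = \<xi>\<^sup>:\<^sub>B\<close>. Moving the line of integration in
  \<open>(1 / 2 \<pi> i) \<integral>\<^bsub>(c)\<^esub> F(w) / (w - s) dw\<close> to the far left collects \<open>F(s)\<close> together with minus
  the principal parts of \<open>F\<close>, evaluated at \<open>s\<close>, and leaves nothing behind because \<open>\<Gamma>\<close>
  decays factorially along the lines midway between its poles. So \<open>\<xi>\<^sup>:\<^sup>r\<^sup>e\<^sup>g\<close> is this integral for every finite \<open>B\<close>, and on the line \<open>Re w = c\<close> the Euler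
  product \<open>\<zeta>\<^sub>B\<close> tends to \<open>1\<close> uniformly as the least prime tends to infinity.

  The depth lies in the absolute convergence of the series of principal parts: for two primes
  \<open>p \<noteq> q\<close> the factor \<open>1 - q\<^sup>-\<^sup>s\<close> is small at some of the poles \<open>s = 2 \<pi> i n / ln p\<close>, and against the
  decay \<open>exp (- \<pi>\<^sup>2 |n| / (2 ln p))\<close> of \<open>\<Gamma>(s / 2)\<close> one needs \<open>|n ln q - k ln p| \<ge> C\<^sub>\<epsilon> exp (- \<epsilon> n)\<close> for every
  \<open>\<epsilon> > 0\<close>, a weak form of Gelfond's theorem. If \<open>n ln q - k ln p\<close> were smaller, then for an
  auxiliary integer polynomial \<open>P\<close> chosen by the pigeonhole principle such that
  \<open>z \<mapsto> P (n z, p\<^sup>z)\<close> has small Taylor coefficients, the integers \<open>P (r n + s k, p\<^sup>r q\<^sup>s)\<close> would be close to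
  values of that function at \<open>z = r + s k / n\<close>, hence zero for more pairs \<open>(r, s)\<close> than a nonzero
  polynomial of these degrees allows.
\<close>

section \<open>Linear forms in the logarithms of two primes\<close>

text \<open>For the kernel \<open>s^m (1 - s)^m g(s)\<close> only the crude decay exp (-|Im s| / 16)
  is proved. This costs nothing: the bound for linear forms holds for every \<epsilon> > 0, so small
  divisors lose against any exponential rate.

  That bound serves twice: at the poles of the factor of p, to sum the residues, and on the
  horizontal sides of the rectangles, which must pass between the poles of all Euler factors at
  once. Both kinds of heights are multiples of pi / ln p, the even ones being poles and the odd ones
  midpoints; hence the estimates for Euler factors are stated in half steps with a parity condition.

  In the transcendence argument L grows with n, while the constant D makes the Taylor tail exp (-D^2
  L^2) beat the growth exp (O(D L^2)) of the exponentials.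

  The limits are taken separately: the heights tend to infinity while the left edge is fixed, and
  only then does the left edge move away. The point 0, where the poles of all Euler factors
  coincide, needs its own treatment: s^m cancels them, so it is an isolated singularity with residue
  0. At the poles themselves the regular part is reached by continuity of the line integral.\<close>

lemma det_scaled_vandermonde_nonzero:
  fixes u w :: "nat \<Rightarrow> 'a :: idom"
  assumes "inj_on w {..<n}" and "\<And>i. i < n \<Longrightarrow> u i \<noteq> 0"
  shows "det (Matrix.mat n n (\<lambda>(j, i). u i * w i ^ j)) \<noteq> 0"
proof
  let ?B = "Matrix.mat n n (\<lambda>(j, i). u i * w i ^ j)"
  assume "det ?B = 0"
  moreover have B: "?B \<in> carrier_mat n n" by simp
  ultimately have "det (transpose_mat ?B) = 0"
    using det_transpose by metis
  then obtain v where v: "v \<in> carrier_vec n" "v \<noteq> 0\<^sub>v n" "transpose_mat ?B *\<^sub>v v = 0\<^sub>v n"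
    using det_0_iff_vec_prod_zero[of "transpose_mat ?B" n] B by auto
  \<comment> \<open>A kernel vector of the transpose, read as a list of coefficients, is a
    polynomial of degree less than \<open>n\<close>. Row \<open>i\<close> of the system says
    \<open>u i * poly P (w i) = 0\<close>, which makes \<open>w i\<close> a root, and these are
    \<open>n\<close> distinct points.\<close>
  define P where "P = (\<Sum>j<n. monom (vec_index v j) j)"
  have "poly P (w i) = 0" if "i < n" for i
  proof -
    have "0 = vec_index (transpose_mat ?B *\<^sub>v v) i"
      using v(3) that by simp
    also have "\<dots> = (\<Sum>j<n. u i * w i ^ j * vec_index v j)"
      using that v(1) by (simp add: scalar_prod_def atLeast0LessThan mult.commute)
    also have "\<dots> = u i * poly P (w i)"
      by (simp add: P_def poly_sum poly_monom sum_distrib_left mult_ac)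
    finally show ?thesis using assms(2)[OF that] by simp
  qed
  then have sub: "w ` {..<n} \<subseteq> {x. poly P x = 0}" by auto
  have "P = 0"
  proof (rule ccontr)
    assume "P \<noteq> 0"
    then have "n \<le> card {x. poly P x = 0}"
      using card_mono[OF poly_roots_finite sub] card_image[OF assms(1)] by simp
    also have "\<dots> \<le> degree P"
      using \<open>P \<noteq> 0\<close> by (rule card_poly_roots_bound)
    finally have "n \<le> degree P" .
    moreover have "n > 0"
      using v(1,2) by (cases n) auto
    then have "degree P < n"
      unfolding P_def by (intro degree_sum_less) (auto intro: le_less_trans[OF degree_monom_le])
    ultimately show False by simp
  qed
  have "vec_index v i = 0" if "i < n" for i
  proof -
    have "0 = coeff P i" using \<open>P = 0\<close> by simp
    also have "\<dots> = (\<Sum>j<n. if j = i then vec_index v j else 0)"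
      by (simp add: P_def coeff_sum coeff_monom)
    also have "\<dots> = vec_index v i"
      using that by (simp add: sum.delta)
    finally show ?thesis by simp
  qed
  then have "v = 0\<^sub>v n" using v(1) by (intro eq_vecI) auto
  with v(2) show False by simp
qed

text \<open>
  The common zeros of the \<open>L\<close> translates of one polynomial make a determinant in \<open>x\<close> vanish; its
  leading coefficient is a Vandermonde determinant in the powers of \<open>c\<close>.
\<close>

lemma zero_estimate:
  fixes Q :: "nat \<Rightarrow> real poly" and W :: "(real \<times> real) set"
  assumes c: "c > 1" and fin: "finite W" and card: "card (fst ` W) > (K - 1) * L"
    and deg: "\<And>l. l < L \<Longrightarrow> degree (Q l) < K"
    and nz: "\<And>x y. (x, y) \<in> W \<Longrightarrow> y \<noteq> 0"
    and zero: "\<And>x y j. (x, y) \<in> W \<Longrightarrow> j < L \<Longrightarrow>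
                 (\<Sum>l<L. poly (Q l) (x + of_nat j * h) * (c ^ j * y) ^ l) = 0"
    and l: "l < L"
  shows "Q l = 0"
proof (rule ccontr)
  assume "Q l \<noteq> 0"
  \<comment> \<open>Keeping only the nonzero polynomials gives every matrix entry a nonzero leading
    coefficient; \<open>n \<le> L\<close> of the translates then form a square system.\<close>
  define \<Lambda> where "\<Lambda> = {l. l < L \<and> Q l \<noteq> 0}"
  define n where "n = card \<Lambda>"
  have "finite \<Lambda>" by (simp add: \<Lambda>_def)
  then obtain e where e: "bij_betw e {..<n} \<Lambda>"
    using ex_bij_betw_nat_finite[of \<Lambda>] by (auto simp: n_def atLeast0LessThan)
  have "n > 0"
    using \<open>Q l \<noteq> 0\<close> l \<open>finite \<Lambda>\<close> unfolding n_def \<Lambda>_def by (auto simp: card_gt_0_iff)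
  have "n \<le> L"
    using card_mono[of "{..<L}" \<Lambda>] by (auto simp: n_def \<Lambda>_def)
  have eL: "e i < L" "Q (e i) \<noteq> 0" if "i < n" for i
    using bij_betwE[OF e] that by (auto simp: \<Lambda>_def)
  define AP where "AP j i = Polynomial.smult (c ^ (j * e i)) (pcompose (Q (e i)) [:of_nat j * h, 1:])" for j i
  define Per where "Per = {p. p permutes {0..<n}}"
  define DP where "DP = (\<Sum>p\<in>Per. signof p * (\<Prod>j = 0..<n. AP j (p j)))"
  have finPer: "finite Per" unfolding Per_def by (simp add: finite_permutations)
  have pn: "p j < n" if "p \<in> Per" "j < n" for p j
    using that permutes_in_image[of p "{0..<n}" j] by (auto simp: Per_def)
  have poly_sign: "poly (signof p) x = signof p" for p :: "nat \<Rightarrow> nat" and x :: real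
    by (simp add: sign_def)
  have poly_DP: "poly DP x = det (Matrix.mat n n (\<lambda>(j, i). poly (AP j i) x))" for x
    unfolding DP_def
    by (subst det_def'[of _ n]) (auto simp: Per_def poly_sum poly_prod poly_sign pn[unfolded Per_def] intro!: sum.cong prod.cong)
  have AP_ne: "AP j i \<noteq> 0" if "i < n" for j i
    using eL[OF that] c by (auto simp: AP_def pcompose_eq_0_iff)
  have deg_AP: "degree (AP j i) = degree (Q (e i))" for i j
    using c by (simp add: AP_def degree_pcompose)
  have lc_AP: "lead_coeff (AP j i) = lead_coeff (Q (e i)) * (c ^ e i) ^ j" for i j
    using lead_coeff_comp[of "[:of_nat j * h, 1:]" "Q (e i)"]
    unfolding AP_def by (simp add: lead_coeff_smult power_mult[symmetric] mult.commute)
  \<comment> \<open>The degree of the entry in row \<open>j\<close> and column \<open>i\<close> does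
    not depend on \<open>j\<close>. All terms of the Leibniz expansion therefore have the same
    degree \<open>d\<close>, and the coefficient of \<open>DP\<close> at \<open>d\<close> is the
    determinant of the leading coefficients.\<close>
  define d where "d = (\<Sum>i = 0..<n. degree (Q (e i)))"
  have deg_prod: "degree (\<Prod>j = 0..<n. AP j (p j)) = d" if "p \<in> Per" for p
  proof -
    have "degree (\<Prod>j = 0..<n. AP j (p j)) = (\<Sum>j = 0..<n. degree (AP j (p j)))"
      by (rule degree_prod_eq_sum_degree) (use AP_ne pn[OF that] in auto)
    also have "\<dots> = (\<Sum>j = 0..<n. degree (Q (e (p j))))" by (simp add: deg_AP)
    also have "\<dots> = d"
      unfolding d_def using that sum.permute[of p "{0..<n}" "\<lambda>i. degree (Q (e i))"]
      by (simp add: Per_def o_def)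
    finally show ?thesis .
  qed
  have coeff_sign: "coeff (signof p * R) k = signof p * coeff R k" for p :: "nat \<Rightarrow> nat" and R :: "real poly" and k
    by (simp add: sign_def)
  have "coeff DP d = (\<Sum>p\<in>Per. signof p * (\<Prod>j = 0..<n. lead_coeff (AP j (p j))))"
    unfolding DP_def coeff_sum coeff_sign
    by (intro sum.cong refl) (metis deg_prod lead_coeff_prod)
  also have "\<dots> = det (Matrix.mat n n (\<lambda>(j, i). lead_coeff (Q (e i)) * (c ^ e i) ^ j))"
    by (subst det_def'[of _ n])
       (auto simp: Per_def pn[unfolded Per_def] lc_AP intro!: sum.cong prod.cong)
  also have "\<dots> \<noteq> 0"
  proof (rule det_scaled_vandermonde_nonzero)
    show "inj_on (\<lambda>i. c ^ e i) {..<n}"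
      using c e by (auto simp: inj_on_def bij_betw_def)
  qed (use eL in auto)
  finally have "DP \<noteq> 0" by auto
  have "degree DP \<le> d"
    unfolding DP_def
  proof (rule degree_sum_le[OF finPer])
    fix p assume "p \<in> Per"
    then show "degree (signof p * (\<Prod>j = 0..<n. AP j (p j))) \<le> d"
      using deg_prod[of p] by (simp add: sign_def)
  qed
  also have "d \<le> (\<Sum>i = 0..<n. K - 1)"
    unfolding d_def by (intro sum_mono) (use deg eL in fastforce)
  also have "\<dots> \<le> (K - 1) * L"
    using \<open>n \<le> L\<close> by simp
  finally have "degree DP < card (fst ` W)" using card by simp
  moreover have "fst ` W \<subseteq> {x. poly DP x = 0}"
  proof safe
    fix x y assume W: "(x, y) \<in> W"
    let ?A = "Matrix.mat n n (\<lambda>(j, i). poly (AP j i) x)"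
    \<comment> \<open>The vanishing of the translates at a point of \<open>W\<close> puts this
      vector into the kernel. It is nonzero because \<open>y\<close> is, so \<open>x\<close> is a
      root of \<open>DP\<close>.\<close>
    define v where "v = Matrix.vec n (\<lambda>i. y ^ e i)"
    have "v \<noteq> 0\<^sub>v n"
    proof
      assume "v = 0\<^sub>v n"
      then have "vec_index v 0 = 0" using \<open>n > 0\<close> by simp
      then show False using nz[OF W] \<open>n > 0\<close> by (simp add: v_def)
    qed
    moreover have "?A *\<^sub>v v = 0\<^sub>v n"
    proof (rule eq_vecI)
      fix j assume "j < dim_vec (0\<^sub>v n :: real Matrix.vec)"
      then have j: "j < n" by simp
      then have "vec_index (?A *\<^sub>v v) j = (\<Sum>i<n. poly (AP j i) x * y ^ e i)"
        by (simp add: scalar_prod_def v_def atLeast0LessThan)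
      also have "\<dots> = (\<Sum>i<n. poly (Q (e i)) (x + of_nat j * h) * (c ^ j * y) ^ e i)"
        by (intro sum.cong refl)
           (simp add: AP_def poly_pcompose power_mult_distrib power_mult algebra_simps)
      also have "\<dots> = (\<Sum>l\<in>\<Lambda>. poly (Q l) (x + of_nat j * h) * (c ^ j * y) ^ l)"
        using sum.reindex_bij_betw[OF e] .
      also have "\<dots> = (\<Sum>l<L. poly (Q l) (x + of_nat j * h) * (c ^ j * y) ^ l)"
        by (rule sum.mono_neutral_left) (auto simp: \<Lambda>_def)
      also have "\<dots> = 0"
        using zero[OF W] j \<open>n \<le> L\<close> by simp
      finally show "vec_index (?A *\<^sub>v v) j = vec_index (0\<^sub>v n) j" using j by simp
    qed simp
    moreover have "v \<in> carrier_vec n" by (simp add: v_def)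
    ultimately have "det ?A = 0"
      using det_0_iff_vec_prod_zero[of ?A n] by auto
    then show "poly DP (fst (x, y)) = 0" by (simp add: poly_DP)
  qed
  then have "card (fst ` W) \<le> card {x. poly DP x = 0}"
    by (rule card_mono[OF poly_roots_finite[OF \<open>DP \<noteq> 0\<close>]])
  then have "card (fst ` W) \<le> degree DP"
    using card_poly_roots_bound[OF \<open>DP \<noteq> 0\<close>] by linarith
  ultimately show False by simp
qed

text \<open>As the coefficients are nonnegative, each form maps vectors with entries in
  \<open>{0..X}\<close> into the interval [0, A X], which is cut into pieces of length A / X. This
  gives at most \<open>(X^2 + 1) ^ card J\<close> cells for \<open>(X + 1) ^ (2 * card J)\<close>
  vectors, so two vectors share a cell, and their difference is the solution.\<close>

lemma siegel_small_forms:
  fixes a :: "'j \<Rightarrow> 'i \<Rightarrow> real" and X :: nat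
  assumes I: "finite I" "card I = 2 * card J" and J: "finite J" "J \<noteq> {}" and X: "X \<ge> 1"
    and a: "\<And>j i. j \<in> J \<Longrightarrow> i \<in> I \<Longrightarrow> a j i \<ge> 0"
    and A: "\<And>j. j \<in> J \<Longrightarrow> (\<Sum>i\<in>I. a j i) \<le> A" and "A > 0"
  shows "\<exists>v :: 'i \<Rightarrow> int. (\<exists>i\<in>I. v i \<noteq> 0) \<and> (\<forall>i\<in>I. \<bar>v i\<bar> \<le> int X) \<and>
    (\<forall>j\<in>J. \<bar>\<Sum>i\<in>I. of_int (v i) * a j i\<bar> \<le> A / X)"
proof -
  define V where "V = I \<rightarrow>\<^sub>E {0..X}"
  define s where "s u j = (\<Sum>i\<in>I. real (u i) * a j i) * X / A" for u :: "'i \<Rightarrow> nat" and j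
  define \<phi> where "\<phi> u = restrict (\<lambda>j. nat \<lfloor>s u j\<rfloor>) J" for u
  have s: "0 \<le> s u j" "s u j \<le> real (X ^ 2)" if "u \<in> V" "j \<in> J" for u j
  proof -
    have u: "u i \<le> X" if "i \<in> I" for i using \<open>u \<in> V\<close> that by (auto simp: V_def PiE_iff)
    show "0 \<le> s u j"
      unfolding s_def using a that \<open>A > 0\<close> by (auto intro!: divide_nonneg_pos mult_nonneg_nonneg sum_nonneg)
    have "(\<Sum>i\<in>I. real (u i) * a j i) \<le> (\<Sum>i\<in>I. real X * a j i)"
      using a that u by (intro sum_mono mult_right_mono) auto
    also have "\<dots> \<le> real X * A"
      using A[OF that(2)] by (simp add: sum_distrib_left[symmetric] mult_left_mono)
    finally have "s u j \<le> (real X * A) * X / A"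
      unfolding s_def using \<open>A > 0\<close> by (intro divide_right_mono mult_right_mono) auto
    then show "s u j \<le> real (X ^ 2)" using \<open>A > 0\<close> by (simp add: power2_eq_square)
  qed
  have "\<phi> ` V \<subseteq> J \<rightarrow>\<^sub>E {0..X ^ 2}"
  proof (rule image_subsetI)
    fix u assume "u \<in> V"
    have "nat \<lfloor>s u j\<rfloor> \<le> X ^ 2" if "j \<in> J" for j
      using s[OF \<open>u \<in> V\<close> that] by (simp add: nat_le_iff floor_le_iff)
    then show "\<phi> u \<in> J \<rightarrow>\<^sub>E {0..X ^ 2}" by (auto simp: \<phi>_def)
  qed
  then have "card (\<phi> ` V) \<le> card (J \<rightarrow>\<^sub>E {0..X ^ 2})"
    by (intro card_mono finite_PiE J) auto
  also have "\<dots> = (X ^ 2 + 1) ^ card J" by (simp add: card_PiE J)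
  also have "\<dots> < ((X + 1) ^ 2) ^ card J"
    using X J by (intro power_strict_mono) (auto simp: power2_eq_square card_gt_0_iff)
  also have "\<dots> = card V" by (simp add: V_def card_PiE I power_mult)
  finally have "\<not> inj_on \<phi> V" using pigeonhole by blast
  then obtain u u' where uu: "u \<in> V" "u' \<in> V" "\<phi> u = \<phi> u'" "u \<noteq> u'"
    by (auto simp: inj_on_def)
  show ?thesis
  proof (intro exI[of _ "\<lambda>i. int (u i) - int (u' i)"] conjI ballI)
    show "\<exists>i\<in>I. int (u i) - int (u' i) \<noteq> 0"
      using uu by (auto simp: V_def intro: PiE_ext)
    show "\<bar>int (u i) - int (u' i)\<bar> \<le> int X" if "i \<in> I" for i
    proof -
      have "u i \<le> X" "u' i \<le> X" using uu(1,2) that by (auto simp: V_def PiE_iff)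
      then show ?thesis by linarith
    qed
    fix j assume j: "j \<in> J"
    have "nat \<lfloor>s u j\<rfloor> = nat \<lfloor>s u' j\<rfloor>" using fun_cong[OF uu(3), of j] j by (simp add: \<phi>_def)
    then have "\<bar>s u j - s u' j\<bar> \<le> 1"
      using s[OF uu(1) j] s[OF uu(2) j] by (simp add: nat_eq_iff) linarith
    moreover have "(\<Sum>i\<in>I. of_int (int (u i) - int (u' i)) * a j i) = (s u j - s u' j) * (A / X)"
      using \<open>A > 0\<close> X by (simp add: s_def field_simps sum_subtractf)
    ultimately show "\<bar>\<Sum>i\<in>I. of_int (int (u i) - int (u' i)) * a j i\<bar> \<le> A / X"
      using \<open>A > 0\<close> X by (auto simp: abs_mult intro!: divide_right_mono mult_left_le_one_le)
  qed
qed

section \<open>Elementary estimates for the exponential function\<close>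

lemma power_div_fact_le_exp:
  fixes x :: real
  assumes "x \<ge> 0"
  shows "x ^ t / fact t \<le> exp x"
proof -
  have s: "(\<lambda>t. x ^ t / fact t) sums exp x"
    using exp_converges[of x] by (simp add: field_simps)
  have "(\<Sum>i\<in>{t}. x ^ i / fact i) \<le> (\<Sum>i. x ^ i / fact i)"
    using assms s by (intro sum_le_suminf) (auto dest: sums_summable)
  then show ?thesis using s by (simp add: sums_iff)
qed

text \<open>Rankin's trick: for k \<ge> m one has x^k \<le> e^(-m) (e x)^k, so the tail is at most
  e^(-m) times the full series of exp (e x). The 3 is an upper bound for e.\<close>

lemma exp_Taylor_remainder_le:
  fixes x :: real
  assumes "x \<ge> 0"
  shows "\<bar>exp x - (\<Sum>t<m. x ^ t / fact t)\<bar> \<le> exp (- real m) * exp (3 * x)"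
proof -
  have s: "(\<lambda>t. y ^ t / fact t) sums exp y" for y :: real
    using exp_converges[of y] by (simp add: field_simps)
  note sx = sums_summable[OF s[of x]] and sex = sums_summable[OF s[of "exp 1 * x"]]
  have "exp x - (\<Sum>t<m. x ^ t / fact t) = (\<Sum>t. x ^ (t + m) / fact (t + m))"
    using suminf_split_initial_segment[OF sx, of m] sums_unique[OF s[of x]] by simp
  moreover have "0 \<le> (\<Sum>t. x ^ (t + m) / fact (t + m))"
    using assms by (intro suminf_nonneg summable_ignore_initial_segment sx) auto
  moreover have "(\<Sum>t. x ^ (t + m) / fact (t + m)) \<le>
      (\<Sum>t. exp (- real m) * ((exp 1 * x) ^ (t + m) / fact (t + m)))"
  proof (intro suminf_le summable_mult summable_ignore_initial_segment sx sex)
    fix t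
    have "x ^ (t + m) \<le> exp (real t) * x ^ (t + m)"
      using assms by (simp add: mult_le_cancel_right1)
    also have "\<dots> = exp (- real m) * (exp 1 * x) ^ (t + m)"
      by (simp add: power_mult_distrib exp_of_nat_mult[symmetric] exp_add[symmetric] mult.assoc[symmetric])
    finally show "x ^ (t + m) / fact (t + m) \<le> exp (- real m) * ((exp 1 * x) ^ (t + m) / fact (t + m))"
      by (simp add: divide_right_mono)
  qed
  moreover have "(\<Sum>t. exp (- real m) * ((exp 1 * x) ^ (t + m) / fact (t + m))) =
      exp (- real m) * (\<Sum>t. (exp 1 * x) ^ (t + m) / fact (t + m))"
    by (intro suminf_mult summable_ignore_initial_segment sex)
  moreover have "(\<Sum>t. (exp 1 * x) ^ (t + m) / fact (t + m)) \<le> exp (exp 1 * x)"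
    using suminf_split_initial_segment[OF sex, of m] sums_unique[OF s[of "exp 1 * x"]]
      sum_nonneg[of "{..<m}" "\<lambda>t. (exp 1 * x) ^ t / fact t"] assms by simp
  moreover have "exp (exp 1 * x) \<le> exp (3 * x)"
    using assms exp_le by (simp add: mult_right_mono)
  ultimately have "exp x - (\<Sum>t<m. x ^ t / fact t) \<le> exp (- real m) * (\<Sum>t. (exp 1 * x) ^ (t + m) / fact (t + m))"
    "(\<Sum>t. (exp 1 * x) ^ (t + m) / fact (t + m)) \<le> exp (3 * x)"
    "0 \<le> exp x - (\<Sum>t<m. x ^ t / fact t)"
    by linarith+
  moreover from this(2) have "exp (- real m) * (\<Sum>t. (exp 1 * x) ^ (t + m) / fact (t + m)) \<le> exp (- real m) * exp (3 * x)"
    by (rule mult_left_mono) simp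
  ultimately show ?thesis by linarith
qed

lemma exp_diff_le:
  fixes a b c :: real
  assumes "a \<le> c" "b \<le> c"
  shows "\<bar>exp a - exp b\<bar> \<le> \<bar>a - b\<bar> * exp c"
proof -
  have *: "exp x - exp y \<le> (x - y) * exp c" if "y \<le> x" "x \<le> c" for x y :: real
  proof -
    have "exp x - exp y = exp x * (1 - exp (y - x))"
      by (simp add: right_diff_distrib flip: exp_add)
    also have "\<dots> \<le> exp x * (x - y)"
      using exp_ge_add_one_self[of "y - x"] by (intro mult_left_mono) (linarith, simp)
    also have "\<dots> \<le> (x - y) * exp c"
      using that by (subst mult.commute) (auto intro!: mult_left_mono)
    finally show ?thesis .
  qed
  show ?thesis
    using *[of a b] *[of b a] assms by (cases "a \<le> b") auto
qed

text \<open>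
  The auxiliary polynomial has degree less than \<open>K\<close> in its first and less than \<open>L\<close> in its second
  variable, \<open>M\<close> Taylor coefficients of the auxiliary function are made small, the function is evaluated
  at the points \<open>r + s k / n\<close> with \<open>r, s < R\<close>, which are at most \<open>Z\<close>, and \<open>9 M A\<close> bounds the coefficients.
\<close>

lemma no_small_linear_form:
  fixes p q n k L D :: nat and \<tau> :: real
  defines "w \<equiv> ln (real p)" and "v \<equiv> ln (real q)"
  defines "W \<equiv> w + v + 1" and "K \<equiv> 2 * D\<^sup>2 * L" and "M \<equiv> D\<^sup>2 * L\<^sup>2" and "R \<equiv> 3 * D * L"
  defines "Z \<equiv> real R * W / w"
  defines "A \<equiv> real (K * L) * (real n * Z) ^ K * exp (real L * real R * W)"
  assumes pq: "p \<ge> 2" "q \<ge> 2" and LD: "L \<ge> 1" "D \<ge> 1" and n: "2 * D * L \<le> n" "coprime n k"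
    and small: "\<bar>real n * v - real k * w\<bar> \<le> \<tau>" and k: "real k * w \<le> real n * (v + 1)"
    and tail: "real (K * L) * (real (9 * M) * A * ((exp 1 * real n * Z) ^ K * (exp (- real M) *
                exp (3 * (real L * real R * W))))) \<le> 1 / 4"
    and err: "real (K * L) * (real (9 * M) * A * ((real n * Z) ^ K * (real L * real R * \<tau> *
                exp (real L * real R * W)))) \<le> 1 / 4"
  shows False
proof -
  let ?Y = "real L * real R * W"
  have w: "w > 0" and v: "v > 0" using pq by (auto simp: w_def v_def)
  have W: "W > w" "W > 0" using w v by (auto simp: W_def)
  have n1: "n \<ge> 1" using n(1) LD by (metis One_nat_def Suc_leI bot_nat_0.not_eq_extremum le_zero_eq mult_is_0 not_one_le_zero zero_neq_numeral)
  have R1: "R \<ge> 1" using LD by (simp add: R_def)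
  have M1: "M \<ge> 1" using LD by (simp add: M_def)
  have K1: "K \<ge> 1" using LD by (simp add: K_def)
  have Z1: "Z \<ge> 1"
  proof -
    have "w * 1 \<le> W * R" using W w R1 by (intro mult_mono) auto
    then show ?thesis using w by (simp add: Z_def field_simps)
  qed
  have wZ: "w * Z = R * W" using w by (simp add: Z_def)
  have nZ: "real n * Z \<ge> 1" using n1 Z1 mult_mono[of 1 "real n" 1 Z] by simp
  have A: "A \<ge> 1"
  proof -
    have "1 * 1 * 1 \<le> real (K * L) * (real n * Z) ^ K * exp ?Y"
      using LD K1 W nZ by (intro mult_mono one_le_power) (auto simp: Suc_le_eq simp flip: of_nat_mult)
    then show ?thesis by (simp add: A_def)
  qed
  \<comment> \<open>The \<open>M\<close> small coefficients add up to at most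
    \<open>M A / X\<close>, which this choice makes at most 1/8. Rounding up adds at most 1 \<le>
    \<open>M A\<close>, whence the bound \<open>9 M A\<close> for the coefficients.\<close>
  define X where "X = nat \<lceil>8 * M * A\<rceil>"
  have MA: "1 \<le> M * A" using M1 A mult_mono[of 1 "real M" 1 A] by simp
  have X: "8 * M * A \<le> X" "X \<le> 9 * M * A" "X \<ge> 1"
  proof -
    have "real X = of_int \<lceil>8 * M * A\<rceil>" using MA by (simp add: X_def)
    then show "8 * M * A \<le> X" "X \<le> 9 * M * A" using MA by linarith+
    then have "real X \<ge> 1" using MA by linarith
    then show "X \<ge> 1" by simp
  qed
  define I where "I = {..<K} \<times> {..<L}"
  \<comment> \<open>The relation \<open>K L = 2 M\<close> provides the two unknowns per condition
    that the pigeonhole argument asks for.\<close>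
  have cardI: "card I = 2 * card {..<M}" by (simp add: I_def K_def M_def power2_eq_square)
  have cardI': "card I = K * L" by (simp add: I_def)
  have sum_const: "(\<Sum>(i, l)\<in>I. c) = real (K * L) * c" for c :: real by (simp add: cardI')
  \<comment> \<open>The Taylor coefficient of order \<open>h\<close> of
    \<open>(n z)^i exp (l w z)\<close> at 0, rescaled by \<open>Z^h\<close>. These numbers are
    nonnegative, as the pigeonhole argument requires, and they multiply powers of
    \<open>z / Z\<close>, which lies in [0, 1].\<close>
  define a where "a h = (\<lambda>(i, l). if i \<le> h then (real n * Z) ^ i * ((real l * w * Z) ^ (h - i) / fact (h - i)) else 0)"
    for h :: nat
  have le_pow: "(real n * z) ^ i \<le> (real n * Z) ^ K" if "i < K" "0 \<le> z" "z \<le> Z" for i z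
  proof -
    have "(real n * z) ^ i \<le> (real n * Z) ^ i"
      using that by (intro power_mono mult_left_mono) auto
    also have "\<dots> \<le> (real n * Z) ^ K"
      using nZ that by (intro power_increasing) auto
    finally show ?thesis .
  qed
  have lwZ: "real l * w * z \<le> ?Y" if "l < L" "0 \<le> z" "z \<le> Z" for l z
  proof -
    have "real l * (w * z) \<le> real L * (w * Z)"
      using that w Z1 by (intro mult_mono) auto
    then show ?thesis by (simp add: wZ mult.assoc)
  qed
  have a_nonneg: "a h i \<ge> 0" for h i
    using w Z1 by (auto simp: a_def split: prod.splits)
  have a_sum: "(\<Sum>i\<in>I. a h i) \<le> A" for h
  proof -
    have "a h (i, l) \<le> (real n * Z) ^ K * exp ?Y" if "i < K" "l < L" for i l
    proof -
      have "(real l * w * Z) ^ (h - i) / fact (h - i) \<le> exp ?Y"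
        using power_div_fact_le_exp[of "real l * w * Z" "h - i"] lwZ[OF that(2), of Z] w Z1
        by (smt (verit, best) exp_le_cancel_iff mult_nonneg_nonneg of_nat_0_le_iff)
      then have "(real n * Z) ^ i * ((real l * w * Z) ^ (h - i) / fact (h - i)) \<le>
          (real n * Z) ^ K * exp ?Y"
        using le_pow[OF that(1), of Z] Z1 nZ w by (intro mult_mono) auto
      moreover have "0 \<le> (real n * Z) ^ K * exp ?Y" using nZ by simp
      ultimately show ?thesis by (auto simp: a_def)
    qed
    then have "(\<Sum>i\<in>I. a h i) \<le> (\<Sum>i\<in>I. (real n * Z) ^ K * exp ?Y)"
      by (intro sum_mono) (auto simp: I_def)
    then show ?thesis by (simp add: A_def cardI')
  qed
  have J: "finite {..<M}" "{..<M} \<noteq> {}" using M1 by (auto simp: lessThan_empty_iff)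
  have "finite I" "0 < A" using A by (auto simp: I_def)
  obtain u :: "nat \<times> nat \<Rightarrow> int" where u: "\<exists>i\<in>I. u i \<noteq> 0" "\<forall>i\<in>I. \<bar>u i\<bar> \<le> int X"
    "\<forall>h\<in>{..<M}. \<bar>\<Sum>i\<in>I. of_int (u i) * a h i\<bar> \<le> A / X"
    using siegel_small_forms[where a = a, OF \<open>finite I\<close> cardI J X(3) a_nonneg a_sum \<open>0 < A\<close>]
    by (elim exE conjE) (rule that)
  have uX: "\<bar>real_of_int (u i)\<bar> \<le> 9 * M * A" if "i \<in> I" for i
    using bspec[OF u(2) that] X(2) by linarith
  define F where "F z = (\<Sum>(i, l)\<in>I. of_int (u (i, l)) * ((real n * z) ^ i * exp (real l * w * z)))" for z
  have F_small: "\<bar>F z\<bar> \<le> 3 / 8" if z: "0 \<le> z" "z \<le> Z" for z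
  proof -
    \<comment> \<open>Truncation after \<open>M - i\<close> terms keeps the product with
      \<open>(n z)^i\<close> below degree \<open>M\<close>, so only coefficients that were made
      small occur; for \<open>i \<ge> M\<close> the sum is empty. The remainder grows by
      \<open>e^i\<close>, which is absorbed into \<open>(e n Z)^K\<close>.\<close>
    define T where "T i l = (\<Sum>t<M - i. (real l * w * z) ^ t / fact t)" for i l
    let ?F = "(\<Sum>(i, l)\<in>I. of_int (u (i, l)) * ((real n * z) ^ i * T i l))"
    have E: "F z - ?F =
        (\<Sum>(i, l)\<in>I. of_int (u (i, l)) * ((real n * z) ^ i * (exp (real l * w * z) - T i l)))"
      by (simp add: F_def sum_subtractf[symmetric] algebra_simps case_prod_unfold)
    have "\<bar>F z - ?F\<bar> \<le> (\<Sum>(i, l)\<in>I. (9 * M * A) * ((exp 1 * real n * Z) ^ K * (exp (- real M) * exp (3 * ?Y))))"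
    unfolding E
    proof (rule order.trans[OF sum_abs], rule sum_mono, clarify)
      fix i l assume il: "(i, l) \<in> I"
      then have il': "i < K" "l < L" by (auto simp: I_def)
      have "\<bar>exp (real l * w * z) - T i l\<bar> \<le> exp (- real (M - i)) * exp (3 * (real l * w * z))"
        unfolding T_def using w z by (intro exp_Taylor_remainder_le) auto
      also have "\<dots> \<le> (exp 1 ^ i * exp (- real M)) * exp (3 * ?Y)"
        using lwZ[OF il'(2) z] by (intro mult_mono) (auto simp: exp_of_nat_mult[symmetric] exp_add[symmetric])
      finally have "(real n * z) ^ i * \<bar>exp (real l * w * z) - T i l\<bar> \<le>
          (real n * Z) ^ i * ((exp 1 ^ i * exp (- real M)) * exp (3 * ?Y))"
        using z by (intro mult_mono power_mono mult_left_mono) auto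
      also have "\<dots> = (exp 1 * real n * Z) ^ i * (exp (- real M) * exp (3 * ?Y))"
        by (simp add: power_mult_distrib mult_ac)
      also have "\<dots> \<le> (exp 1 * real n * Z) ^ K * (exp (- real M) * exp (3 * ?Y))"
      proof (intro mult_right_mono power_increasing)
        show "1 \<le> exp 1 * real n * Z"
          using nZ mult_mono[of 1 "exp 1" 1 "real n * Z"] by (simp add: mult.assoc)
      qed (use il' in auto)
      finally have H: "(real n * z) ^ i * \<bar>exp (real l * w * z) - T i l\<bar> \<le>
        (exp 1 * real n * Z) ^ K * (exp (- real M) * exp (3 * ?Y))" .
      show "\<bar>real_of_int (u (i, l)) * ((real n * z) ^ i * (exp (real l * w * z) - T i l))\<bar>
          \<le> (9 * M * A) * ((exp 1 * real n * Z) ^ K * (exp (- real M) * exp (3 * ?Y)))"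
        using mult_mono[OF uX[OF il] H] z A by (simp add: abs_mult)
    qed
    also have "\<dots> \<le> 1 / 4"
      unfolding sum_const by (rule tail)
    finally have 1: "\<bar>F z - ?F\<bar> \<le> 1 / 4" .
    have shift: "(\<Sum>t<M - i. f t) = (\<Sum>h<M. if i \<le> h then f (h - i) else 0)" for i and f :: "nat \<Rightarrow> real"
    proof -
      have "(\<Sum>h<M. if i \<le> h then f (h - i) else 0) = (\<Sum>h\<in>{i..<M}. f (h - i))"
        by (subst sum.inter_filter[symmetric]) (auto intro!: sum.cong)
      also have "\<dots> = (\<Sum>t<M - i. f t)"
        by (rule sum.reindex_bij_witness[of _ "\<lambda>t. t + i" "\<lambda>h. h - i"]) auto
      finally show ?thesis by simp
    qed
    have il_eq: "(real n * z) ^ i * T i l = (\<Sum>h<M. a h (i, l) * (z / Z) ^ h)" for i l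
    proof -
      have "(real n * z) ^ i * T i l =
          (\<Sum>h<M. if i \<le> h then (real n * z) ^ i * ((real l * w * z) ^ (h - i) / fact (h - i)) else 0)"
        unfolding T_def shift sum_distrib_left by (intro sum.cong) auto
      also have "\<dots> = (\<Sum>h<M. a h (i, l) * (z / Z) ^ h)"
      proof (intro sum.cong refl)
        fix h
        have "(real n * z) ^ i * (real l * w * z) ^ (h - i) =
            (real n * Z) ^ i * (real l * w * Z) ^ (h - i) * (z / Z) ^ h" if "i \<le> h"
        proof -
          have "(real n * z) ^ i = (real n * Z) ^ i * (z / Z) ^ i"
            using Z1 by (simp flip: power_mult_distrib)
          moreover have "(real l * w * z) ^ (h - i) = (real l * w * Z) ^ (h - i) * (z / Z) ^ (h - i)"
            using Z1 by (simp add: mult.assoc flip: power_mult_distrib)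
          ultimately show ?thesis
            using that by (simp add: power_add[symmetric] mult_ac)
        qed
        then show "(if i \<le> h then (real n * z) ^ i * ((real l * w * z) ^ (h - i) / fact (h - i)) else 0) =
            a h (i, l) * (z / Z) ^ h"
          by (auto simp: a_def)
      qed
      finally show ?thesis .
    qed
    have E': "?F =
        (\<Sum>h<M. (\<Sum>i\<in>I. of_int (u i) * a h i) * (z / Z) ^ h)"
      unfolding il_eq sum_distrib_left sum_distrib_right
      by (subst sum.swap) (simp add: case_prod_unfold mult.assoc)
    have "\<bar>?F\<bar> \<le> (\<Sum>h<M. A / X * 1)"
      unfolding E'
    proof (rule order.trans[OF sum_abs], rule sum_mono)
      fix h assume "h \<in> {..<M}"
      then show "\<bar>(\<Sum>i\<in>I. of_int (u i) * a h i) * (z / Z) ^ h\<bar> \<le> A / X * 1"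
        unfolding abs_mult using bspec[OF u(3), of h] z Z1
        by (intro mult_mono) (auto intro!: power_le_one)
    qed
    also have "\<dots> \<le> 1 / 8" using X by (simp add: field_simps)
    finally show ?thesis using 1 by linarith
  qed
  define G where "G r s = (\<Sum>(i, l)\<in>I. u (i, l) * int ((r * n + s * k) ^ i * (p ^ r * q ^ s) ^ l))" for r s
  have exp_p: "real p = exp w" and exp_q: "real q = exp v" using pq by (auto simp: w_def v_def)
  have kn: "real k * w / n \<le> v + 1" using k n1 by (simp add: field_simps)
  have G0: "G r s = 0" if rs: "r < R" "s < R" for r s
  proof -
    \<comment> \<open>At this point \<open>n z\<close> is exactly the integer
      \<open>r n + s k\<close>, so the first arguments of the polynomial agree in \<open>F\<close>
      and \<open>G\<close>. The exponents differ by \<open>(l s / n) (n v - k w)\<close>, hence by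
      at most \<open>L R \<tau>\<close>.\<close>
    define z where "z = r + s * real k / n"
    have wz: "w * z = r * w + s * (real k * w / n)" by (simp add: z_def algebra_simps)
    have "w * z \<le> R * w + R * (v + 1)"
      unfolding wz using rs kn w n1 by (intro add_mono mult_mono) auto
    then have wz_le: "w * z \<le> R * W" by (simp add: W_def algebra_simps)
    then have z: "0 \<le> z" "z \<le> Z" using w by (auto simp: z_def Z_def field_simps)
    have nz: "real n * z = real (r * n + s * k)" using n1 by (simp add: z_def field_simps)
    have E: "real_of_int (G r s) - F z =
       (\<Sum>(i, l)\<in>I. of_int (u (i, l)) * ((real n * z) ^ i * (exp (real l * (r * w + s * v)) - exp (real l * w * z))))"
      unfolding G_def F_def nz of_int_sum sum_subtractf[symmetric]
      by (intro sum.cong refl)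
         (auto simp: exp_p exp_q algebra_simps exp_add power_mult_distrib simp flip: exp_of_nat_mult)
    have "\<bar>real_of_int (G r s) - F z\<bar> \<le> (\<Sum>(i, l)\<in>I. (9 * M * A) * ((real n * Z) ^ K * (real L * real R * \<tau> * exp ?Y)))"
    unfolding E
    proof (rule order.trans[OF sum_abs], rule sum_mono, clarify)
      fix i l assume il: "(i, l) \<in> I"
      then have il': "i < K" "l < L" by (auto simp: I_def)
      have "r * w + s * v \<le> R * w + R * v"
        using rs w v by (intro add_mono mult_right_mono) auto
      also have "\<dots> \<le> R * W" by (simp add: W_def algebra_simps)
      finally have rs_le: "r * w + s * v \<le> R * W" .
      have le: "real l * x \<le> ?Y" if "x \<le> R * W" for x
      proof -
        have "real l * x \<le> real l * (R * W)" using that by (intro mult_left_mono) auto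
        also have "\<dots> \<le> real L * (R * W)" using il' W by (intro mult_right_mono) auto
        finally show ?thesis by (simp add: mult.assoc)
      qed
      have "real l * (r * w + s * v) - real l * w * z = (real l * s / n) * (real n * v - real k * w)"
        using n1 by (simp add: z_def field_simps)
      also have "\<bar>\<dots>\<bar> \<le> (real L * real R) * \<tau>"
        unfolding abs_mult
      proof (intro mult_mono small)
        have "real l * s / n \<le> real L * R / 1"
          using il' rs n1 by (intro frac_le mult_mono) auto
        then show "\<bar>real l * s / n\<bar> \<le> real L * real R" by simp
      qed auto
      finally have d: "\<bar>real l * (r * w + s * v) - real l * w * z\<bar> \<le> real L * real R * \<tau>" .
      have e2: "real l * w * z \<le> ?Y"
        using le[OF wz_le] by (simp only: mult.assoc)
      have "\<bar>exp (real l * (r * w + s * v)) - exp (real l * w * z)\<bar> \<le>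
          \<bar>real l * (r * w + s * v) - real l * w * z\<bar> * exp ?Y"
        by (rule exp_diff_le[OF le[OF rs_le] e2])
      also have "\<dots> \<le> real L * real R * \<tau> * exp ?Y"
        using d by (intro mult_right_mono) auto
      finally have H: "(real n * z) ^ i * \<bar>exp (real l * (r * w + s * v)) - exp (real l * w * z)\<bar> \<le>
          (real n * Z) ^ K * (real L * real R * \<tau> * exp ?Y)"
        using le_pow[OF il'(1) z] z nZ by (intro mult_mono) auto
      show "\<bar>real_of_int (u (i, l)) * ((real n * z) ^ i * (exp (real l * (r * w + s * v)) - exp (real l * w * z)))\<bar>
        \<le> (9 * M * A) * ((real n * Z) ^ K * (real L * real R * \<tau> * exp ?Y))"
        using mult_mono[OF uX[OF il] H] z A by (simp add: abs_mult)
    qed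
    also have "\<dots> \<le> 1 / 4"
      unfolding sum_const by (rule err)
    \<comment> \<open>The linear form contributes at most 1/4 and \<open>F\<close> itself at most
      3/8; an integer of modulus below 1 vanishes.\<close>
    finally have "\<bar>real_of_int (G r s)\<bar> < 1"
      using F_small[OF z] by linarith
    then show ?thesis by linarith
  qed
  define Q where "Q l = (\<Sum>i<K. monom (real_of_int (u (i, l))) i)" for l
  \<comment> \<open>The pairs in \<open>S \<times> S\<close> give 4 D^2 L^2 abscissae, more than
    \<open>(K - 1) L\<close> < 2 D^2 L^2. They are distinct: equal values of
    \<open>r n + s k\<close> force \<open>s = s'\<close> modulo \<open>n\<close> by coprimality, and
    \<open>2 D L \<le> n\<close>. The gap between \<open>2 D L\<close> and \<open>R = 3 D L\<close>
    leaves room for the translations of \<open>r\<close> by \<open>j < L\<close>.\<close>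
  define S where "S = {..<2 * D * L}"
  define Pts where "Pts = (\<lambda>(r, s). (real (r * n + s * k), real (p ^ r * q ^ s))) ` (S \<times> S)"
  have Q0: "Q l = 0" if "l < L" for l
  proof (rule zero_estimate[where W = Pts and K = K and L = L and c = "real p" and h = "real n"])
    show "finite Pts" by (simp add: Pts_def S_def)
    have inj: "inj_on (\<lambda>(r, s). real (r * n + s * k)) (S \<times> S)"
    proof (rule inj_onI, clarify)
      fix r s r' s' assume rs: "r \<in> S" "s \<in> S" "r' \<in> S" "s' \<in> S"
        and "real (r * n + s * k) = real (r' * n + s' * k)"
      then have eq: "r * n + s * k = r' * n + s' * k" by (metis of_nat_eq_iff)
      then have "[s * k = s' * k] (mod n)"
        unfolding cong_def by (metis mod_mult_self3)
      then have "[s = s'] (mod n)"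
        using n(2) by (simp add: cong_mult_rcancel_nat coprime_commute)
      then have "s = s'"
        using rs n(1) by (auto simp: S_def cong_def)
      then show "r = r' \<and> s = s'" using eq n1 by auto
    qed
    have "fst ` Pts = (\<lambda>(r, s). real (r * n + s * k)) ` (S \<times> S)"
      by (force simp: Pts_def image_iff)
    then have "card (fst ` Pts) = (2 * D * L) * (2 * D * L)"
      using card_image[OF inj] by (simp add: S_def)
    moreover have "(K - 1) * L < (2 * D * L) * (2 * D * L)"
    proof -
      have "(K - 1) * L < K * L" using K1 LD by simp
      also have "\<dots> \<le> (2 * D * L) * (2 * D * L)" by (simp add: K_def power2_eq_square)
      finally show ?thesis .
    qed
    ultimately show "(K - 1) * L < card (fst ` Pts)" by simp
    show "degree (Q l) < K" for l
      unfolding Q_def using K1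
      by (intro degree_sum_less) (auto intro: le_less_trans[OF degree_monom_le])
    show "y \<noteq> 0" if "(x, y) \<in> Pts" for x y
      using that pq by (auto simp: Pts_def)
    fix x y j assume xy: "(x, y) \<in> Pts" and j: "j < L"
    then obtain r s where rs: "r \<in> S" "s \<in> S" "x = real (r * n + s * k)" "y = real (p ^ r * q ^ s)"
      by (auto simp: Pts_def)
    have lt: "r + j < R" "s < R"
    proof -
      have "2 * D * L + L \<le> R" using LD by (simp add: R_def)
      then show "r + j < R" "s < R" using rs j by (auto simp: S_def)
    qed
    have "0 = real_of_int (G (r + j) s)" using G0[OF lt] by simp
    also have "\<dots> = (\<Sum>(i, l)\<in>I. real_of_int (u (i, l)) * ((x + real j * real n) ^ i * (real p ^ j * y) ^ l))"
      unfolding G_def of_int_sum rs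
      by (intro sum.cong refl) (auto simp: algebra_simps power_add)
    also have "\<dots> = (\<Sum>i<K. \<Sum>l<L. real_of_int (u (i, l)) * ((x + real j * real n) ^ i * (real p ^ j * y) ^ l))"
      unfolding I_def by (simp add: sum.cartesian_product)
    also have "\<dots> = (\<Sum>l<L. poly (Q l) (x + real j * real n) * (real p ^ j * y) ^ l)"
      by (subst sum.swap) (simp add: Q_def poly_sum poly_monom sum_distrib_right mult.assoc)
    finally show "(\<Sum>l<L. poly (Q l) (x + real j * real n) * (real p ^ j * y) ^ l) = 0" by simp
  qed (use pq that in auto)
  have "u (i, l) = 0" if "i < K" "l < L" for i l
  proof -
    have "0 = coeff (Q l) i" using Q0[OF that(2)] by simp
    also have "\<dots> = real_of_int (u (i, l))"
      using that by (simp add: Q_def coeff_sum coeff_monom sum.delta)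
    finally show ?thesis by simp
  qed
  then show False using u(1) by (auto simp: I_def)
qed


text \<open>With \<open>D\<close> fixed and \<open>x = L\<close>, the logarithm of the tail
  condition is 12 d W x^2 - d^2 x^2 + O(x ln x), and that of the condition on the linear form is 6 d
  W x^2 - \<epsilon> x^3 + O(x ln x). Both tend to minus infinity. Coprimality makes the evaluation
  points distinct.\<close>

lemma linear_form_lower_bound_coprime:
  fixes p q :: nat and \<epsilon> :: real
  assumes pq: "p \<ge> 2" "q \<ge> 2" and \<epsilon>: "\<epsilon> > 0"
  shows "\<exists>n0. \<forall>n\<ge>n0. \<forall>k. coprime n k \<longrightarrow> exp (- \<epsilon> * real n) \<le> \<bar>real n * ln (real q) - real k * ln (real p)\<bar>"
proof -
  define w where "w = ln (real p)"
  define v where "v = ln (real q)"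
  define W where "W = w + v + 1"
  have w: "w > 0" and v: "v > 0" using pq by (auto simp: w_def v_def)
  have W: "W > w" "W > 0" using w v by (auto simp: W_def)
  \<comment> \<open>In the tail condition the exponentials cost 12 d W x^2, namely 3 d W x^2 through
    the coefficients and 9 d W x^2 through the remainder. The choice \<open>24 W \<le> d\<close>
    leaves half of d^2 x^2.\<close>
  obtain D :: nat where D: "24 * W \<le> real D" using real_arch_simple by blast
  define d where "d = real D"
  have d: "d > 0" "24 * W \<le> d" using D W by (auto simp: d_def)
  define c where "c = 3 * d * W / w"
  have c: "c > 0" using d W w by (simp add: c_def)
  \<comment> \<open>\<open>f1\<close> and \<open>f2\<close> are logarithms of upper bounds for the
    left sides of the conditions \<open>tail\<close> and \<open>err\<close>. The inner logarithm is
    taken of a bound for \<open>3 n Z\<close>, where \<open>Z = c x\<close>,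
    \<open>n \<le> (x + 1)^3\<close> and 3 stands for e; the coefficient 4 d^2 x is
    \<open>2 K\<close>.\<close>
  define f1 where "f1 x = ln (36 * d ^ 6 * x ^ 6) + 4 * d\<^sup>2 * x * ln (3 * (c * x * (x + 1) ^ 3)) - d\<^sup>2 * x\<^sup>2 / 2" for x
  define f2 where "f2 x = ln (108 * d ^ 7 * x ^ 8) + 4 * d\<^sup>2 * x * ln (3 * (c * x * (x + 1) ^ 3)) + 6 * d * x\<^sup>2 * W - \<epsilon> * x ^ 3" for x
  have "filterlim f1 at_bot at_top" unfolding f1_def using d c by real_asymp
  then have "eventually (\<lambda>x. f1 x \<le> ln (1 / 4)) at_top" by (simp add: filterlim_at_bot)
  moreover have "filterlim f2 at_bot at_top" unfolding f2_def using d c W \<epsilon> by real_asymp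
  then have "eventually (\<lambda>x. f2 x \<le> ln (1 / 4)) at_top" by (simp add: filterlim_at_bot)
  moreover have "eventually (\<lambda>x. 2 * d * x \<le> x ^ 3) at_top" using d by real_asymp
  moreover have "eventually (\<lambda>x :: real. x \<ge> 1) at_top" "eventually (\<lambda>x. 3 * (c * x * (x + 1) ^ 3) \<ge> 1) at_top"
    using c by real_asymp+
  ultimately have "eventually (\<lambda>x. f1 x \<le> ln (1 / 4) \<and> f2 x \<le> ln (1 / 4) \<and> 2 * d * x \<le> x ^ 3 \<and> x \<ge> 1 \<and>
      3 * (c * x * (x + 1) ^ 3) \<ge> 1) at_top" by eventually_elim auto
  then obtain x0 where x0: "\<And>x. x \<ge> x0 \<Longrightarrow> f1 x \<le> ln (1 / 4) \<and> f2 x \<le> ln (1 / 4) \<and> 2 * d * x \<le> x ^ 3 \<and> x \<ge> 1 \<and>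
      3 * (c * x * (x + 1) ^ 3) \<ge> 1"
    by (auto simp: eventually_at_top_linorder)
  define L0 where "L0 = nat \<lceil>x0\<rceil>"
  have L0: "real L \<ge> x0" if "L \<ge> L0" for L
    using that by (simp add: L0_def)
  show ?thesis
  proof (intro exI[of _ "L0 ^ 3"] allI impI, rule ccontr)
    fix n k :: nat assume n: "L0 ^ 3 \<le> n" and cop: "coprime n k"
      and "\<not> exp (- \<epsilon> * real n) \<le> \<bar>real n * ln (real q) - real k * ln (real p)\<bar>"
    then have small: "\<bar>real n * v - real k * w\<bar> \<le> exp (- \<epsilon> * real n)"
      by (simp add: v_def w_def)
    \<comment> \<open>\<open>L\<close> of order \<open>n\<^sup>1\<^sup>/\<^sup>3\<close> suffices: the argument yields a lower bound \<open>exp (- O(L\<^sup>2))\<close> once \<open>L\<close> exceeds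
        a multiple of \<open>ln n\<close>.\<close>
    define L where "L = (GREATEST L. L ^ 3 \<le> n)"
    have bound: "y \<le> n" if "y ^ 3 \<le> n" for y :: nat
      using that self_le_power[of y 3] by (cases "y = 0") auto
    have L: "L ^ 3 \<le> n" unfolding L_def
      by (rule GreatestI_nat[of "\<lambda>L. L ^ 3 \<le> n" L0 n]) (use n bound in auto)
    have L_max: "y \<le> L" if "y ^ 3 \<le> n" for y
      unfolding L_def by (rule Greatest_le_nat[of "\<lambda>L. L ^ 3 \<le> n" y n]) (use bound that in auto)
    have nL: "n < (L + 1) ^ 3"
    proof (rule ccontr)
      assume "\<not> n < (L + 1) ^ 3"
      then have "L + 1 \<le> L" by (intro L_max) simp
      then show False by simp
    qed
    define x where "x = real L"
    have x: "f1 x \<le> ln (1 / 4)" "f2 x \<le> ln (1 / 4)" "2 * d * x \<le> x ^ 3" "x \<ge> 1" "3 * (c * x * (x + 1) ^ 3) \<ge> 1"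
      using x0[OF L0[OF L_max[OF n]]] by (auto simp: x_def)
    have Lr: "x ^ 3 \<le> real n" "real n \<le> (x + 1) ^ 3"
    proof -
      show "x ^ 3 \<le> real n" using L unfolding x_def by (metis of_nat_le_iff of_nat_power)
      have "real n \<le> real ((L + 1) ^ 3)" using nL by (simp del: of_nat_power of_nat_add)
      then show "real n \<le> (x + 1) ^ 3" by (simp add: x_def add.commute)
    qed
    have L1: "L \<ge> 1" "D \<ge> 1" using x(4) d by (auto simp: x_def d_def)
    have n1: "real n \<ge> 1"
    proof -
      have "1 \<le> x ^ 3" using x(4) by simp
      then show ?thesis using Lr by linarith
    qed
    define y where "y = 3 * (c * x * (x + 1) ^ 3)"
    have y: "y \<ge> 1" using x by (simp add: y_def)
    define K where "K = 2 * D\<^sup>2 * L"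
    define Z where "Z = real (3 * D * L) * W / w"
    have Zc: "Z = c * x" by (simp add: Z_def c_def d_def x_def)
    have nZ0: "0 \<le> real n * Z" using c x by (simp add: Zc)
    have "c * x * n \<le> c * x * (x + 1) ^ 3"
      using Lr c x by (intro mult_left_mono) auto
    then have nZ3: "3 * (real n * Z) \<le> y" by (simp add: Zc y_def mult_ac)
    have P1: "(real n * Z) ^ K \<le> y ^ K"
      using nZ3 nZ0 by (intro power_mono) auto
    have P2: "(exp 1 * real n * Z) ^ K \<le> y ^ K"
    proof (intro power_mono)
      have "exp 1 * (real n * Z) \<le> 3 * (real n * Z)"
        using nZ0 exp_le by (intro mult_right_mono) auto
      then show "exp 1 * real n * Z \<le> y" using nZ3 by (simp add: mult.assoc)
    qed (use nZ0 in \<open>simp add: mult.assoc\<close>)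
    have yK: "y ^ K * y ^ K = exp (4 * d\<^sup>2 * x * ln y)"
    proof -
      have "y = exp (ln y)" using y by simp
      then have "y ^ K * y ^ K = exp (ln y) ^ (2 * K)" by (metis mult_2 power_add)
      also have "\<dots> = exp (real (2 * K) * ln y)" by (simp only: exp_of_nat_mult)
      finally show ?thesis by (simp add: K_def d_def x_def)
    qed
    have N: "real (K * L) = 2 * d\<^sup>2 * x\<^sup>2" by (simp add: K_def d_def x_def power2_eq_square)
    have M: "real (D\<^sup>2 * L\<^sup>2) = d\<^sup>2 * x\<^sup>2" by (simp add: d_def x_def)
    have M9: "real (9 * (D\<^sup>2 * L\<^sup>2)) = 9 * (d\<^sup>2 * x\<^sup>2)" by (simp add: d_def x_def)
    have R: "real (3 * D * L) = 3 * d * x" by (simp add: d_def x_def)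
    define E where "E = exp (3 * d * x\<^sup>2 * W)"
    have E: "exp (real L * real (3 * D * L) * W) = E" "E > 0"
      by (simp_all add: E_def d_def x_def power2_eq_square mult_ac)
    define A where "A = real (K * L) * (real n * Z) ^ K * exp (real L * real (3 * D * L) * W)"
    have A: "A \<le> 2 * d\<^sup>2 * x\<^sup>2 * y ^ K * E"
      unfolding A_def N E(1) using P1 x y E(2) by (intro mult_right_mono mult_left_mono) auto
    have A0: "A \<ge> 0" using nZ0 by (simp add: A_def)
    let ?err = "real (K * L) * (real (9 * (D\<^sup>2 * L\<^sup>2)) * A * ((real n * Z) ^ K * (real L * real (3 * D * L) * exp (- \<epsilon> * real n) *
                exp (real L * real (3 * D * L) * W))))"
    let ?tail = "real (K * L) * (real (9 * (D\<^sup>2 * L\<^sup>2)) * A * ((exp 1 * real n * Z) ^ K * (exp (- real (D\<^sup>2 * L\<^sup>2)) *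
                exp (3 * (real L * real (3 * D * L) * W)))))"
    have C1: "real (K * L) * (real (9 * (D\<^sup>2 * L\<^sup>2)) * A) \<le> 36 * d ^ 6 * x ^ 6 * y ^ K * E"
    proof -
      have "real (K * L) * (real (9 * (D\<^sup>2 * L\<^sup>2)) * A) \<le> 2 * d\<^sup>2 * x\<^sup>2 * (9 * (d\<^sup>2 * x\<^sup>2) * (2 * d\<^sup>2 * x\<^sup>2 * y ^ K * E))"
        unfolding N M9 using A by (intro mult_left_mono) auto
      also have "\<dots> = 36 * d ^ 6 * x ^ 6 * y ^ K * E" by (simp add: eval_nat_numeral)
      finally show ?thesis .
    qed
    have "?tail =
          (real (K * L) * (real (9 * (D\<^sup>2 * L\<^sup>2)) * A)) * ((exp 1 * real n * Z) ^ K * (exp (- (d\<^sup>2 * x\<^sup>2)) *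
                exp (9 * d * x\<^sup>2 * W)))"
      unfolding M R by (simp add: x_def power2_eq_square mult_ac)
    also have "\<dots> \<le> (36 * d ^ 6 * x ^ 6 * y ^ K * E) * (y ^ K * (exp (- (d\<^sup>2 * x\<^sup>2)) *
                exp (9 * d * x\<^sup>2 * W)))"
    proof (rule mult_mono[OF C1 mult_right_mono[OF P2]])
      show "0 \<le> 36 * d ^ 6 * x ^ 6 * y ^ K * E"
        using d(1) x(4) y E(2) by simp
      show "0 \<le> (exp 1 * real n * Z) ^ K * (exp (- (d\<^sup>2 * x\<^sup>2)) * exp (9 * d * x\<^sup>2 * W))"
        using nZ0 by (simp add: mult.assoc)
    qed simp
    also have "\<dots> = (36 * d ^ 6 * x ^ 6) * (y ^ K * y ^ K) * (E * exp (9 * d * x\<^sup>2 * W) * exp (- (d\<^sup>2 * x\<^sup>2)))"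
      by (simp only: mult_ac)
    also have "\<dots> = exp (ln (36 * d ^ 6 * x ^ 6) + 4 * d\<^sup>2 * x * ln y + (12 * d * x\<^sup>2 * W - d\<^sup>2 * x\<^sup>2))"
      unfolding yK E_def using d x by (simp add: exp_add [symmetric] exp_diff exp_minus field_simps) (simp add: exp_add)
    also have "\<dots> \<le> exp (f1 x)"
    proof -
      have "12 * W * (d * x\<^sup>2) \<le> d / 2 * (d * x\<^sup>2)"
        using d by (intro mult_right_mono) auto
      then show ?thesis by (simp add: f1_def y_def power2_eq_square mult_ac)
    qed
    also have "\<dots> \<le> exp (ln (1 / 4))" using x(1) by (simp only: exp_le_cancel_iff)
    also have "\<dots> = 1 / 4" by simp
    finally have tail: "?tail \<le> 1 / 4" .
    have "?err =
          (real (K * L) * (real (9 * (D\<^sup>2 * L\<^sup>2)) * A)) * ((real n * Z) ^ K * (3 * d * x\<^sup>2 * exp (- \<epsilon> * real n) * E))"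
      unfolding E(1) unfolding R by (simp add: x_def power2_eq_square mult_ac)
    also have "\<dots> \<le> (36 * d ^ 6 * x ^ 6 * y ^ K * E) * (y ^ K * (3 * d * x\<^sup>2 * exp (- \<epsilon> * x ^ 3) * E))"
    proof (rule mult_mono[OF C1 mult_mono[OF P1]])
      show "0 \<le> 36 * d ^ 6 * x ^ 6 * y ^ K * E"
        using d(1) x(4) y E(2) by simp
      show "3 * d * x\<^sup>2 * exp (- \<epsilon> * real n) * E \<le> 3 * d * x\<^sup>2 * exp (- \<epsilon> * x ^ 3) * E"
        using d(1) E(2) \<epsilon> Lr by (intro mult_right_mono mult_left_mono) auto
    qed (use d(1) y nZ0 E(2) in auto)
    also have "\<dots> = (108 * d ^ 7 * x ^ 8) * (y ^ K * y ^ K) * (E * E * exp (- \<epsilon> * x ^ 3))"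
      by (simp add: eval_nat_numeral)
    also have "\<dots> = exp (ln (108 * d ^ 7 * x ^ 8) + 4 * d\<^sup>2 * x * ln y + (6 * d * x\<^sup>2 * W - \<epsilon> * x ^ 3))"
      unfolding yK E_def using d x by (simp add: exp_add [symmetric] exp_diff exp_minus field_simps) (simp add: exp_add)
    also have "\<dots> = exp (f2 x)" by (simp add: f2_def y_def)
    also have "\<dots> \<le> exp (ln (1 / 4))" using x(2) by (simp only: exp_le_cancel_iff)
    also have "\<dots> = 1 / 4" by simp
    finally have err: "?err \<le> 1 / 4" .
    have "exp (- \<epsilon> * real n) \<le> 1" using \<epsilon> by simp
    then have "real k * w \<le> real n * v + 1" using small by linarith
    then have kw: "real k * w \<le> real n * (v + 1)" using n1 by (simp add: distrib_left)
    have DLn: "2 * D * L \<le> n"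
    proof -
      have "2 * d * x \<le> real n" using x(3) Lr by linarith
      then have "real (2 * D * L) \<le> real n" by (simp add: d_def x_def)
      then show ?thesis by (simp only: of_nat_le_iff)
    qed
    show False
      by (rule no_small_linear_form[OF pq L1 DLn cop small[unfolded w_def v_def] kw[unfolded w_def v_def]
            tail[unfolded A_def Z_def K_def W_def w_def v_def] err[unfolded A_def Z_def K_def W_def w_def v_def]])
  qed
qed

text \<open>Common factors only help: division by the gcd makes the form smaller and the claimed
  bound larger. For coprime pairs with small \<open>n\<close> a constant suffices, since no form
  vanishes, by unique factorisation.\<close>

lemma linear_form_lower_bound:
  fixes p q :: nat and \<epsilon> :: real
  assumes pq: "prime p" "prime q" "p \<noteq> q" and \<epsilon>: "\<epsilon> > 0"
  shows "\<exists>C>0. \<forall>n\<ge>1. \<forall>k. C * exp (- \<epsilon> * real n) \<le> \<bar>real n * ln (real q) - real k * ln (real p)\<bar>"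
proof -
  have pq2: "p \<ge> 2" "q \<ge> 2" using pq by (auto simp: prime_ge_2_nat)
  define w where "w = ln (real p)"
  define v where "v = ln (real q)"
  have w: "w > 0" and v: "v > 0" using pq2 by (auto simp: w_def v_def)
  obtain n0 where n0: "\<And>n k. n \<ge> n0 \<Longrightarrow> coprime n k \<Longrightarrow> exp (- \<epsilon> * real n) \<le> \<bar>real n * v - real k * w\<bar>"
    using linear_form_lower_bound_coprime[OF pq2 \<epsilon>] unfolding w_def v_def by blast
  have ne: "real n * v - real k * w \<noteq> 0" if "n \<ge> 1" for n k
  proof
    assume "real n * v - real k * w = 0"
    then have "ln (real (q ^ n)) = ln (real (p ^ k))" using pq2 by (simp add: w_def v_def ln_realpow)
    then have "q ^ n = p ^ k" using pq2 by (simp del: of_nat_power)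
    then have "q dvd p ^ k" using that by (metis dvd_power gr0I not_one_le_zero)
    then have "q dvd p" using pq prime_dvd_power by blast
    then show False using pq primes_dvd_imp_eq by blast
  qed
  \<comment> \<open>For \<open>n \<le> n0\<close> and \<open>k > k0\<close> the form is at least 1
    in modulus, so a minimum over finitely many pairs remains. The extra element 1 of
    \<open>S\<close> ensures \<open>C \<le> 1\<close>.\<close>
  define k0 where "k0 = nat \<lceil>(real n0 * v + 1) / w\<rceil>"
  define S where "S = insert 1 ((\<lambda>(n, k). \<bar>real n * v - real k * w\<bar>) ` ({1..n0} \<times> {..k0}))"
  define C where "C = Min S"
  have finS: "finite S" by (simp add: S_def)
  have "C > 0" using finS ne by (auto simp: C_def S_def)
  have C1: "C \<le> 1" using finS by (simp add: C_def S_def)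
  have cop: "C * exp (- \<epsilon> * real n) \<le> \<bar>real n * v - real k * w\<bar>" if n: "n \<ge> 1" and "coprime n k" for n k
  proof (cases "n \<ge> n0")
    case True
    have "C * exp (- \<epsilon> * real n) \<le> 1 * exp (- \<epsilon> * real n)" using C1 by (intro mult_right_mono) auto
    then show ?thesis using n0[OF True \<open>coprime n k\<close>] by linarith
  next
    case False
    have "C \<le> \<bar>real n * v - real k * w\<bar>"
    proof (cases "k \<le> k0")
      case True
      then show ?thesis using finS False n unfolding C_def by (intro Min_le) (auto simp: S_def)
    next
      case False': False
      have "(real n0 * v + 1) / w \<le> k0" by (simp add: k0_def) linarith
      also have "real k0 \<le> real k" using False' by simp
      finally have "real n0 * v + 1 \<le> real k * w" using w by (simp add: field_simps)
      moreover have "real n * v \<le> real n0 * v" using v False by (intro mult_right_mono) auto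
      ultimately show ?thesis using C1 by linarith
    qed
    moreover have "C * exp (- \<epsilon> * real n) \<le> C * 1" using \<open>C > 0\<close> \<epsilon> by (intro mult_left_mono) auto
    ultimately show ?thesis by simp
  qed
  have "C * exp (- \<epsilon> * real n) \<le> \<bar>real n * v - real k * w\<bar>" if n: "n \<ge> 1" for n k
  proof -
    define g where "g = gcd n k"
    have g: "g \<ge> 1" using n by (simp add: g_def Suc_le_eq)
    obtain n' k' where nk: "n = n' * g" "k = k' * g" "coprime n' k'"
      using gcd_coprime_exists[of n k] n unfolding g_def by auto
    have n': "n' \<ge> 1" using n nk by (cases n') auto
    have "C * exp (- \<epsilon> * real n) \<le> C * exp (- \<epsilon> * real n')"
    proof -
      have "real n' * 1 \<le> real n' * real g" using g by (intro mult_left_mono) auto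
      then show ?thesis using \<open>C > 0\<close> \<epsilon> by (simp add: nk(1))
    qed
    also have "\<dots> \<le> 1 * \<bar>real n' * v - real k' * w\<bar>" using cop[OF n' nk(3)] by simp
    also have "\<dots> \<le> real g * \<bar>real n' * v - real k' * w\<bar>" using g by (intro mult_right_mono) auto
    also have "\<dots> = \<bar>real g * (real n' * v - real k' * w)\<bar>" by (simp add: abs_mult)
    also have "real g * (real n' * v - real k' * w) = real n * v - real k * w" by (simp add: nk algebra_simps)
    finally show ?thesis .
  qed
  then show ?thesis using \<open>C > 0\<close> unfolding w_def v_def by blast
qed

section \<open>Lower bounds for the Euler factors\<close>

text \<open>The bound is uniform in \<open>r\<close>, so that it later holds for all real parts at
  once. With \<open>u = sin^2 (\<theta> / 2)\<close> the squared modulus is (1 - r)^2 + 4 r u. For r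
  \<ge> 1/4 the second term alone exceeds \<open>u\<close>; otherwise \<open>u \<le> 1\<close>
  reduces the claim to 0 \<le> r^2 + 2 r.\<close>

lemma norm_one_minus_rcis_ge:
  assumes "r \<ge> 0"
  shows "\<bar>sin (\<theta> / 2)\<bar> \<le> norm (1 - of_real r * cis \<theta>)"
proof (rule power2_le_imp_le)
  define u where "u = (sin (\<theta> / 2))\<^sup>2"
  have u: "0 \<le> u" "u \<le> 1" by (simp_all add: u_def abs_square_le_1)
  have alg: "(1 - r * c)\<^sup>2 + (r * s)\<^sup>2 = 1 - 2 * r * c + r\<^sup>2 * (s\<^sup>2 + c\<^sup>2)" for c s :: real
    by (simp add: power2_eq_square algebra_simps)
  have cos_u: "cos \<theta> = 1 - 2 * u"
    using cos_double_sin[of "\<theta> / 2"] by (simp add: u_def)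
  have "(norm (1 - of_real r * cis \<theta>))\<^sup>2 = (1 - r * cos \<theta>)\<^sup>2 + (r * sin \<theta>)\<^sup>2"
    by (simp add: cmod_power2)
  then have "(norm (1 - of_real r * cis \<theta>))\<^sup>2 = 1 - 2 * r * cos \<theta> + r\<^sup>2 * ((sin \<theta>)\<^sup>2 + (cos \<theta>)\<^sup>2)"
    by (simp only: alg)
  then have "(norm (1 - of_real r * cis \<theta>))\<^sup>2 = 1 - 2 * r * cos \<theta> + r\<^sup>2"
    by (simp only: sin_cos_squared_add mult_1_right)
  then have "(norm (1 - of_real r * cis \<theta>))\<^sup>2 = (1 - r)\<^sup>2 + 4 * r * u"
    unfolding cos_u by (simp only: power2_eq_square algebra_simps)
  moreover have "u \<le> (1 - r)\<^sup>2 + 4 * r * u"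
  proof (cases "r \<ge> 1 / 4")
    case True
    have "1 * u \<le> 4 * r * u" using True u by (intro mult_right_mono) auto
    then show ?thesis using zero_le_power2[of "1 - r"] by linarith
  next
    case False
    have "(1 - 4 * r) * u \<le> (1 - 4 * r) * 1" using False u by (intro mult_left_mono) auto
    moreover have "0 \<le> r\<^sup>2 + 2 * r" using assms by simp
    ultimately show ?thesis by (simp add: power2_eq_square algebra_simps)
  qed
  ultimately show "\<bar>sin (\<theta> / 2)\<bar>\<^sup>2 \<le> (norm (1 - of_real r * cis \<theta>))\<^sup>2"
    by (simp add: u_def)
qed simp

lemma norm_one_minus_powr_ge:
  assumes "q > 0"
  shows "\<bar>sin (Im s * ln (real q) / 2)\<bar> \<le> norm (1 - of_nat q powr (- s))"
proof -
  have "of_nat q powr (- s) = exp (- s * of_real (ln (real q)))"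
    using assms by (simp add: powr_def Ln_of_nat)
  also have "\<dots> = of_real (exp (- Re s * ln (real q))) * cis (- Im s * ln (real q))"
    by (subst exp_eq_polar) simp
  finally show ?thesis
    using norm_one_minus_rcis_ge[of "exp (- Re s * ln (real q))" "- Im s * ln (real q)"] by simp
qed

lemma half_le_sin:
  assumes "0 \<le> x" "x \<le> pi / 2"
  shows "x / 2 \<le> sin x"
proof (cases "x \<le> pi / 3")
  case True
  have "sin 0 - 0 / 2 \<le> sin x - x / 2"
  proof (rule DERIV_nonneg_imp_nondecreasing[of 0 x "\<lambda>x. sin x - x / 2"])
    fix y assume y: "0 \<le> y" "y \<le> x"
    have "cos (pi / 3) \<le> cos y" using y True by (intro cos_monotone_0_pi_le) auto
    then have "0 \<le> cos y - 1 / 2" by (simp add: cos_60)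
    moreover have "((\<lambda>x. sin x - x / 2) has_real_derivative (cos y - 1 / 2)) (at y)"
      by (auto intro!: derivative_eq_intros)
    ultimately show "\<exists>z. ((\<lambda>x. sin x - x / 2) has_real_derivative z) (at y) \<and> 0 \<le> z" by blast
  qed (use assms in auto)
  then show ?thesis by simp
next
  case False
  have "sin (pi / 3) \<le> sin x" using assms False by (intro sin_monotone_2pi_le) auto
  moreover have "x / 2 \<le> 0.8" using assms pi_less_4 pi_approx by simp
  moreover have "sqrt 3 / 2 \<ge> 0.8"
  proof -
    have "1.6 \<le> sqrt 3" by (rule real_le_rsqrt) (simp add: power2_eq_square)
    then show ?thesis by simp
  qed
  ultimately show ?thesis by (simp add: sin_60)
qed

text \<open>Subtracting the nearest integer changes \<open>sin (pi x)\<close> at most by a sign, and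
  the constant 1/2 of \<open>half_le_sin\<close> is enough because pi / 2 \<ge> 1.\<close>

lemma abs_sin_pi_ge_dist:
  "\<bar>x - of_int (round x)\<bar> \<le> \<bar>sin (pi * x)\<bar>"
proof -
  define k where "k = round x"
  define y where "y = \<bar>x - of_int k\<bar>"
  have y: "0 \<le> y" "y \<le> 1 / 2" using of_int_round_abs_le[of x] by (simp_all add: y_def k_def abs_minus_commute)
  have "\<bar>sin (pi * x)\<bar> = \<bar>sin (pi * (x - of_int k))\<bar>"
    by (simp add: right_diff_distrib sin_diff abs_mult)
  also have "\<dots> = \<bar>sin (pi * y)\<bar>"
    by (simp add: y_def abs_if) (smt (verit) mult_minus_right sin_minus)
  also have "\<dots> \<ge> pi * y / 2"
    using half_le_sin[of "pi * y"] y by (smt (verit, best) field_sum_of_halves mult_left_mono mult_nonneg_nonneg pi_gt_zero mult_cancel_left2 times_divide_eq_right)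
  moreover have "pi * y / 2 \<ge> y" using y pi_gt3 mult_right_mono[of 2 pi y] by simp
  ultimately show ?thesis by (simp add: y_def k_def)
qed

text \<open>The heights are half steps: even \<open>n\<close> are poles of the factor of
  \<open>p\<close>, odd \<open>n\<close> lie midway between them. For \<open>q = p\<close> and odd
  \<open>n\<close> the sine is 1 in modulus. For \<open>q \<noteq> p\<close> the distance of
  \<open>n ln q / (2 ln p)\<close> from the integers is a linear form
  \<open>n ln q - 2 k ln p\<close> divided by \<open>2 ln p\<close>.\<close>

lemma norm_one_minus_prime_powr_ge:
  fixes p q :: nat and \<epsilon> :: real
  assumes pq: "prime p" "prime q" and \<epsilon>: "\<epsilon> > 0"
  shows "\<exists>C>0. \<forall>n :: int. \<forall>\<sigma>. (if p = q then odd n else n \<noteq> 0) \<longrightarrow>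
    C * exp (- \<epsilon> * \<bar>real_of_int n\<bar>) \<le> norm (1 - of_nat q powr (- Complex \<sigma> (pi * of_int n / ln (real p))))"
proof -
  have pq2: "p \<ge> 2" "q \<ge> 2" using pq by (auto simp: prime_ge_2_nat)
  define w where "w = ln (real p)"
  define v where "v = ln (real q)"
  have w: "w > 0" and v: "v > 0" using pq2 by (auto simp: w_def v_def)
  have *: "\<bar>sin (pi * (of_int n * v / (2 * w)))\<bar> \<le> norm (1 - of_nat q powr (- Complex \<sigma> (pi * of_int n / w)))"
    for n :: int and \<sigma>
    using norm_one_minus_powr_ge[of q "Complex \<sigma> (pi * of_int n / w)"] pq2 by (simp add: v_def mult_ac)
  have "\<exists>C>0. \<forall>n :: int. (if p = q then odd n else n \<noteq> 0) \<longrightarrow>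
    C * exp (- \<epsilon> * \<bar>real_of_int n\<bar>) \<le> \<bar>sin (pi * (of_int n * v / (2 * w)))\<bar>"
  proof (cases "p = q")
    case True
    then have "v / w = 1" using w by (simp add: v_def w_def)
    have "1 * exp (- \<epsilon> * \<bar>real_of_int n\<bar>) \<le> \<bar>sin (pi * (of_int n * v / (2 * w)))\<bar>" if "odd n" for n
    proof -
      have "2 * (pi * (of_int n * v / (2 * w))) = pi * of_int n" using \<open>v / w = 1\<close> w by (simp add: field_simps)
      then have "1 - 2 * (sin (pi * (of_int n * v / (2 * w))))\<^sup>2 = - 1"
        using cos_double_sin[of "pi * (of_int n * v / (2 * w))"] that by simp
      then have "\<bar>sin (pi * (of_int n * v / (2 * w)))\<bar> = 1" by (simp add: abs_square_eq_1)
      then show ?thesis using \<epsilon> by simp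
    qed
    then show ?thesis using True by (intro exI[of _ 1]) auto
  next
    case False
    obtain C where C: "C > 0" "\<And>n k. n \<ge> 1 \<Longrightarrow> C * exp (- \<epsilon> * real n) \<le> \<bar>real n * v - real k * w\<bar>"
      using linear_form_lower_bound[OF pq(1,2) False \<epsilon>] unfolding v_def w_def by blast
    \<comment> \<open>For negative \<open>k\<close> the two terms have the same sign, so the form is
      at least its value at \<open>k = 0\<close>.\<close>
    have int: "C * exp (- \<epsilon> * real n) \<le> \<bar>real n * v - of_int k * w\<bar>" if "n \<ge> 1" for n and k :: int
    proof (cases "k \<ge> 0")
      case True
      then show ?thesis using C(2)[OF that, of "nat k"] by simp
    next
      case False
      then have "of_int k * w \<le> 0" using w by (simp add: mult_nonpos_nonneg)
      moreover have "real n * v \<ge> 0" using v by simp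
      ultimately show ?thesis using C(2)[OF that, of 0] by simp
    qed
    have "C / (2 * w) * exp (- \<epsilon> * \<bar>real_of_int n\<bar>) \<le> \<bar>sin (pi * (of_int n * v / (2 * w)))\<bar>" if n: "n \<noteq> 0" for n
    proof -
      define k where "k = round (of_int n * v / (2 * w))"
      define N where "N = nat \<bar>n\<bar>"
      have N: "N \<ge> 1" "real N = \<bar>real_of_int n\<bar>" using n by (auto simp: N_def)
      have "C * exp (- \<epsilon> * real N) \<le> \<bar>of_int n * v - of_int (2 * k) * w\<bar>"
        using int[OF N(1), of "sgn n * (2 * k)"] N(2) n
        by (cases "n > 0") (auto simp: abs_minus_commute)
      then have "C * exp (- \<epsilon> * real N) / (2 * w) \<le> \<bar>of_int n * v - of_int (2 * k) * w\<bar> / (2 * w)"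
        using w by (intro divide_right_mono) auto
      also have "\<dots> = \<bar>(of_int n * v - of_int (2 * k) * w) / (2 * w)\<bar>" using w by (simp add: abs_divide)
      also have "(of_int n * v - of_int (2 * k) * w) / (2 * w) = of_int n * v / (2 * w) - of_int k"
        using w by (simp add: field_simps)
      also have "\<bar>\<dots>\<bar> \<le> \<bar>sin (pi * (of_int n * v / (2 * w)))\<bar>"
        unfolding k_def by (rule abs_sin_pi_ge_dist)
      finally show ?thesis by (simp add: N)
    qed
    moreover have "C / (2 * w) > 0" using C w by simp
    ultimately show ?thesis using False by (intro exI[of _ "C / (2 * w)"]) auto
  qed
  then show ?thesis using * unfolding w_def v_def by (meson order.trans)
qed

section \<open>Exponential decay of the Gamma factor\<close>

text \<open>Termwise in Gauss's limit formula: the numerators have the same modulus, and each factor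
  of the denominator satisfies |z + i| \<ge> Re z + i.\<close>

lemma norm_Gamma_le_Gamma_Re:
  assumes "Re z > 0"
  shows "norm (Gamma z) \<le> Gamma (Re z)"
proof (rule LIMSEQ_le)
  show "(\<lambda>n. norm (Gamma_series z n)) \<longlonglongrightarrow> norm (Gamma z)"
    by (intro tendsto_norm Gamma_series_LIMSEQ)
  show "(\<lambda>n. Gamma_series (Re z) n) \<longlonglongrightarrow> Gamma (Re z)"
    by (rule Gamma_series_LIMSEQ)
  show "\<exists>N. \<forall>n\<ge>N. norm (Gamma_series z n) \<le> Gamma_series (Re z) n"
  proof (intro exI[of _ 0] allI impI)
    fix n :: nat
    have le: "pochhammer (Re z) (n + 1) \<le> norm (pochhammer z (n + 1))"
      unfolding pochhammer_prod prod_norm[symmetric]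
    proof (rule prod_mono, safe)
      fix i
      have "Re z + real i = Re (z + of_nat i)" by simp
      also have "\<dots> \<le> norm (z + of_nat i)" by (rule complex_Re_le_cmod)
      finally show "Re z + real i \<le> norm (z + of_nat i)" .
    qed (use assms in simp)
    have pos: "0 < pochhammer (Re z) (n + 1)" using assms by (intro pochhammer_pos)
    have "norm (Gamma_series z n) = fact n * exp (Re z * ln (real n)) / norm (pochhammer z (n + 1))"
      by (simp add: Gamma_series_def norm_mult norm_divide)
    also have "\<dots> \<le> fact n * exp (Re z * ln (real n)) / pochhammer (Re z) (n + 1)"
      using le pos by (intro divide_left_mono mult_pos_pos) auto
    finally show "norm (Gamma_series z n) \<le> Gamma_series (Re z) n"
      by (simp add: Gamma_series_def)
  qed
qed

text \<open>
  Compare \<open>\<Gamma>(z)\<close> with \<open>\<Gamma>(z + K)\<close> for \<open>K\<close> close to \<open>|Im z|\<close>: in each of the \<open>K\<close> quotients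
  \<open>(Re z + k) / |z + k|\<close> the imaginary part dominates, so each is at most \<open>1 / sqrt 2\<close>.
\<close>

lemma Gamma_exp_decay_right:
  assumes u: "0 < (u :: real)"
  shows "\<exists>C>0. \<forall>z. u \<le> Re z \<and> Re z \<le> v \<longrightarrow> norm (Gamma z) \<le> C * exp (- \<bar>Im z\<bar> / 4)"
proof -
  have "continuous_on {u..v} (Gamma :: real \<Rightarrow> real)"
    using u by (intro continuous_intros) (auto elim!: nonpos_Ints_cases)
  then have "bounded (Gamma ` {u..v})"
    by (intro compact_imp_bounded compact_continuous_image) auto
  then obtain B where B: "B > 0" "\<And>x. x \<in> {u..v} \<Longrightarrow> \<bar>Gamma x\<bar> \<le> B"
    by (auto simp: bounded_pos)
  \<comment> \<open>The origin of the rate 1/4: since e \<le> 4, a quotient of at most 1 / sqrt 2 is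
    at most exp (-1/4), and there are |Im z| - O(1) such quotients.\<close>
  have e2: "exp (1 / 4) \<le> sqrt 2"
  proof (rule real_le_rsqrt, rule power2_le_imp_le)
    have "((exp (1 / 4))\<^sup>2)\<^sup>2 = exp (1 :: real)" by (simp flip: exp_of_nat_mult power_mult)
    then show "((exp (1 / 4 :: real))\<^sup>2)\<^sup>2 \<le> 2\<^sup>2" using exp_le by simp
  qed simp
  have main: "norm (Gamma z) \<le> B * exp ((\<bar>v\<bar> + 1) / 4) * exp (- \<bar>Im z\<bar> / 4)" if z: "u \<le> Re z" "Re z \<le> v" for z
  proof -
    define x y where "x = Re z" and "y = \<bar>Im z\<bar>"
    \<comment> \<open>The largest range in which \<open>Re z + k \<le> |Im z|\<close> is guaranteed
      for all \<open>k < K\<close>. If \<open>y < v\<close> it is 0; the final exponent only relies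
      on \<open>y - v - 1 \<le> K\<close>, which holds in either case.\<close>
    define K where "K = nat \<lfloor>y - v\<rfloor>"
    have x: "x > 0" using z u by (simp add: x_def)
    have nonpos: "z \<notin> \<int>\<^sub>\<le>\<^sub>0" "x \<notin> \<int>\<^sub>\<le>\<^sub>0" using x by (auto elim!: nonpos_Ints_cases simp: x_def)
    have "pochhammer x K \<le> exp (- 1 / 4) ^ K * norm (pochhammer z K)"
    proof -
      have "(\<Prod>k<K. x + of_nat k) \<le> (\<Prod>k<K. exp (- 1 / 4) * norm (z + of_nat k))"
      proof (rule prod_mono, safe)
        fix k assume "k < K"
        then have "real k + 1 \<le> y - v" unfolding K_def by linarith
        then have "x + k \<le> y" using z by (simp add: x_def)
        have "norm (z + of_nat k) = sqrt ((x + k)\<^sup>2 + y\<^sup>2)"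
          by (simp add: cmod_def x_def y_def)
        also have "\<dots> \<ge> sqrt (2 * (x + k)\<^sup>2)"
          using \<open>x + k \<le> y\<close> x by (intro real_sqrt_le_mono) (simp add: power_mono)
        also have "sqrt (2 * (x + k)\<^sup>2) = sqrt 2 * (x + k)" using x by (simp add: real_sqrt_mult)
        finally have "sqrt 2 * (x + k) \<le> norm (z + of_nat k)" .
        moreover have "exp (1 / 4) * (x + k) \<le> sqrt 2 * (x + k)"
          using e2 x by (intro mult_right_mono) auto
        ultimately have "exp (- 1 / 4) * (exp (1 / 4) * (x + k)) \<le> exp (- 1 / 4) * norm (z + of_nat k)"
          by (intro mult_left_mono) auto
        moreover have "exp (- 1 / 4) * exp (1 / 4) = (1 :: real)"
          by (simp flip: exp_add)
        ultimately show "x + real k \<le> exp (- 1 / 4) * norm (z + of_nat k)"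
          by (metis mult.assoc mult_1)
      qed (use x in simp)
      then show ?thesis
        by (simp add: pochhammer_prod prod.distrib prod_norm atLeast0LessThan)
    qed
    moreover have "norm (Gamma z) * norm (pochhammer z K) \<le> Gamma x * pochhammer x K"
    proof -
      have "norm (Gamma z) * norm (pochhammer z K) = norm (Gamma (z + of_nat K))"
        using pochhammer_Gamma[OF nonpos(1), of K] Gamma_nonzero[OF nonpos(1)] by (simp add: norm_divide)
      also have "\<dots> \<le> Gamma (x + K)"
        using norm_Gamma_le_Gamma_Re[of "z + of_nat K"] x by (simp add: x_def)
      also have "\<dots> = Gamma x * pochhammer x K"
        using pochhammer_Gamma[OF nonpos(2), of K] Gamma_nonzero[OF nonpos(2)] by simp
      finally show ?thesis .
    qed
    moreover have "Gamma x \<ge> 0" using x by (simp add: Gamma_real_nonneg)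
    ultimately have "norm (Gamma z) * norm (pochhammer z K) \<le> Gamma x * (exp (- 1 / 4) ^ K * norm (pochhammer z K))"
      by (meson mult_left_mono order.trans)
    moreover have "norm (pochhammer z K) > 0"
      using nonpos(1) by (auto simp: pochhammer_eq_0_iff)
    ultimately have "norm (Gamma z) \<le> Gamma x * exp (- 1 / 4) ^ K" by (simp add: mult.assoc[symmetric])
    also have "\<dots> \<le> B * exp ((\<bar>v\<bar> + 1) / 4 - y / 4)"
    proof (intro mult_mono)
      show "Gamma x \<le> B" using B(2)[of x] z by (simp add: x_def)
      have "exp (- 1 / 4 :: real) ^ K = exp (- real K / 4)" by (simp flip: exp_of_nat_mult)
      also have "\<dots> \<le> exp ((\<bar>v\<bar> + 1) / 4 - y / 4)"
      proof -
        have "y - v - 1 \<le> real K" unfolding K_def by linarith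
        then have "- real K \<le> \<bar>v\<bar> + 1 - y" using abs_ge_self[of v] by linarith
        then show ?thesis
          unfolding exp_le_cancel_iff using divide_right_mono[of "- real K" "\<bar>v\<bar> + 1 - y" 4]
          by (simp add: diff_divide_distrib)
      qed
      finally show "exp (- 1 / 4 :: real) ^ K \<le> exp ((\<bar>v\<bar> + 1) / 4 - y / 4)" .
    qed (use B(1) in auto)
    also have "exp ((\<bar>v\<bar> + 1) / 4 - y / 4) = exp ((\<bar>v\<bar> + 1) / 4) * exp (- y / 4)"
      by (simp flip: exp_add)
    finally show ?thesis by (simp only: y_def mult.assoc)
  qed
  show ?thesis using main B(1) by (intro exI[of _ "B * exp ((\<bar>v\<bar> + 1) / 4)"]) auto
qed

text \<open>The functional equation carries the strip into the right half plane. Each step divides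
  by a factor whose modulus is at least |Im z| \<ge> 1, so the bound there can be pulled back
  without loss.\<close>

lemma Gamma_exp_decay:
  fixes u v :: real
  shows "\<exists>C>0. \<forall>z. u \<le> Re z \<and> Re z \<le> v \<and> (0 < u \<or> 1 \<le> \<bar>Im z\<bar>) \<longrightarrow> norm (Gamma z) \<le> C * exp (- \<bar>Im z\<bar> / 4)"
proof (cases "0 < u")
  case True
  then show ?thesis using Gamma_exp_decay_right[of u v] by blast
next
  case False
  define K where "K = nat \<lceil>1 - u\<rceil>"
  have K: "1 \<le> u + K" using False by (simp add: K_def) linarith
  obtain C where C: "C > 0" "\<And>z. u + K \<le> Re z \<Longrightarrow> Re z \<le> v + K \<Longrightarrow> norm (Gamma z) \<le> C * exp (- \<bar>Im z\<bar> / 4)"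
    using Gamma_exp_decay_right[of "u + K" "v + K"] K by auto
  have "norm (Gamma z) \<le> C * exp (- \<bar>Im z\<bar> / 4)" if z: "u \<le> Re z" "Re z \<le> v" "1 \<le> \<bar>Im z\<bar>" for z
  proof -
    have nonpos: "z \<notin> \<int>\<^sub>\<le>\<^sub>0" using z(3) by (auto elim!: nonpos_Ints_cases)
    have "1 \<le> norm (pochhammer z K)"
      unfolding pochhammer_prod prod_norm[symmetric]
    proof (rule prod_ge_1)
      fix i
      have "1 \<le> \<bar>Im (z + of_nat i)\<bar>" using z(3) by simp
      also have "\<dots> \<le> norm (z + of_nat i)" by (rule abs_Im_le_cmod)
      finally show "1 \<le> norm (z + of_nat i)" .
    qed
    then have "norm (Gamma z) * 1 \<le> norm (Gamma z) * norm (pochhammer z K)"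
      by (intro mult_left_mono) auto
    also have "\<dots> = norm (Gamma (z + of_nat K))"
      using pochhammer_Gamma[OF nonpos, of K] Gamma_nonzero[OF nonpos] by (simp add: norm_divide)
    also have "\<dots> \<le> C * exp (- \<bar>Im z\<bar> / 4)"
      using C(2)[of "z + of_nat K"] z by simp
    finally show ?thesis by simp
  qed
  then show ?thesis using C(1) False by blast
qed

section \<open>The kernel s^m (1 - s)^m g(s): polynomial growth against the decay of Gamma\<close>

lemma poly_le_exp:
  "\<exists>C>0. \<forall>t\<ge>0. (1 + t :: real) ^ j \<le> C * exp (t / 16)"
proof (intro exI[of _ "16 ^ j * fact j * exp (1 / 16)"] conjI allI impI)
  fix t :: real assume "t \<ge> 0"
  then have "((1 + t) / 16) ^ j / fact j \<le> exp ((1 + t) / 16)" by (intro power_div_fact_le_exp) auto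
  then show "(1 + t) ^ j \<le> 16 ^ j * fact j * exp (1 / 16) * exp (t / 16)"
  proof -
    assume "((1 + t) / 16) ^ j / fact j \<le> exp ((1 + t) / 16)"
    also have "exp ((1 + t) / 16) = exp (1 / 16) * exp (t / 16)"
      by (simp only: add_divide_distrib exp_add)
    finally have "(1 + t) ^ j / (16 ^ j * fact j) \<le> exp (1 / 16) * exp (t / 16)"
      by (simp add: power_divide)
    then show ?thesis by (subst (asm) pos_divide_le_eq) (simp_all add: mult_ac)
  qed
qed simp


text \<open>Absorbing the factor \<open>s / 2\<close> into \<open>Gamma (s / 2)\<close> fills in the
  singularity of \<open>g\<close> at 0 and leaves exactly the poles \<open>- 2 n\<close> with
  \<open>n \<ge> 1\<close>.\<close>

definition g_kernel :: "complex \<Rightarrow> complex" where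
  "g_kernel s = (s - 1) * of_real pi powr (- s / 2) * Gamma (1 + s / 2)"

lemma half_nonpos_Int_iff: "1 + s / 2 \<in> \<int>\<^sub>\<le>\<^sub>0 \<longleftrightarrow> (\<exists>n\<ge>1. s = - 2 * of_nat n)" for s :: complex
proof
  assume "1 + s / 2 \<in> \<int>\<^sub>\<le>\<^sub>0"
  then obtain n where "1 + s / 2 = - of_nat n" by (auto elim!: nonpos_Ints_cases')
  then have "s = - 2 * of_nat (n + 1)" by (simp add: field_simps eq_neg_iff_add_eq_0)
  then show "\<exists>n\<ge>1. s = - 2 * of_nat n" by (intro exI[of _ "n + 1"]) auto
next
  assume "\<exists>n\<ge>1. s = - 2 * of_nat n"
  then obtain n where n: "n \<ge> 1" "s = - 2 * of_nat n" by auto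
  then have "1 + s / 2 = - of_nat (n - 1)" by (simp add: of_nat_diff)
  then show "1 + s / 2 \<in> \<int>\<^sub>\<le>\<^sub>0" by (metis nonpos_Ints_of_int minus_of_nat_in_nonpos_Ints)
qed

lemma pi_powr_analytic: "(\<lambda>w. of_real pi powr (- w / 2)) analytic_on A"
proof -
  have "(\<lambda>w :: complex. of_real pi powr (- w / 2)) = (\<lambda>w. exp (- w / 2 * Ln (of_real pi)))"
    by (auto simp: powr_def)
  moreover have "(\<lambda>w. exp (- w / 2 * Ln (of_real pi))) holomorphic_on UNIV"
    by (intro holomorphic_intros) auto
  ultimately have "(\<lambda>w :: complex. of_real pi powr (- w / 2)) analytic_on UNIV"
    by (simp add: analytic_on_open)
  then show ?thesis by (rule analytic_on_subset) simp
qed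

lemma g_kernel_analytic: "1 + s / 2 \<notin> \<int>\<^sub>\<le>\<^sub>0 \<Longrightarrow> g_kernel analytic_on {s}"
  unfolding g_kernel_def by (intro analytic_intros pi_powr_analytic) auto

text \<open>The equality extends to the poles, where both sides are 0 by convention:
  \<open>remove_sings\<close> takes the value 0 at a pole, and so does \<open>Gamma\<close> at
  nonpositive integers.\<close>

lemma g_fun_eq_g_kernel: "g_fun = g_kernel"
proof
  fix s :: complex
  have eq: "w * (w - 1) / 2 * of_real pi powr (- w / 2) * Gamma (w / 2) = g_kernel w" if "w \<noteq> 0" for w :: complex
  proof (cases "w / 2 \<in> \<int>\<^sub>\<le>\<^sub>0")
    case True
    then obtain n where n: "w / 2 = - of_nat n" by (auto elim!: nonpos_Ints_cases')
    then have "n \<noteq> 0" using that by auto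
    then have "1 + w / 2 = - of_nat (n - 1)" using n by (simp add: of_nat_diff Suc_le_eq)
    then have "1 + w / 2 \<in> \<int>\<^sub>\<le>\<^sub>0" by (metis minus_of_nat_in_nonpos_Ints)
    then show ?thesis using True by (simp add: g_kernel_def Gamma_nonpos_Int)
  next
    case False
    have "Gamma (1 + w / 2) = w / 2 * Gamma (w / 2)"
      using Gamma_plus1[OF False] by (simp add: add.commute)
    then show ?thesis by (simp add: g_kernel_def)
  qed
  have "g_fun s = remove_sings g_kernel s"
    unfolding g_fun_def
  proof (rule remove_sings_cong)
    have "eventually (\<lambda>w :: complex. w \<noteq> 0) (at s)"
      using eventually_neq_at_within[of 0 s UNIV] by simp
    then show "eventually (\<lambda>w. w * (w - 1) / 2 * of_real pi powr (- w / 2) * Gamma (w / 2) = g_kernel w) (at s)"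
      by eventually_elim (rule eq)
  qed simp
  also have "\<dots> = g_kernel s"
  proof (cases "1 + s / 2 \<in> \<int>\<^sub>\<le>\<^sub>0")
    case False
    then show ?thesis by (intro remove_sings_at_analytic g_kernel_analytic)
  next
    case True
    then obtain n where n: "1 + s / 2 = - of_nat n" by (auto elim!: nonpos_Ints_cases')
    obtain k where k: "s = - 2 * of_nat k" using True half_nonpos_Int_iff by auto
    have "s \<noteq> 1"
    proof
      assume "s = 1"
      then have "Re s = 1" by simp
      then show False using k by simp
    qed
    have "filterlim (\<lambda>w. 1 + w / 2) (at (1 + s / 2)) (at s)"
      by (rule filterlim_atI) (auto intro!: tendsto_eq_intros simp: eventually_at_filter)
    moreover have "filterlim Gamma at_infinity (at (1 + s / 2))"
      unfolding n by (rule Gamma_poles)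
    ultimately have "filterlim (\<lambda>w. Gamma (1 + w / 2)) at_infinity (at s)"
      by (rule filterlim_compose[rotated])
    moreover have "((\<lambda>w. (w - 1) * of_real pi powr (- w / 2)) \<longlongrightarrow> (s - 1) * of_real pi powr (- s / 2)) (at s)"
    proof -
      have "(\<lambda>w. (w - 1) * of_real pi powr (- w / 2)) analytic_on {s}"
        by (intro analytic_intros pi_powr_analytic)
      then show ?thesis by (auto dest!: analytic_at_imp_isCont simp: isCont_def)
    qed
    ultimately have "is_pole g_kernel s"
      unfolding is_pole_def g_kernel_def using \<open>s \<noteq> 1\<close>
      by (intro tendsto_mult_filterlim_at_infinity) auto
    then show ?thesis using True by (simp add: g_kernel_def Gamma_nonpos_Int)
  qed
  finally show "g_fun s = g_kernel s" .
qed

lemma norm_pi_powr: "norm (of_real pi powr s) = exp (Re s * ln pi)"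
  by (simp add: norm_powr_real_powr powr_def)

text \<open>The common factor of \<open>\<xi>\<^sup>:\<^sub>B\<close> for all sets \<open>B\<close> of \<open>m\<close> primes.\<close>

definition xi_kernel :: "nat \<Rightarrow> complex \<Rightarrow> complex" where
  "xi_kernel m s = s ^ m * (1 - s) ^ m * g_kernel s"

lemma norm_xi_kernel_le:
  assumes "norm s \<le> r" "norm (1 - s) \<le> r"
  shows "norm (xi_kernel m s) \<le> r ^ (2 * m + 1) * (exp (- Re s / 2 * ln pi) * norm (Gamma (1 + s / 2)))"
proof -
  have "norm (xi_kernel m s) = norm s ^ m * norm (1 - s) ^ m * norm (1 - s) *
      (exp (- Re s / 2 * ln pi) * norm (Gamma (1 + s / 2)))"
    by (simp add: xi_kernel_def g_kernel_def norm_mult norm_power norm_pi_powr norm_minus_commute)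
  also have "norm s ^ m * norm (1 - s) ^ m * norm (1 - s) \<le> r ^ m * r ^ m * r"
    using assms order.trans[OF norm_ge_zero assms(1)] by (intro mult_mono power_mono) auto
  also have "\<dots> = r ^ (2 * m + 1)" by (simp add: mult_2 power_add)
  finally show ?thesis by (simp add: mult_right_mono)
qed

lemma poly_exp_le_exp:
  assumes "C > 0" "\<And>t. t \<ge> 0 \<Longrightarrow> (1 + t :: real) ^ j \<le> C * exp (t / 16)"
  shows "(1 + \<bar>t\<bar>) ^ j * exp (- \<bar>t\<bar> / 8) \<le> C * exp (- \<bar>t\<bar> / 16)"
proof -
  have "(1 + \<bar>t\<bar>) ^ j * exp (- \<bar>t\<bar> / 8) \<le> C * exp (\<bar>t\<bar> / 16) * exp (- \<bar>t\<bar> / 8)"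
    using assms(2)[of "\<bar>t\<bar>"] by (intro mult_right_mono) auto
  also have "exp (- \<bar>t\<bar> / 16) = exp (\<bar>t\<bar> / 16) * exp (- \<bar>t\<bar> / 8)"
    by (simp flip: exp_add)
  then have "C * exp (\<bar>t\<bar> / 16) * exp (- \<bar>t\<bar> / 8) = C * exp (- \<bar>t\<bar> / 16)" by (simp only: mult.assoc)
  finally show ?thesis .
qed

text \<open>Rates: halving the argument turns 1/4 into 1/8, and the polynomial factors consume half
  of that. The alternative \<open>- 2 < u\<close> or \<open>2 \<le> |Im s|\<close> keeps away from
  the poles, the rightmost of which is -2.\<close>

lemma xi_kernel_exp_decay:
  fixes u v :: real
  shows "\<exists>C>0. \<forall>s. u \<le> Re s \<and> Re s \<le> v \<and> (- 2 < u \<or> 2 \<le> \<bar>Im s\<bar>) \<longrightarrow>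
    norm (xi_kernel m s) \<le> C * exp (- \<bar>Im s\<bar> / 16)"
proof -
  define c where "c = 1 + \<bar>u\<bar> + \<bar>v\<bar>"
  obtain C1 where C1: "C1 > 0" "\<And>z. 1 + u / 2 \<le> Re z \<Longrightarrow> Re z \<le> 1 + v / 2 \<Longrightarrow> 0 < 1 + u / 2 \<or> 1 \<le> \<bar>Im z\<bar> \<Longrightarrow>
      norm (Gamma z) \<le> C1 * exp (- \<bar>Im z\<bar> / 4)"
    using Gamma_exp_decay[of "1 + u / 2" "1 + v / 2"] by blast
  obtain C2 where C2: "C2 > 0" "\<And>t. t \<ge> 0 \<Longrightarrow> (1 + t :: real) ^ (2 * m + 1) \<le> C2 * exp (t / 16)"
    using poly_le_exp[of "2 * m + 1"] by blast
  have c: "c \<ge> 1" by (simp add: c_def)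
  have "norm (xi_kernel m s) \<le> (c ^ (2 * m + 1) * exp (c * ln pi) * C1 * C2) * exp (- \<bar>Im s\<bar> / 16)"
    if s: "u \<le> Re s" "Re s \<le> v" "- 2 < u \<or> 2 \<le> \<bar>Im s\<bar>" for s
  proof -
    define t where "t = \<bar>Im s\<bar>"
    have r: "c + t \<le> c * (1 + t)" using c by (simp add: t_def algebra_simps mult_le_cancel_right1)
    have "norm s \<le> \<bar>Re s\<bar> + \<bar>Im s\<bar>" "norm (1 - s) \<le> \<bar>Re (1 - s)\<bar> + \<bar>Im (1 - s)\<bar>" by (rule cmod_le)+
    moreover have "\<bar>Re s\<bar> \<le> c" "\<bar>Re (1 - s)\<bar> \<le> c" using s(1,2) by (auto simp: c_def)
    moreover have "\<bar>Im s\<bar> = t" "\<bar>Im (1 - s)\<bar> = t" by (simp_all add: t_def)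
    ultimately have "norm s \<le> c * (1 + t)" "norm (1 - s) \<le> c * (1 + t)" using r by linarith+
    then have "norm (xi_kernel m s) \<le> (c * (1 + t)) ^ (2 * m + 1) * (exp (- Re s / 2 * ln pi) * norm (Gamma (1 + s / 2)))"
      by (rule norm_xi_kernel_le)
    also have "\<dots> \<le> (c * (1 + t)) ^ (2 * m + 1) * (exp (c * ln pi) * (C1 * exp (- t / 8)))"
    proof (intro mult_left_mono mult_mono)
      have "- Re s / 2 \<le> c" using s(1) by (simp add: c_def)
      then show "exp (- Re s / 2 * ln pi) \<le> exp (c * ln pi)"
        unfolding exp_le_cancel_iff using pi_ge_two by (intro mult_right_mono) auto
      show "norm (Gamma (1 + s / 2)) \<le> C1 * exp (- t / 8)"
        using C1(2)[of "1 + s / 2"] s by (auto simp: t_def)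
    qed (use c in \<open>auto simp: t_def\<close>)
    also have "\<dots> = (c ^ (2 * m + 1) * exp (c * ln pi) * C1) * ((1 + \<bar>Im s\<bar>) ^ (2 * m + 1) * exp (- \<bar>Im s\<bar> / 8))"
      unfolding power_mult_distrib t_def by (simp only: mult_ac)
    also have "\<dots> \<le> (c ^ (2 * m + 1) * exp (c * ln pi) * C1) * (C2 * exp (- \<bar>Im s\<bar> / 16))"
      using c C1(1) by (intro mult_left_mono poly_exp_le_exp C2) auto
    finally show ?thesis by (simp only: mult_ac)
  qed
  moreover have "c ^ (2 * m + 1) * exp (c * ln pi) * C1 * C2 > 0" using c C1 C2 by simp
  ultimately show ?thesis by blast
qed

lemma poly_times_power_over_fact_LIMSEQ:
  "(\<lambda>N. real (2 * N + 4) ^ j * x ^ N / fact N) \<longlonglongrightarrow> 0" for x :: real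
proof -
  obtain C where C: "C > 0" "\<And>t. t \<ge> 0 \<Longrightarrow> (1 + t :: real) ^ j \<le> C * exp (t / 16)"
    using poly_le_exp[of j] by blast
  have s: "summable (\<lambda>N. y ^ N / fact N)" for y :: real
    using summable_exp[of y] by (simp add: field_simps)
  show ?thesis
  proof (rule tendsto_0_le[where K = 1])
    have "(\<lambda>N. 4 ^ j * C * ((exp 1 * \<bar>x\<bar>) ^ N / fact N)) \<longlonglongrightarrow> 4 ^ j * C * 0"
      by (intro tendsto_mult tendsto_const summable_LIMSEQ_zero s)
    then show "(\<lambda>N. 4 ^ j * C * ((exp 1 * \<bar>x\<bar>) ^ N / fact N)) \<longlonglongrightarrow> 0" by simp
    show "eventually (\<lambda>N. norm (real (2 * N + 4) ^ j * x ^ N / fact N) \<le> norm (4 ^ j * C * ((exp 1 * \<bar>x\<bar>) ^ N / fact N)) * 1) sequentially"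
    proof (intro always_eventually allI)
      fix N :: nat
      have "real (2 * N + 4) ^ j \<le> (4 * (1 + real N)) ^ j" by (intro power_mono) auto
      also have "\<dots> \<le> 4 ^ j * (C * exp (real N / 16))"
        unfolding power_mult_distrib using C(2)[of "real N"] by (intro mult_left_mono) auto
      also have "\<dots> \<le> 4 ^ j * (C * exp 1 ^ N)"
        using C(1) by (intro mult_left_mono) (auto simp flip: exp_of_nat_mult)
      finally have "real (2 * N + 4) ^ j * (\<bar>x\<bar> ^ N / fact N) \<le> 4 ^ j * (C * exp 1 ^ N) * (\<bar>x\<bar> ^ N / fact N)"
        by (intro mult_right_mono) auto
      moreover have "4 ^ j * (C * exp 1 ^ N) * (\<bar>x\<bar> ^ N / fact N) = 4 ^ j * C * ((exp 1 * \<bar>x\<bar>) ^ N / fact N)"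
        by (simp add: power_mult_distrib)
      ultimately have "real (2 * N + 4) ^ j * (\<bar>x\<bar> ^ N / fact N) \<le> 4 ^ j * C * ((exp 1 * \<bar>x\<bar>) ^ N / fact N)"
        by linarith
      moreover have "norm (real (2 * N + 4) ^ j * x ^ N / fact N) = real (2 * N + 4) ^ j * (\<bar>x\<bar> ^ N / fact N)"
        by (simp add: abs_mult power_abs)
      moreover have "norm (4 ^ j * C * ((exp 1 * \<bar>x\<bar>) ^ N / fact N)) = 4 ^ j * C * ((exp 1 * \<bar>x\<bar>) ^ N / fact N)"
        using C(1) by simp
      ultimately show "norm (real (2 * N + 4) ^ j * x ^ N / fact N) \<le> norm (4 ^ j * C * ((exp 1 * \<bar>x\<bar>) ^ N / fact N)) * 1"
        by linarith
    qed
  qed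
qed

text \<open>These lines run midway between neighbouring poles. There \<open>1 + s / 2\<close> has
  real part 1/2 - N, and N steps of the functional equation lead to real part 1/2. The factors
  passed have a product of modulus at least \<open>pochhammer (1 / 2) N\<close>, which outgrows the
  power of pi and the polynomial.\<close>

lemma xi_kernel_left_decay:
  "\<exists>c. c \<longlonglongrightarrow> 0 \<and> (\<forall>N t. norm (xi_kernel m (Complex (- (2 * real N + 1)) t)) \<le> c N * exp (- \<bar>t\<bar> / 16))"
proof -
  obtain C1 where C1: "C1 > 0" "\<And>z. 1 / 2 \<le> Re z \<Longrightarrow> Re z \<le> 1 / 2 \<Longrightarrow> norm (Gamma z) \<le> C1 * exp (- \<bar>Im z\<bar> / 4)"
    using Gamma_exp_decay[of "1 / 2" "1 / 2"] by auto
  obtain C2 where C2: "C2 > 0" "\<And>t. t \<ge> 0 \<Longrightarrow> (1 + t :: real) ^ (2 * m + 1) \<le> C2 * exp (t / 16)"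
    using poly_le_exp[of "2 * m + 1"] by blast
  define P where "P N = pochhammer (1 / 2 :: real) N" for N
  have P: "P N > 0" for N unfolding P_def by (intro pochhammer_pos) simp
  define c where "c N = real (2 * N + 2) ^ (2 * m + 1) * exp ((N + 1 / 2) * ln pi) * (C1 / P N) * C2" for N
  have "c \<longlonglongrightarrow> 0"
  proof (rule LIMSEQ_imp_Suc, rule tendsto_0_le[where K = 1])
    have "(\<lambda>N. (2 * exp (3 / 2 * ln pi) * C1 * C2) * (real (2 * N + 4) ^ (2 * m + 1) * pi ^ N / fact N)) \<longlonglongrightarrow>
        (2 * exp (3 / 2 * ln pi) * C1 * C2) * 0"
      by (intro tendsto_mult tendsto_const poly_times_power_over_fact_LIMSEQ)
    then show "(\<lambda>N. (2 * exp (3 / 2 * ln pi) * C1 * C2) * (real (2 * N + 4) ^ (2 * m + 1) * pi ^ N / fact N)) \<longlonglongrightarrow> 0"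
      by simp
    show "eventually (\<lambda>N. norm (c (Suc N)) \<le>
      norm ((2 * exp (3 / 2 * ln pi) * C1 * C2) * (real (2 * N + 4) ^ (2 * m + 1) * pi ^ N / fact N)) * 1) sequentially"
    proof (intro always_eventually allI)
      fix N :: nat
      \<comment> \<open>Splitting off the first factor 1/2 leaves the factors 3/2 + k, which
        dominate 1 + k one by one; for this the sequence is considered at
        \<open>Suc N\<close>.\<close>
      have P_ge: "fact N / 2 \<le> P (Suc N)"
      proof -
        have "(\<Prod>k<N. 1 + real k) \<le> (\<Prod>k<N. 1 / 2 + 1 + real k)" by (intro prod_mono) auto
        moreover have "fact N = (\<Prod>k<N. 1 + real k)"
          by (simp add: pochhammer_fact pochhammer_prod atLeast0LessThan)
        moreover have "P (Suc N) = 1 / 2 * (\<Prod>k<N. 1 / 2 + 1 + real k)"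
          unfolding P_def pochhammer_rec by (simp add: pochhammer_prod atLeast0LessThan)
        ultimately show ?thesis by linarith
      qed
      have "exp ((real (Suc N) + 1 / 2) * ln pi) = exp (3 / 2 * ln pi + real N * ln pi)"
        by (simp add: algebra_simps)
      also have "\<dots> = exp (3 / 2 * ln pi) * pi ^ N" by (simp only: exp_add exp_of_nat_mult) simp
      finally have e: "exp ((real (Suc N) + 1 / 2) * ln pi) = exp (3 / 2 * ln pi) * pi ^ N" .
      have "C1 / P (Suc N) \<le> C1 / (fact N / 2)"
        using P_ge P C1(1) by (intro divide_left_mono) auto
      then have "c (Suc N) \<le> real (2 * Suc N + 2) ^ (2 * m + 1) * (exp (3 / 2 * ln pi) * pi ^ N) * (C1 / (fact N / 2)) * C2"
        unfolding c_def e using C2(1) by (intro mult_right_mono mult_left_mono) auto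
      also have "\<dots> = (2 * exp (3 / 2 * ln pi) * C1 * C2) * (real (2 * N + 4) ^ (2 * m + 1) * pi ^ N / fact N)"
        by (simp add: mult_ac add_ac)
      also have "\<dots> \<le> \<bar>\<dots>\<bar>" by (rule abs_ge_self)
      finally have "c (Suc N) \<le> \<bar>(2 * exp (3 / 2 * ln pi) * C1 * C2) * (real (2 * N + 4) ^ (2 * m + 1) * pi ^ N / fact N)\<bar>" .
      moreover have "c (Suc N) \<ge> 0" using P[of "Suc N"] C1(1) C2(1) unfolding c_def by (intro mult_nonneg_nonneg divide_nonneg_pos) auto
      ultimately show "norm (c (Suc N)) \<le>
        norm ((2 * exp (3 / 2 * ln pi) * C1 * C2) * (real (2 * N + 4) ^ (2 * m + 1) * pi ^ N / fact N)) * 1"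
        by simp
    qed
  qed
  moreover have "norm (xi_kernel m (Complex (- (2 * real N + 1)) t)) \<le> c N * exp (- \<bar>t\<bar> / 16)" for N t
  proof -
    define s where "s = Complex (- (2 * real N + 1)) t"
    define r where "r = real (2 * N + 2) * (1 + \<bar>t\<bar>)"
    have r: "real (2 * N + 2) + \<bar>t\<bar> \<le> r" by (simp add: r_def algebra_simps)
    have "norm s \<le> \<bar>Re s\<bar> + \<bar>Im s\<bar>" "norm (1 - s) \<le> \<bar>Re (1 - s)\<bar> + \<bar>Im (1 - s)\<bar>" by (rule cmod_le)+
    then have "norm s \<le> r" "norm (1 - s) \<le> r" using r by (auto simp: s_def)
    then have *: "norm (xi_kernel m s) \<le> r ^ (2 * m + 1) * (exp (- Re s / 2 * ln pi) * norm (Gamma (1 + s / 2)))"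
      by (rule norm_xi_kernel_le)
    define z where "z = Complex (1 / 2) (t / 2)"
    have zN: "1 + s / 2 + of_nat N = z" by (rule complex_eqI) (simp_all add: s_def z_def, simp add: field_simps)
    have "P N * norm (Gamma (1 + s / 2)) \<le> norm (Gamma z)"
    proof (cases "1 + s / 2 \<in> \<int>\<^sub>\<le>\<^sub>0")
      case True
      then show ?thesis by (simp add: Gamma_nonpos_Int)
    next
      case False
      have "P N \<le> norm (pochhammer (1 + s / 2) N)"
      proof -
        have "P N = (\<Prod>k<N. 1 / 2 + real k)" by (simp add: P_def pochhammer_prod atLeast0LessThan)
        \<comment> \<open>The real parts of the factors run from 1/2 - N up to -1/2, so their moduli
          are the factors of \<open>P N\<close> in reverse order.\<close>
        also have "\<dots> = (\<Prod>k<N. 1 / 2 + real (N - Suc k))"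
          by (rule prod.nat_diff_reindex[symmetric])
        also have "\<dots> \<le> (\<Prod>k<N. norm (1 + s / 2 + of_nat k))"
        proof (rule prod_mono, safe)
          fix k assume "k < N"
          moreover have "Re (1 + s / 2 + of_nat k) = 1 / 2 - real N + real k"
            by (simp add: s_def) (simp add: field_simps)
          ultimately have "1 / 2 + real (N - Suc k) = \<bar>Re (1 + s / 2 + of_nat k)\<bar>"
            by (simp add: of_nat_diff)
          also have "\<dots> \<le> norm (1 + s / 2 + of_nat k)" by (rule abs_Re_le_cmod)
          finally show "1 / 2 + real (N - Suc k) \<le> norm (1 + s / 2 + of_nat k)" .
        qed simp
        also have "\<dots> = norm (pochhammer (1 + s / 2) N)"
          by (simp add: pochhammer_prod prod_norm atLeast0LessThan)
        finally show ?thesis .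
      qed
      then have "P N * norm (Gamma (1 + s / 2)) \<le> norm (pochhammer (1 + s / 2) N) * norm (Gamma (1 + s / 2))"
        by (intro mult_right_mono) auto
      also have "\<dots> = norm (Gamma z)"
        using pochhammer_Gamma[OF False, of N] Gamma_nonzero[OF False] by (simp add: norm_divide zN)
      finally show ?thesis .
    qed
    also have "\<dots> \<le> C1 * exp (- \<bar>t\<bar> / 8)" using C1(2)[of z] by (simp add: z_def)
    finally have G: "norm (Gamma (1 + s / 2)) \<le> C1 / P N * exp (- \<bar>t\<bar> / 8)"
      using P[of N] by (simp add: field_simps)
    have "norm (xi_kernel m s) \<le> r ^ (2 * m + 1) * (exp (- Re s / 2 * ln pi) * (C1 / P N * exp (- \<bar>t\<bar> / 8)))"
      using G by (intro order.trans[OF *] mult_left_mono) (auto simp: r_def)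
    also have "- Re s / 2 = N + 1 / 2" by (simp add: s_def)
    also have "r ^ (2 * m + 1) * (exp ((N + 1 / 2) * ln pi) * (C1 / P N * exp (- \<bar>t\<bar> / 8))) =
        (real (2 * N + 2) ^ (2 * m + 1) * exp ((N + 1 / 2) * ln pi) * (C1 / P N)) * ((1 + \<bar>t\<bar>) ^ (2 * m + 1) * exp (- \<bar>t\<bar> / 8))"
      unfolding r_def power_mult_distrib by (simp only: mult_ac)
    also have "\<dots> \<le> (real (2 * N + 2) ^ (2 * m + 1) * exp ((N + 1 / 2) * ln pi) * (C1 / P N)) * (C2 * exp (- \<bar>t\<bar> / 16))"
      using P[of N] C1(1) by (intro mult_left_mono poly_exp_le_exp C2 mult_nonneg_nonneg) (auto intro!: divide_nonneg_pos)
    finally show ?thesis by (simp only: c_def s_def mult_ac)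
  qed
  ultimately show ?thesis by blast
qed

section \<open>The Euler product and its principal parts\<close>

lemma of_nat_powr_minus: "p > 0 \<Longrightarrow> of_nat p powr (- s) = exp (- s * of_real (ln (real p)))" for s :: complex
  by (simp add: powr_def Ln_of_nat)

lemma imag_pole_eq_Complex: "imag_pole p n = Complex 0 (2 * pi * of_int n / ln (real p))"
  by (simp add: imag_pole_def complex_eq_iff Re_divide_of_real Im_divide_of_real)

lemma one_minus_powr_eq_0_iff:
  assumes "p \<ge> 2"
  shows "1 - of_nat p powr (- s) = 0 \<longleftrightarrow> (\<exists>n. s = imag_pole p n)"
proof -
  have w: "ln (real p) > 0" using assms by simp
  have "1 - of_nat p powr (- s) = 0 \<longleftrightarrow> exp (- s * of_real (ln (real p))) = 1"
    using assms by (auto simp: of_nat_powr_minus)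
  also have "\<dots> \<longleftrightarrow> Re s = 0 \<and> (\<exists>n. - Im s * ln (real p) = of_int (2 * n) * pi)"
    using w by (simp add: exp_eq_1)
  also have "(\<exists>n. - Im s * ln (real p) = of_int (2 * n) * pi) \<longleftrightarrow> (\<exists>n. Im s = 2 * pi * of_int n / ln (real p))"
  proof safe
    fix n assume "- Im s * ln (real p) = of_int (2 * n) * pi"
    then show "\<exists>n. Im s = 2 * pi * of_int n / ln (real p)"
      using w by (intro exI[of _ "- n"]) (simp add: field_simps)
  next
    fix n assume "Im s = 2 * pi * of_int n / ln (real p)"
    then show "\<exists>n. - Im s * ln (real p) = of_int (2 * n) * pi"
      using w by (intro exI[of _ "- n"]) (simp add: field_simps)
  qed
  finally show ?thesis by (auto simp: imag_pole_eq_Complex complex_eq_iff)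
qed

lemma one_minus_powr_has_field_derivative:
  fixes s :: complex
  assumes "p > 0"
  shows "((\<lambda>s. 1 - of_nat p powr (- s)) has_field_derivative of_real (ln (real p)) * of_nat p powr (- s)) (at s)"
proof -
  have "((\<lambda>s. 1 - exp (- s * of_real (ln (real p)))) has_field_derivative
      of_real (ln (real p)) * exp (- s * of_real (ln (real p)))) (at s)"
    by (auto intro!: derivative_eq_intros)
  then show ?thesis using assms by (simp add: of_nat_powr_minus)
qed

lemma one_minus_powr_holomorphic: "p > 0 \<Longrightarrow> (\<lambda>s. 1 - of_nat p powr (- s)) holomorphic_on A"
  using one_minus_powr_has_field_derivative[of p]
  by (auto simp: holomorphic_on_def field_differentiable_def intro: has_field_derivative_at_within)

lemma norm_one_minus_powr_bounds:
  assumes "p \<ge> 2"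
  shows "Re s \<le> - 1 \<Longrightarrow> 1 \<le> norm (1 - of_nat p powr (- s))"
    and "Re s \<ge> 1 \<Longrightarrow> 1 / 2 \<le> norm (1 - of_nat p powr (- s))"
proof -
  have n: "norm (of_nat p powr (- s)) = exp (- Re s * ln (real p))"
    using assms by (simp add: of_nat_powr_minus)
  have p: "exp (ln (real p)) \<ge> 2" using assms by simp
  show "1 \<le> norm (1 - of_nat p powr (- s))" if "Re s \<le> - 1"
  proof -
    have "1 * ln (real p) \<le> - Re s * ln (real p)" using that assms by (intro mult_right_mono) auto
    then have "exp (ln (real p)) \<le> norm (of_nat p powr (- s))" by (simp add: n)
    then show ?thesis using norm_triangle_ineq2[of "of_nat p powr (- s)" 1] p
      by (simp add: norm_minus_commute)
  qed
  show "1 / 2 \<le> norm (1 - of_nat p powr (- s))" if "Re s \<ge> 1"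
  proof -
    have "1 * ln (real p) \<le> Re s * ln (real p)" using that assms by (intro mult_right_mono) auto
    then have "norm (of_nat p powr (- s)) \<le> exp (- ln (real p))" by (simp add: n)
    also have "\<dots> \<le> 1 / 2" using p assms by (simp add: exp_minus field_simps)
    finally show ?thesis using norm_triangle_ineq2[of 1 "of_nat p powr (- s)"] by simp
  qed
qed

lemma norm_zeta_B_le_left:
  assumes "\<And>p. p \<in> B \<Longrightarrow> p \<ge> 2" "Re s \<le> - 1"
  shows "norm (zeta_B B s) \<le> 1"
  unfolding zeta_B_def prod_norm[symmetric]
  using norm_one_minus_powr_bounds(1)[OF assms(1) assms(2)]
  by (intro prod_le_1) (auto simp: norm_divide divide_le_eq_1)

lemma norm_zeta_B_le_right:
  assumes "\<And>p. p \<in> B \<Longrightarrow> p \<ge> 2" "Re s \<ge> 1"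
  shows "norm (zeta_B B s) \<le> 2 ^ card B"
proof -
  have "norm (1 / (1 - of_nat p powr (- s))) \<le> 2" if "p \<in> B" for p
    using norm_one_minus_powr_bounds(2)[OF assms(1)[OF that] assms(2)]
    by (simp add: norm_divide divide_le_eq)
  then have "(\<Prod>p\<in>B. norm (1 / (1 - of_nat p powr (- s)))) \<le> (\<Prod>p\<in>B. 2)"
    by (intro prod_mono) auto
  then show ?thesis by (simp add: zeta_B_def prod_norm)
qed

text \<open>Each new prime receives half of the remaining \<epsilon>. The condition covers two
  situations: odd \<open>n\<close>, where even the factor of \<open>p\<close> is harmless, and any
  nonzero \<open>n\<close> after \<open>p\<close> has been taken out of the product.\<close>

lemma norm_zeta_B_le_exp:
  fixes \<epsilon> :: real
  assumes "finite B" "\<And>q. q \<in> B \<Longrightarrow> prime q" "prime p" "\<epsilon> > 0"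
  shows "\<exists>C>0. \<forall>n :: int. \<forall>\<sigma>. (odd n \<or> n \<noteq> 0 \<and> p \<notin> B) \<longrightarrow>
    norm (zeta_B B (Complex \<sigma> (pi * of_int n / ln (real p)))) \<le> C * exp (\<epsilon> * \<bar>real_of_int n\<bar>)"
  using assms(1,2,4)
proof (induction B arbitrary: \<epsilon> rule: finite_induct)
  case empty
  then show ?case by (intro exI[of _ 1]) (auto simp: zeta_B_def)
next
  case (insert q B)
  let ?s = "\<lambda>\<sigma> n. Complex \<sigma> (pi * of_int n / ln (real p))"
  obtain C1 where C1: "C1 > 0" "\<And>n \<sigma>. odd n \<or> n \<noteq> 0 \<and> p \<notin> B \<Longrightarrow>
      norm (zeta_B B (?s \<sigma> n)) \<le> C1 * exp (\<epsilon> / 2 * \<bar>real_of_int n\<bar>)"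
    using insert.IH[of "\<epsilon> / 2"] insert.prems by auto
  obtain C2 where C2: "C2 > 0" "\<And>n \<sigma>. (if p = q then odd n else n \<noteq> 0) \<Longrightarrow>
      C2 * exp (- (\<epsilon> / 2) * \<bar>real_of_int n\<bar>) \<le> norm (1 - of_nat q powr (- ?s \<sigma> n))"
    using norm_one_minus_prime_powr_ge[of p q "\<epsilon> / 2"] insert.prems assms(3) by auto
  have "norm (zeta_B (insert q B) (?s \<sigma> n)) \<le> C1 / C2 * exp (\<epsilon> * \<bar>real_of_int n\<bar>)"
    if n: "odd n \<or> n \<noteq> 0 \<and> p \<notin> insert q B" for n \<sigma>
  proof -
    have n': "if p = q then odd n else n \<noteq> 0" using n by auto
    have e: "exp (\<epsilon> / 2 * \<bar>real_of_int n\<bar>) > 0" by simp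
    have "norm (zeta_B (insert q B) (?s \<sigma> n)) = norm (zeta_B B (?s \<sigma> n)) / norm (1 - of_nat q powr (- ?s \<sigma> n))"
      using insert.hyps by (simp add: zeta_B_def norm_mult norm_divide)
    also have "\<dots> \<le> (C1 * exp (\<epsilon> / 2 * \<bar>real_of_int n\<bar>)) / (C2 * exp (- (\<epsilon> / 2) * \<bar>real_of_int n\<bar>))"
      using C1 C2 n n' by (intro frac_le) auto
    also have "\<dots> = C1 / C2 * (exp (\<epsilon> / 2 * \<bar>real_of_int n\<bar>) * exp (\<epsilon> / 2 * \<bar>real_of_int n\<bar>))"
    proof -
      have "exp (- (\<epsilon> / 2) * \<bar>real_of_int n\<bar>) = inverse (exp (\<epsilon> / 2 * \<bar>real_of_int n\<bar>))"
        by (simp flip: exp_minus)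
      then show ?thesis by (simp only: divide_inverse inverse_mult_distrib inverse_inverse_eq mult_ac)
    qed
    also have "exp (\<epsilon> / 2 * \<bar>real_of_int n\<bar>) * exp (\<epsilon> / 2 * \<bar>real_of_int n\<bar>) = exp (\<epsilon> * \<bar>real_of_int n\<bar>)"
      by (simp flip: exp_add)
    finally show ?thesis .
  qed
  then show ?case using C1(1) C2(1) by (intro exI[of _ "C1 / C2"]) auto
qed

section \<open>Absolute convergence of the series of principal parts\<close>

lemma summable_on_exp_neg_abs_int:
  fixes c :: real
  assumes "c > 0"
  shows "(\<lambda>n :: int. exp (- c * \<bar>of_int n\<bar>)) summable_on UNIV"
proof -
  have "summable (\<lambda>n. exp (- c) ^ n)" using assms by (intro summable_geometric) auto
  then have "(\<lambda>n. exp (- c) ^ n) summable_on UNIV"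
    by (intro norm_summable_imp_summable_on) simp
  then have nat: "(\<lambda>n :: nat. exp (- c * real n)) summable_on UNIV"
    by (simp flip: exp_of_nat_mult add: mult.commute)
  have 1: "(\<lambda>n :: int. exp (- c * \<bar>of_int n\<bar>)) summable_on range int"
    by (subst summable_on_reindex) (use nat in \<open>simp_all add: o_def\<close>)
  have "(\<lambda>n :: int. exp (- c * \<bar>of_int n\<bar>)) summable_on range (\<lambda>n. - int n)"
    by (subst summable_on_reindex) (use nat in \<open>simp_all add: o_def inj_def\<close>)
  then have "(\<lambda>n :: int. exp (- c * \<bar>of_int n\<bar>)) summable_on (range (\<lambda>n. - int n) - range int)"
    by (rule summable_on_subset) auto
  with 1 have "(\<lambda>n :: int. exp (- c * \<bar>of_int n\<bar>)) summable_on (range int \<union> (range (\<lambda>n. - int n) - range int))"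
    by (intro summable_on_Un_disjoint) auto
  moreover have "range int \<union> (range (\<lambda>n. - int n) - range int) = UNIV"
  proof -
    have "x \<in> range int \<or> x \<in> range (\<lambda>n. - int n)" for x :: int
      by (cases x rule: int_cases2) auto
    then show ?thesis by auto
  qed
  ultimately show ?thesis by simp
qed

text \<open>The residue at \<open>imag_pole p n\<close> of the function before removal of
  singularities. The value at \<open>n = 0\<close> reflects that \<open>s ^ card B\<close> cancels
  the common pole of the Euler factors there.\<close>

definition imag_res :: "nat set \<Rightarrow> nat \<Rightarrow> int \<Rightarrow> complex" where
  "imag_res B p n = (if n = 0 then 0
     else xi_kernel (card B) (imag_pole p n) * zeta_B (B - {p}) (imag_pole p n) / of_real (ln (real p)))"

definition even_res :: "nat set \<Rightarrow> nat \<Rightarrow> complex" where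
  "even_res B n = (-1) ^ n * (2 * of_real pi ^ n * (2 * of_nat n + 1) *
     ((- 2 * of_nat n) ^ card B * (1 + 2 * of_nat n) ^ card B * zeta_B B (- 2 * of_nat n))) / Gamma (of_nat n)"

lemma imag_res_bound:
  assumes B: "finite B" "\<And>q. q \<in> B \<Longrightarrow> prime q" "p \<in> B"
  shows "\<exists>C>0. \<exists>c>0. \<forall>n. norm (imag_res B p n) \<le> C * exp (- c * \<bar>of_int n\<bar>)"
proof -
  have p: "p \<ge> 2" using B by (auto simp: prime_ge_2_nat)
  define w where "w = ln (real p)"
  have w: "w > 0" using p by (simp add: w_def)
  obtain C1 where C1: "C1 > 0" "\<And>s. Re s = 0 \<Longrightarrow> norm (xi_kernel (card B) s) \<le> C1 * exp (- \<bar>Im s\<bar> / 16)"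
    using xi_kernel_exp_decay[of 0 0 "card B"] by force
  \<comment> \<open>In half steps the pole \<open>imag_pole p n\<close> has index
    \<open>2 n\<close>. The Euler product thus costs exp (pi |n| / (16 w)), half of the decay exp (-
    pi |n| / (8 w)) of the kernel.\<close>
  define \<epsilon> where "\<epsilon> = pi / (32 * w)"
  have \<epsilon>: "\<epsilon> > 0" using w by (simp add: \<epsilon>_def)
  obtain C2 where C2: "C2 > 0" "\<And>n \<sigma>. n \<noteq> 0 \<Longrightarrow>
     norm (zeta_B (B - {p}) (Complex \<sigma> (pi * of_int n / w))) \<le> C2 * exp (\<epsilon> * \<bar>real_of_int n\<bar>)"
    using norm_zeta_B_le_exp[of "B - {p}" p \<epsilon>] B \<epsilon> unfolding w_def by auto
  have "norm (imag_res B p n) \<le> C1 * C2 / w * exp (- (pi / (16 * w)) * \<bar>of_int n\<bar>)" for n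
  proof (cases "n = 0")
    case True
    then show ?thesis using C1 C2 w by (simp add: imag_res_def)
  next
    case False
    have "norm (xi_kernel (card B) (imag_pole p n)) \<le> C1 * exp (- (pi / (8 * w)) * \<bar>of_int n\<bar>)"
      using C1(2)[of "imag_pole p n"] w by (simp add: imag_pole_eq_Complex w_def abs_mult)
    moreover have "norm (zeta_B (B - {p}) (imag_pole p n)) \<le> C2 * exp (pi / (16 * w) * \<bar>of_int n\<bar>)"
      using C2(2)[of "2 * n" 0] False by (simp add: imag_pole_eq_Complex w_def \<epsilon>_def abs_mult mult_ac)
    ultimately have "norm (imag_res B p n) \<le> (C1 * exp (- (pi / (8 * w)) * \<bar>of_int n\<bar>)) * (C2 * exp (pi / (16 * w) * \<bar>of_int n\<bar>)) / w"
      using False w C1(1) by (auto simp: imag_res_def norm_mult norm_divide w_def intro!: divide_right_mono mult_mono)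
    also have "\<dots> = C1 * C2 / w * (exp (- (pi / (8 * w)) * \<bar>of_int n\<bar>) * exp (pi / (16 * w) * \<bar>of_int n\<bar>))"
      by simp
    also have "exp (- (pi / (8 * w)) * \<bar>of_int n\<bar>) * exp (pi / (16 * w) * \<bar>of_int n\<bar>) = exp (- (pi / (16 * w)) * \<bar>of_int n\<bar>)"
      by (simp add: field_simps flip: exp_add)
    finally show ?thesis .
  qed
  moreover have "C1 * C2 / w > 0" "pi / (16 * w) > 0" using C1 C2 w by auto
  ultimately show ?thesis by blast
qed

text \<open>Only finitely many \<open>b n\<close> come within distance 1 of \<open>s\<close> and
  none equals \<open>s\<close>, so the denominators are bounded away from 0.\<close>

lemma summable_on_div_discrete:
  fixes a b :: "'i \<Rightarrow> complex"
  assumes a: "(\<lambda>n. norm (a n)) summable_on A" and fin: "finite {n \<in> A. norm (s - b n) < 1}"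
    and s: "\<And>n. n \<in> A \<Longrightarrow> s \<noteq> b n"
  shows "(\<lambda>n. a n / (s - b n)) summable_on A"
proof -
  define d where "d = Min (insert 1 ((\<lambda>n. norm (s - b n)) ` {n \<in> A. norm (s - b n) < 1}))"
  have d: "d > 0" unfolding d_def using fin s by (subst Min_gr_iff) auto
  have d_le: "d \<le> norm (s - b n)" if "n \<in> A" for n
  proof (cases "norm (s - b n) < 1")
    case True
    then show ?thesis unfolding d_def using fin that by (intro Min_le) auto
  next
    case False
    have "d \<le> 1" unfolding d_def using fin by (intro Min_le) auto
    then show ?thesis using False by simp
  qed
  have "(\<lambda>n. norm (a n / (s - b n))) summable_on A"
  proof (rule summable_on_comparison_test)
    show "(\<lambda>n. norm (a n) * (1 / d)) summable_on A" using a by (rule summable_on_cmult_left)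
    show "norm (a n / (s - b n)) \<le> norm (a n) * (1 / d)" if "n \<in> A" for n
      using d d_le[OF that] by (simp add: norm_divide frac_le)
  qed auto
  then show ?thesis by (rule abs_summable_summable)
qed

abbreviation imag_height :: "nat \<Rightarrow> int \<Rightarrow> real" where
  "imag_height p n \<equiv> 2 * pi * of_int n / ln (real p)"

lemma finite_bounded_imag_poles:
  assumes "p \<ge> 2"
  shows "finite {n. \<bar>imag_height p n\<bar> \<le> T}"
proof (rule finite_subset)
  define M where "M = \<lceil>T * ln (real p) / (2 * pi)\<rceil>"
  have w: "ln (real p) > 0" using assms by simp
  show "{n. \<bar>imag_height p n\<bar> \<le> T} \<subseteq> {- M..M}"
  proof
    fix n assume "n \<in> {n. \<bar>imag_height p n\<bar> \<le> T}"
    then have "\<bar>of_int n\<bar> \<le> T * ln (real p) / (2 * pi)" using w by (simp add: abs_mult field_simps)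
    then have "\<bar>of_int n\<bar> \<le> real_of_int M" unfolding M_def by linarith
    then show "n \<in> {- M..M}" by (auto simp: abs_le_iff)
  qed
qed simp

lemma imag_series_summable:
  assumes B: "finite B" "\<And>q. q \<in> B \<Longrightarrow> prime q" "p \<in> B" and s: "\<And>n. s \<noteq> imag_pole p n"
  shows "(\<lambda>n. imag_res B p n / (s - imag_pole p n)) summable_on UNIV"
proof (rule summable_on_div_discrete)
  obtain C c where C: "c > 0" "\<And>n. norm (imag_res B p n) \<le> C * exp (- c * \<bar>of_int n\<bar>)"
    using imag_res_bound[OF B] by blast
  have "(\<lambda>n :: int. C * exp (- c * \<bar>of_int n\<bar>)) summable_on UNIV"
    by (intro summable_on_cmult_right summable_on_exp_neg_abs_int C)
  then show "(\<lambda>n. norm (imag_res B p n)) summable_on UNIV"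
    by (rule summable_on_comparison_test) (use C in auto)
  have p: "p \<ge> 2" using B by (auto simp: prime_ge_2_nat)
  show "finite {n \<in> UNIV. norm (s - imag_pole p n) < 1}"
  proof (rule finite_subset[OF _ finite_bounded_imag_poles[OF p, of "norm s + 1"]], safe)
    fix n assume "norm (s - imag_pole p n) < 1"
    then have "norm (imag_pole p n) \<le> norm s + 1"
      using norm_triangle_ineq3[of s "imag_pole p n"] by linarith
    then show "\<bar>imag_height p n\<bar> \<le> norm s + 1"
      using abs_Im_le_cmod[of "imag_pole p n"] by (simp add: imag_pole_eq_Complex)
  qed
qed (use s in auto)

lemma even_series_summable:
  assumes B: "finite B" "\<And>q. q \<in> B \<Longrightarrow> prime q" and s: "\<And>n. n \<ge> 1 \<Longrightarrow> s \<noteq> - 2 * of_nat n"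
  shows "(\<lambda>n. even_res B n / (s - (- 2 * of_nat n))) summable_on {1..}"
proof (rule summable_on_div_discrete)
  let ?m = "2 * card B + 1"
  have bound: "norm (even_res B (Suc n)) \<le> 2 * pi * (real (2 * n + 4) ^ ?m * pi ^ n / fact n)" for n
  proof -
    have z: "norm (zeta_B B (- 2 * of_nat (Suc n))) \<le> 1"
      using B by (intro norm_zeta_B_le_left) (auto simp: prime_ge_2_nat)
    have n1: "norm (1 + 2 * of_nat (Suc n) :: complex) = real (2 * n + 3)"
      using norm_of_nat[of "2 * n + 3", where ?'a = complex] by (simp add: algebra_simps)
    have n2: "norm (2 * of_nat (Suc n) :: complex) = real (2 * n + 2)"
      using norm_of_nat[of "2 * n + 2", where ?'a = complex] by (simp add: algebra_simps)
    have Gf: "norm (Gamma (of_nat (Suc n)) :: complex) = fact n"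
      by (simp only: of_nat_Suc Gamma_fact norm_fact)
    have "norm (even_res B (Suc n)) = 2 * pi ^ Suc n * norm (1 + 2 * of_nat (Suc n) :: complex) *
       (norm (2 * of_nat (Suc n) :: complex) ^ card B * norm (1 + 2 * of_nat (Suc n) :: complex) ^ card B *
         norm (zeta_B B (- 2 * of_nat (Suc n)))) / norm (Gamma (of_nat (Suc n)) :: complex)"
      unfolding even_res_def
      by (simp only: norm_mult norm_divide norm_power norm_minus_cancel norm_one norm_of_real abs_of_pos[OF pi_gt_zero]
           power_one mult_1 norm_numeral add.commute mult_minus_left)
    then have eq: "norm (even_res B (Suc n)) = 2 * pi ^ Suc n * real (2 * n + 3) *
       (real (2 * n + 2) ^ card B * real (2 * n + 3) ^ card B * norm (zeta_B B (- 2 * of_nat (Suc n)))) / fact n"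
      by (simp only: n1 n2 Gf)
    have le: "2 * pi ^ Suc n * real (2 * n + 3) *
       (real (2 * n + 2) ^ card B * real (2 * n + 3) ^ card B * norm (zeta_B B (- 2 * of_nat (Suc n)))) / fact n \<le>
       2 * pi ^ Suc n * real (2 * n + 4) * (real (2 * n + 4) ^ card B * real (2 * n + 4) ^ card B * 1) / fact n"
      using z by (intro divide_right_mono mult_mono power_mono) auto
    have gen: "2 * pi ^ Suc n * r * (r ^ b * r ^ b * 1) / F = 2 * pi * (r ^ (2 * b + 1) * pi ^ n / F)"
      for r F :: real and b
    proof -
      have "r ^ (2 * b + 1) = r * (r ^ b * r ^ b)" by (simp add: power_add mult_2)
      then show ?thesis by (simp only: power_Suc times_divide_eq_right mult_1_right mult_ac)
    qed
    show ?thesis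
      using le unfolding eq[symmetric] gen[of "real (2 * n + 4)" "card B" "fact n"] .
  qed
  have "summable (\<lambda>n. 2 * pi * (real (2 * n + 4) ^ ?m * pi ^ n / fact n))"
  proof (intro summable_mult)
    \<comment> \<open>Boundedness with 2 pi in place of pi yields a geometric majorant of ratio 1/2
      for the series with pi.\<close>
    have "(\<lambda>N. real (2 * N + 4) ^ ?m * (2 * pi) ^ N / fact N) \<longlonglongrightarrow> 0"
      by (rule poly_times_power_over_fact_LIMSEQ)
    then have "Bseq (\<lambda>N. real (2 * N + 4) ^ ?m * (2 * pi) ^ N / fact N)"
      by (intro convergent_imp_Bseq) (auto simp: convergent_def)
    then obtain D where D: "D > 0" "\<And>N. norm (real (2 * N + 4) ^ ?m * (2 * pi) ^ N / fact N) \<le> D"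
      by (auto simp: Bseq_def)
    show "summable (\<lambda>n. real (2 * n + 4) ^ ?m * pi ^ n / fact n)"
    proof (rule summable_comparison_test')
      show "summable (\<lambda>n. D * (1 / 2) ^ n)" by (intro summable_mult summable_geometric) auto
      fix n :: nat
      have "real (2 * n + 4) ^ ?m * pi ^ n / fact n = (real (2 * n + 4) ^ ?m * (2 * pi) ^ n / fact n) * (1 / 2) ^ n"
        by (simp add: power_mult_distrib power_divide)
      then show "norm (real (2 * n + 4) ^ ?m * pi ^ n / fact n) \<le> D * (1 / 2) ^ n"
        using mult_right_mono[OF D(2)[of n], of "(1 / 2) ^ n"] by (simp only: norm_mult norm_power) simp
    qed
  qed
  then have "summable (\<lambda>n. norm (even_res B (Suc n)))"
    by (rule summable_comparison_test'[of _ 0]) (use bound in simp)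
  then have "(\<lambda>n. norm (even_res B (Suc n))) summable_on UNIV"
    by (intro norm_summable_imp_summable_on) simp
  moreover have "bij_betw Suc UNIV {1..}"
    by (rule bij_betwI[of _ _ _ "\<lambda>n. n - 1"]) auto
  ultimately show "(\<lambda>n. norm (even_res B n)) summable_on {1..}"
    using summable_on_reindex_bij_betw[of Suc UNIV "{1..}" "\<lambda>n. norm (even_res B n)"] by simp
  show "finite {n \<in> {1..}. norm (s - - 2 * of_nat n) < 1}"
  proof (rule finite_subset)
    show "{n \<in> {1..}. norm (s - - 2 * of_nat n) < 1} \<subseteq> {..nat \<lceil>norm s + 1\<rceil>}"
    proof
      fix n :: nat assume "n \<in> {n \<in> {1..}. norm (s - - 2 * of_nat n) < 1}"
      then have "norm (s - - 2 * of_nat n) < 1" by simp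
      then have "norm (2 * of_nat n :: complex) \<le> norm s + 1"
        using norm_triangle_ineq3[of s "- 2 * of_nat n"] by simp
      then have "real n \<le> norm s + 1" by (simp add: norm_mult)
      then show "n \<in> {..nat \<lceil>norm s + 1\<rceil>}" by simp linarith
    qed
  qed simp
qed (use s in auto)


section \<open>Location of the singularities\<close>

lemma imag_pole_neq:
  assumes "prime p" "prime q" "p \<noteq> q" "n \<noteq> 0"
  shows "imag_pole p n \<noteq> imag_pole q k"
proof
  assume eq: "imag_pole p n = imag_pole q k"
  \<comment> \<open>A positive lower bound forbids the factor of \<open>q\<close> to vanish at a
    pole belonging to \<open>p\<close>; this expresses the irrationality of ln q / ln p.\<close>
  obtain C where C: "C > 0" "\<And>n :: int. \<And>\<sigma>. n \<noteq> 0 \<Longrightarrow>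
      C * exp (- 1 * \<bar>real_of_int n\<bar>) \<le> norm (1 - of_nat q powr (- Complex \<sigma> (pi * of_int n / ln (real p))))"
    using norm_one_minus_prime_powr_ge[OF assms(1,2), of 1] assms(3) by auto
  have "Complex 0 (pi * of_int (2 * n) / ln (real p)) = imag_pole q k"
    using eq by (simp add: imag_pole_eq_Complex mult_ac)
  then have "1 - of_nat q powr (- Complex 0 (pi * of_int (2 * n) / ln (real p))) = 0"
    using one_minus_powr_eq_0_iff[of q] assms(2) by (auto simp: prime_ge_2_nat)
  then have "C * exp (- 1 * \<bar>real_of_int (2 * n)\<bar>) \<le> 0" using C(2)[of "2 * n" 0] assms(4) by simp
  then show False using C(1) by (simp add: mult_le_0_iff)
qed

lemma imag_pole_inject: "p \<ge> 2 \<Longrightarrow> imag_pole p n = imag_pole p k \<longleftrightarrow> n = k"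
  by (simp add: imag_pole_eq_Complex)

lemma Re_imag_pole [simp]: "Re (imag_pole p n) = 0"
  by (simp add: imag_pole_eq_Complex)

text \<open>The plain product, to which analyticity and residue computations apply directly. It
  agrees with \<open>xi_colon\<close> away from the exceptional points; at 0 it need not.\<close>

definition xi_raw :: "nat set \<Rightarrow> complex \<Rightarrow> complex" where
  "xi_raw B s = xi_kernel (card B) s * zeta_B B s"

definition imag_poles :: "nat set \<Rightarrow> complex set" where
  "imag_poles B = {imag_pole p n | p n. p \<in> B}"

definition even_poles :: "complex set" where
  "even_poles = {- 2 * of_nat n | n. n \<ge> 1}"

lemma finite_bounded_poles:
  assumes B: "finite B" "\<And>p. p \<in> B \<Longrightarrow> prime p"
  shows "finite {z \<in> imag_poles B \<union> even_poles. norm z \<le> R}"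
proof (rule finite_subset)
  let ?S = "(\<Union>p\<in>B. imag_pole p ` {n. \<bar>imag_height p n\<bar> \<le> R}) \<union> (\<lambda>n. - 2 * of_nat n) ` {..nat \<lceil>R\<rceil>}"
  show "{z \<in> imag_poles B \<union> even_poles. norm z \<le> R} \<subseteq> ?S"
  proof
    fix z assume z: "z \<in> {z \<in> imag_poles B \<union> even_poles. norm z \<le> R}"
    then have nz: "norm z \<le> R" by simp
    from z consider p n where "p \<in> B" "z = imag_pole p n" | n where "n \<ge> 1" "z = - 2 * of_nat n"
      unfolding imag_poles_def even_poles_def by blast
    then show "z \<in> ?S"
    proof cases
      case 1
      have "imag_height p n = Im z" using 1 by (simp add: imag_pole_eq_Complex)
      then have "\<bar>imag_height p n\<bar> \<le> R" using nz abs_Im_le_cmod[of z] by linarith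
      then show ?thesis using 1 by blast
    next
      case 2
      then have "real n \<le> R" using nz by (simp add: norm_mult)
      then have "n \<in> {..nat \<lceil>R\<rceil>}" by simp linarith
      then show ?thesis using 2 by blast
    qed
  qed
  show "finite ?S"
    using B by (intro finite_UnI finite_UN_I finite_imageI finite_bounded_imag_poles) (auto simp: prime_ge_2_nat)
qed

lemma zeta_B_analytic:
  assumes "\<And>p. p \<in> B \<Longrightarrow> prime p" "s \<notin> imag_poles B"
  shows "zeta_B B analytic_on {s}"
proof -
  have "(\<lambda>s. \<Prod>p\<in>B. 1 / (1 - of_nat p powr (- s))) analytic_on {s}"
  proof (intro analytic_on_prod analytic_on_divide analytic_on_const)
    fix p assume p: "p \<in> B"
    then have p2: "p \<ge> 2" using assms(1) prime_ge_2_nat by blast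
    then show "(\<lambda>s. 1 - of_nat p powr (- s)) analytic_on {s}"
      using one_minus_powr_holomorphic[of p UNIV] by (auto simp: analytic_at)
    show "1 - of_nat p powr (- z) \<noteq> 0" if "z \<in> {s}" for z
      using that one_minus_powr_eq_0_iff[OF p2] assms(2) p by (auto simp: imag_poles_def)
  qed
  then show ?thesis by (simp add: zeta_B_def[abs_def])
qed

lemma xi_kernel_analytic:
  assumes "s \<notin> even_poles"
  shows "xi_kernel m analytic_on {s}"
  unfolding xi_kernel_def[abs_def]
  using assms by (intro analytic_intros g_kernel_analytic) (auto simp: half_nonpos_Int_iff even_poles_def)

lemma xi_raw_analytic:
  assumes "\<And>p. p \<in> B \<Longrightarrow> prime p" "s \<notin> imag_poles B" "s \<notin> even_poles"
  shows "xi_raw B analytic_on {s}"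
  unfolding xi_raw_def[abs_def]
  by (intro analytic_on_mult xi_kernel_analytic zeta_B_analytic assms)

lemma xi_colon_eq_xi_raw:
  assumes "\<And>p. p \<in> B \<Longrightarrow> prime p" "s \<notin> imag_poles B" "s \<notin> even_poles"
  shows "xi_colon B s = xi_raw B s"
proof -
  have "(\<lambda>s. s ^ card B * (1 - s) ^ card B * xi_B B s) = xi_raw B"
    by (rule ext) (simp add: xi_B_def xi_raw_def xi_kernel_def g_fun_eq_g_kernel)
  then show ?thesis
    unfolding xi_colon_def using xi_raw_analytic[OF assms] by simp
qed

lemma zeta_colon_even_pole:
  assumes "\<And>p. p \<in> B \<Longrightarrow> prime p" "n \<ge> 1"
  shows "zeta_colon B (- 2 * of_nat n) = (- 2 * of_nat n) ^ card B * (1 + 2 * of_nat n) ^ card B * zeta_B B (- 2 * of_nat n)"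
proof -
  have "(- 2 * of_nat n :: complex) \<notin> imag_poles B"
  proof
    assume "(- 2 * of_nat n :: complex) \<in> imag_poles B"
    then obtain p k where "(- 2 * of_nat n :: complex) = imag_pole p k" by (auto simp: imag_poles_def)
    then have "Re (- 2 * of_nat n :: complex) = 0" by (metis Re_imag_pole)
    then show False using assms(2) by simp
  qed
  then have "(\<lambda>s. s ^ card B * (1 - s) ^ card B * zeta_B B s) analytic_on {- 2 * of_nat n}"
    by (intro analytic_intros zeta_B_analytic assms)
  then show ?thesis by (simp add: zeta_colon_def)
qed

lemma imag_pole_not_even_pole: "imag_pole p n \<notin> even_poles"
proof
  assume "imag_pole p n \<in> even_poles"
  then obtain k where "k \<ge> 1" "imag_pole p n = - 2 * of_nat k" by (auto simp: even_poles_def)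
  then have "Re (- 2 * of_nat k :: complex) = 0" by (metis Re_imag_pole)
  then show False using \<open>k \<ge> 1\<close> by simp
qed

lemma imag_pole_not_in_imag_poles_Diff:
  assumes "\<And>q. q \<in> B \<Longrightarrow> prime q" "prime p" "n \<noteq> 0"
  shows "imag_pole p n \<notin> imag_poles (B - {p})"
  using imag_pole_neq[OF assms(2) assms(1) _ assms(3)] by (auto simp: imag_poles_def)

text \<open>Removing \<open>p\<close> lowers the exponent \<open>card B\<close> by one, and the
  explicit factor z (1 - z) restores it, so the coefficients become residues. At these points
  \<open>xi_colon (B - {p})\<close> may be replaced by the plain product, since poles of different
  primes are distinct.\<close>

lemma xi_colon_pp_eq:
  assumes B: "finite B" "\<And>p. p \<in> B \<Longrightarrow> prime p"
  shows "xi_colon_pp B s = (\<Sum>p\<in>B. \<Sum>\<^sub>\<infinity>n\<in>UNIV. imag_res B p n / (s - imag_pole p n)) +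
    (\<Sum>\<^sub>\<infinity>n\<in>{1..}. even_res B n / (s - (- 2 * of_nat n)))"
proof -
  have "imag_pole p n * (1 - imag_pole p n) * xi_colon (B - {p}) (imag_pole p n) /
        (of_real (ln (real p)) * (s - imag_pole p n)) = imag_res B p n / (s - imag_pole p n)"
    if p: "p \<in> B" for p n
  proof (cases "n = 0")
    case True
    then show ?thesis by (simp add: imag_res_def imag_pole_def)
  next
    case False
    have "xi_colon (B - {p}) (imag_pole p n) = xi_raw (B - {p}) (imag_pole p n)"
      using B p False by (intro xi_colon_eq_xi_raw imag_pole_not_even_pole imag_pole_not_in_imag_poles_Diff) auto
    moreover have "xi_kernel (card B) z = z * (1 - z) * xi_kernel (card (B - {p})) z" for z
    proof -
      have "card B = Suc (card (B - {p}))" using card.remove[OF B(1) p] .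
      then show ?thesis by (simp only: xi_kernel_def power_Suc mult_ac)
    qed
    ultimately show ?thesis
      using False by (simp only: imag_res_def xi_raw_def if_False divide_divide_eq_left mult.assoc)
  qed
  moreover have "(-1) ^ n * (2 * of_real pi ^ n * (2 * of_nat n + 1) * zeta_colon B (- 2 * of_nat n)) /
        (Gamma (of_nat n) * (s + 2 * of_nat n)) = even_res B n / (s - (- 2 * of_nat n))" if "n \<in> {1..}" for n
  proof -
    have "s - (- 2 * of_nat n) = s + 2 * of_nat n" by simp
    moreover have "n \<ge> 1" using that by simp
    ultimately show ?thesis
      using zeta_colon_even_pole[OF B(2) \<open>n \<ge> 1\<close>] by (simp only: even_res_def divide_divide_eq_left)
  qed
  ultimately show ?thesis
    unfolding xi_colon_pp_def by (intro arg_cong2[where f = "(+)"] sum.cong infsum_cong refl)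
qed

section \<open>Residues of the integrand\<close>

lemma residue_analytic_quotient:
  assumes h: "h analytic_on {z}" and E: "E analytic_on {z}" "E z = 0"
    and E': "(E has_field_derivative E') (at z)" "E' \<noteq> 0"
  shows "residue (\<lambda>w. h w / E w) z = h z / E'"
proof -
  obtain A1 where A1: "open A1" "z \<in> A1" "h holomorphic_on A1" using h by (auto simp: analytic_at)
  obtain A2 where A2: "open A2" "z \<in> A2" "E holomorphic_on A2" using E by (auto simp: analytic_at)
  have lim: "((\<lambda>w. (E w - E z) / (w - z)) \<longlongrightarrow> E') (at z)"
    using E'(1) by (simp add: has_field_derivative_iff)
  then have "eventually (\<lambda>w. (E w - E z) / (w - z) \<noteq> 0) (at z)"
    using E'(2) by (rule tendsto_imp_eventually_ne)
  then obtain A3 where A3: "open A3" "z \<in> A3" "\<And>w. w \<in> A3 \<Longrightarrow> w \<noteq> z \<Longrightarrow> E w \<noteq> 0"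
    using E(2) by (auto simp: eventually_at_topological)
  have "open (A1 \<inter> A2 \<inter> A3)" "z \<in> A1 \<inter> A2 \<inter> A3" using A1 A2 A3 by auto
  moreover have "(\<lambda>w. h w / E w) holomorphic_on (A1 \<inter> A2 \<inter> A3 - {z})"
    using A1 A2 A3 by (intro holomorphic_on_divide) (auto intro: holomorphic_on_subset)
  moreover have "((\<lambda>w. h w / E w * (w - z)) \<longlongrightarrow> h z / E') (at z)"
  proof -
    have "h \<midarrow>z\<rightarrow> h z" using h by (auto dest!: analytic_at_imp_isCont simp: isCont_def)
    then have "((\<lambda>w. h w / ((E w - E z) / (w - z))) \<longlongrightarrow> h z / E') (at z)"
      using lim E'(2) by (intro tendsto_divide)
    then show ?thesis using E(2) by simp
  qed
  ultimately show ?thesis by (rule residue_simple')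
qed

lemma not_in_poles_of_Re_neq_0: "Re s \<noteq> 0 \<Longrightarrow> s \<notin> imag_poles B"
  by (auto simp: imag_poles_def)

lemma residue_at_regular_point:
  assumes "\<And>p. p \<in> B \<Longrightarrow> prime p" "s \<notin> imag_poles B" "s \<notin> even_poles"
  shows "residue (\<lambda>w. xi_raw B w / (w - s)) s = xi_raw B s"
proof -
  have "residue (\<lambda>w. xi_raw B w / (w - s)) s = xi_raw B s / 1"
    by (intro residue_analytic_quotient xi_raw_analytic assms analytic_intros) (auto intro!: derivative_eq_intros)
  then show ?thesis by simp
qed

lemma residue_at_imag_pole:
  assumes B: "finite B" "\<And>p. p \<in> B \<Longrightarrow> prime p" and p: "p \<in> B" and n: "n \<noteq> 0" and s: "s \<noteq> imag_pole p n"
  shows "residue (\<lambda>w. xi_raw B w / (w - s)) (imag_pole p n) = - imag_res B p n / (s - imag_pole p n)"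
proof -
  define z where "z = imag_pole p n"
  have p2: "p \<ge> 2" using B p prime_ge_2_nat by blast
  have "(\<lambda>w. xi_raw B w / (w - s)) =
      (\<lambda>w. (xi_kernel (card B) w * zeta_B (B - {p}) w / (w - s)) / (1 - of_nat p powr (- w)))"
    using B p by (auto simp: xi_raw_def zeta_B_def prod.remove fun_eq_iff)
  moreover have "residue \<dots> z = (xi_kernel (card B) z * zeta_B (B - {p}) z / (z - s)) / of_real (ln (real p))"
  proof (rule residue_analytic_quotient)
    show "(\<lambda>w. xi_kernel (card B) w * zeta_B (B - {p}) w / (w - s)) analytic_on {z}"
      using B p n s unfolding z_def
      by (intro analytic_intros xi_kernel_analytic zeta_B_analytic imag_pole_not_even_pole
          imag_pole_not_in_imag_poles_Diff) auto
    show "(\<lambda>s. 1 - of_nat p powr (- s)) analytic_on {z}"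
      using one_minus_powr_holomorphic[of p UNIV] p2 by (auto simp: analytic_at)
    show E0: "1 - of_nat p powr (- z) = 0" using one_minus_powr_eq_0_iff[OF p2] by (auto simp: z_def)
    then show "((\<lambda>s. 1 - of_nat p powr (- s)) has_field_derivative of_real (ln (real p))) (at z)"
      using one_minus_powr_has_field_derivative[of p z] p2 by simp
  qed (use p2 in auto)
  ultimately have "residue (\<lambda>w. xi_raw B w / (w - s)) z =
      (xi_kernel (card B) z * zeta_B (B - {p}) z / (z - s)) / of_real (ln (real p))"
    by (simp only:)
  also have "\<dots> = imag_res B p n / (z - s)"
    using n by (simp add: imag_res_def z_def)
  also have "\<dots> = - imag_res B p n / (s - z)"
    by (metis minus_diff_eq minus_divide_divide)
  finally show ?thesis by (simp only: z_def)
qed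

text \<open>With \<open>Gamma\<close> written as the reciprocal of \<open>rGamma\<close>, the pole
  comes from a simple zero of the denominator. The derivative of \<open>rGamma\<close> at -k is
  (-1)^k k! with k = n - 1, and the inner function 1 + w/2 contributes 1/2; this explains the 2, the
  sign and \<open>Gamma n\<close> in \<open>even_res\<close>.\<close>

lemma residue_at_even_pole:
  assumes B: "finite B" "\<And>p. p \<in> B \<Longrightarrow> prime p" and n: "n \<ge> 1" and s: "s \<noteq> - 2 * of_nat n"
  shows "residue (\<lambda>w. xi_raw B w / (w - s)) (- 2 * of_nat n) = - even_res B n / (s - (- 2 * of_nat n))"
proof -
  define z :: complex where "z = - 2 * of_nat n"
  obtain k where k: "n = Suc k" using n by (cases n) auto
  have zk: "1 + z / 2 = - of_nat k" by (simp add: z_def k field_simps)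
  define h where "h w = w ^ card B * (1 - w) ^ card B * ((w - 1) * of_real pi powr (- w / 2)) * zeta_B B w / (w - s)" for w
  have "(\<lambda>w. xi_raw B w / (w - s)) = (\<lambda>w. h w / rGamma (1 + w / 2))"
    by (rule ext) (simp add: xi_raw_def xi_kernel_def g_kernel_def h_def Gamma_def divide_simps)
  moreover have "residue (\<lambda>w. h w / rGamma (1 + w / 2)) z = h z / ((-1) ^ k * fact k / 2)"
  proof (rule residue_analytic_quotient)
    have "Re z \<noteq> 0" using n by (simp add: z_def)
    then show "h analytic_on {z}"
      unfolding h_def[abs_def] using B s
      by (intro analytic_intros pi_powr_analytic zeta_B_analytic not_in_poles_of_Re_neq_0) (auto simp: z_def)
    show "(\<lambda>w. rGamma (1 + w / 2)) analytic_on {z}" by (intro analytic_intros) auto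
    show "rGamma (1 + z / 2) = 0" unfolding zk by (simp add: rGamma_eq_zero_iff)
    have "((\<lambda>w. rGamma (1 + w / 2)) has_field_derivative ((-1) ^ k * fact k) * (1 / 2)) (at z)"
    proof (rule DERIV_chain2[where f = rGamma and g = "\<lambda>w. 1 + w / 2"])
      show "(rGamma has_field_derivative (-1) ^ k * fact k) (at (1 + z / 2))"
        unfolding zk by (rule has_field_derivative_rGamma_nonpos_int)
    qed (auto intro!: derivative_eq_intros)
    then show "((\<lambda>w. rGamma (1 + w / 2)) has_field_derivative (-1) ^ k * fact k / 2) (at z)" by simp
  qed simp
  ultimately have "residue (\<lambda>w. xi_raw B w / (w - s)) z = h z / ((-1) ^ k * fact k / 2)"
    by (simp only:)
  also have "\<dots> = 2 * (-1) ^ k / fact k * h z"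
    by (cases "even k") simp_all
  also have "h z = z ^ card B * (1 - z) ^ card B * ((z - 1) * of_real pi ^ n) * zeta_B B z / (z - s)"
  proof -
    have "- z / 2 = of_nat n" by (simp add: z_def)
    then show ?thesis unfolding h_def by (simp add: powr_nat' n)
  qed
  finally have R: "residue (\<lambda>w. xi_raw B w / (w - s)) z = 2 * (-1) ^ k / fact k *
      (z ^ card B * (1 - z) ^ card B * ((z - 1) * of_real pi ^ n) * zeta_B B z / (z - s))" .
  have "Gamma (of_nat n :: complex) = fact k" unfolding k by (simp only: of_nat_Suc Gamma_fact)
  moreover have "(-1 :: complex) ^ n = - ((-1) ^ k)" by (simp add: k)
  moreover have "2 * of_nat n + 1 = - (z - 1)" "1 + 2 * of_nat n = 1 - z" by (simp_all add: z_def)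
  ultimately have "even_res B n = 2 * (-1) ^ k / fact k *
      (z ^ card B * (1 - z) ^ card B * ((z - 1) * of_real pi ^ n) * zeta_B B z)"
    unfolding even_res_def z_def[symmetric] by (simp only: minus_mult_minus mult_minus_left mult_minus_right) simp
  with R have "residue (\<lambda>w. xi_raw B w / (w - s)) z = even_res B n / (z - s)"
    by (simp only: times_divide_eq_right)
  also have "\<dots> = - even_res B n / (s - z)"
    by (metis minus_diff_eq minus_divide_divide)
  finally show ?thesis by (simp only: z_def)
qed

text \<open>The \<open>card B\<close> factors \<open>w\<close> are shared out among the Euler
  factors, and \<open>w / (1 - p^(-w))\<close> tends to \<open>1 / ln p\<close>. So the product has
  a finite limit at 0, and multiplication by one more \<open>w\<close> gives 0.\<close>

lemma residue_at_0:
  assumes B: "finite B" "\<And>p. p \<in> B \<Longrightarrow> prime p" and s: "s \<noteq> 0"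
    and A: "open A" "0 \<in> A" "(\<lambda>w. xi_raw B w / (w - s)) holomorphic_on A - {0}"
  shows "residue (\<lambda>w. xi_raw B w / (w - s)) 0 = 0"
proof (rule residue_simple'[OF A])
  have lim: "((\<lambda>w. w / (1 - of_nat p powr (- w))) \<longlongrightarrow> 1 / of_real (ln (real p))) (at (0 :: complex))" if "p \<in> B" for p
  proof -
    have p2: "p \<ge> 2" using B that prime_ge_2_nat by blast
    have "((\<lambda>w. (1 - of_nat p powr (- w)) / w) \<longlongrightarrow> of_real (ln (real p))) (at (0 :: complex))"
      using one_minus_powr_has_field_derivative[of p 0] p2 by (simp add: has_field_derivative_iff)
    then have "((\<lambda>w. inverse ((1 - of_nat p powr (- w)) / w)) \<longlongrightarrow> inverse (of_real (ln (real p)))) (at (0 :: complex))"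
      using p2 by (intro tendsto_inverse) auto
    then show ?thesis by (simp add: divide_inverse mult.commute)
  qed
  have g0: "g_kernel \<midarrow>0\<rightarrow> g_kernel 0"
    using g_kernel_analytic[of 0] by (auto dest!: analytic_at_imp_isCont simp: isCont_def)
  have "((\<lambda>w. w * ((\<Prod>p\<in>B. w / (1 - of_nat p powr (- w))) * (1 - w) ^ card B * g_kernel w / (w - s))) \<longlongrightarrow>
     0 * ((\<Prod>p\<in>B. 1 / of_real (ln (real p))) * (1 - 0) ^ card B * g_kernel 0 / (0 - s))) (at 0)"
    using s by (intro tendsto_intros lim g0) auto
  moreover have "(\<lambda>w. w * ((\<Prod>p\<in>B. w / (1 - of_nat p powr (- w))) * (1 - w) ^ card B * g_kernel w / (w - s))) =
      (\<lambda>w. xi_raw B w / (w - s) * (w - 0))"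
    by (rule ext) (simp add: xi_raw_def xi_kernel_def zeta_B_def prod_dividef)
  ultimately show "((\<lambda>w. xi_raw B w / (w - s) * (w - 0)) \<longlongrightarrow> 0) (at 0)" by simp
qed

section \<open>Moving the line of integration\<close>

lemma contour_integral_rectpath_split:
  assumes "a \<le> c" "b \<le> (d :: real)"
    and cont: "continuous_on (cbox (Complex a b) (Complex c d) - box (Complex a b) (Complex c d)) f"
  shows "contour_integral (rectpath (Complex a b) (Complex c d)) f =
    contour_integral (linepath (Complex a b) (Complex c b)) f + contour_integral (linepath (Complex c b) (Complex c d)) f
    - contour_integral (linepath (Complex a d) (Complex c d)) f - contour_integral (linepath (Complex a b) (Complex a d)) f"
proof -
  let ?D = "cbox (Complex a b) (Complex c d) - box (Complex a b) (Complex c d)"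
  have seg: "closed_segment (Complex a b) (Complex c b) \<subseteq> ?D" "closed_segment (Complex c b) (Complex c d) \<subseteq> ?D"
    "closed_segment (Complex c d) (Complex a d) \<subseteq> ?D" "closed_segment (Complex a d) (Complex a b) \<subseteq> ?D"
    using assms(1,2)
    by (auto simp: closed_segment_same_Re closed_segment_same_Im closed_segment_eq_real_ivl in_cbox_complex_iff
        in_box_complex_iff split: if_splits)
  have int: "f contour_integrable_on linepath (Complex a b) (Complex c b)"
    "f contour_integrable_on linepath (Complex c b) (Complex c d)"
    "f contour_integrable_on linepath (Complex c d) (Complex a d)"
    "f contour_integrable_on linepath (Complex a d) (Complex a b)"
    using seg cont by (auto intro!: contour_integrable_continuous_linepath intro: continuous_on_subset)
  have "contour_integral (rectpath (Complex a b) (Complex c d)) f =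
    contour_integral (linepath (Complex a b) (Complex c b)) f + (contour_integral (linepath (Complex c b) (Complex c d)) f
    + (contour_integral (linepath (Complex c d) (Complex a d)) f + contour_integral (linepath (Complex a d) (Complex a b)) f))"
    unfolding rectpath_def Let_def using int by (simp add: contour_integrable_joinI)
  moreover have "contour_integral (linepath (Complex c d) (Complex a d)) f = - contour_integral (linepath (Complex a d) (Complex c d)) f"
    by (rule contour_integral_reverse_linepath) (use seg(3) cont in \<open>auto simp: closed_segment_commute intro: continuous_on_subset\<close>)
  moreover have "contour_integral (linepath (Complex a d) (Complex a b)) f = - contour_integral (linepath (Complex a b) (Complex a d)) f"
    by (rule contour_integral_reverse_linepath) (use seg(4) cont in \<open>auto simp: closed_segment_commute intro: continuous_on_subset\<close>)
  ultimately show ?thesis by simp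
qed

section \<open>Integrals along vertical lines under exponential decay\<close>

lemma integrable_exp_neg_abs: "integrable lborel (\<lambda>t :: real. exp (- \<bar>t\<bar> / 16))"
proof -
  obtain C where C: "C > 0" "\<And>t. t \<ge> 0 \<Longrightarrow> (1 + t :: real) ^ 2 \<le> C * exp (t / 16)"
    using poly_le_exp[of 2] by blast
  have "set_integrable lborel UNIV (\<lambda>x :: real. inverse (1 + x^2))"
    using integrable_inverse_1_plus_square by simp
  then have "integrable lborel (\<lambda>x :: real. C * inverse (1 + x^2))"
    by (intro integrable_mult_right) (simp add: set_integrable_def)
  then show ?thesis
  proof (rule Bochner_Integration.integrable_bound)
    show "AE t in lborel. norm (exp (- \<bar>t\<bar> / 16) :: real) \<le> norm (C * inverse (1 + t^2))"
    proof (intro AE_I2)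
      fix t :: real
      have "1 + t\<^sup>2 \<le> (1 + \<bar>t\<bar>) ^ 2" by (simp add: power2_sum)
      also have "\<dots> \<le> C * exp (\<bar>t\<bar> / 16)" by (rule C(2)) simp
      finally have "(1 + t\<^sup>2) * exp (- \<bar>t\<bar> / 16) \<le> C * exp (\<bar>t\<bar> / 16) * exp (- \<bar>t\<bar> / 16)"
        by (rule mult_right_mono) simp
      also have "\<dots> = C" by (simp add: mult.assoc flip: exp_add)
      finally have "exp (- \<bar>t\<bar> / 16) * (1 + t\<^sup>2) \<le> C" by (simp only: mult.commute)
      moreover have "0 < 1 + t\<^sup>2" by (simp add: add_pos_nonneg)
      ultimately have le: "exp (- \<bar>t\<bar> / 16) \<le> C / (1 + t\<^sup>2)" by (simp only: pos_le_divide_eq)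
      note le
      also have "C / (1 + t\<^sup>2) = C * inverse (1 + t\<^sup>2)" by (rule divide_inverse)
      also have "\<dots> \<le> norm (C * inverse (1 + t\<^sup>2))" by (simp only: real_norm_def abs_ge_self)
      finally show "norm (exp (- \<bar>t\<bar> / 16)) \<le> norm (C * inverse (1 + t^2))" by (simp only: real_norm_def abs_exp_cancel)
    qed
    show "(\<lambda>t :: real. exp (- \<bar>t\<bar> / 16)) \<in> borel_measurable lborel" by measurable
  qed
qed

lemma line_integrable:
  fixes f :: "complex \<Rightarrow> complex"
  assumes cont: "continuous_on UNIV (\<lambda>t. f (Complex c t))"
    and bound: "\<And>t. norm (f (Complex c t)) \<le> C * exp (- \<bar>t\<bar> / 16)"
  shows "integrable lborel (\<lambda>t. f (Complex c t))"
proof (rule Bochner_Integration.integrable_bound)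
  show "integrable lborel (\<lambda>t. C * exp (- \<bar>t\<bar> / 16))"
    by (intro integrable_mult_right integrable_exp_neg_abs)
  show "(\<lambda>t. f (Complex c t)) \<in> borel_measurable lborel"
    using borel_measurable_continuous_onI[OF cont] by simp
  show "AE t in lborel. norm (f (Complex c t)) \<le> norm (C * exp (- \<bar>t\<bar> / 16))"
    using order.trans[OF bound abs_ge_self] by (intro AE_I2) simp
qed

lemma norm_vertical_line_integral_le:
  fixes f :: "complex \<Rightarrow> complex"
  assumes cont: "continuous_on UNIV (\<lambda>t. f (Complex c t))"
    and bound: "\<And>t. norm (f (Complex c t)) \<le> C * exp (- \<bar>t\<bar> / 16)"
  shows "norm (vertical_line_integral c f) \<le> C * (LINT t|lborel. exp (- \<bar>t\<bar> / 16))"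
proof -
  have "norm (vertical_line_integral c f) \<le> (LINT t|lborel. norm (f (Complex c t) * \<i>))"
    unfolding vertical_line_integral_def by (rule integral_norm_bound)
  also have "\<dots> \<le> (LINT t|lborel. C * exp (- \<bar>t\<bar> / 16))"
    using bound line_integrable[OF assms] by (intro integral_mono integrable_norm integrable_mult_right integrable_exp_neg_abs)
      (auto simp: norm_mult)
  finally show ?thesis by simp
qed

lemma contour_integral_tendsto_vertical_line_integral:
  fixes f :: "complex \<Rightarrow> complex" and T :: "nat \<Rightarrow> real"
  assumes cont: "continuous_on UNIV (\<lambda>t. f (Complex c t))"
    and bound: "\<And>t. norm (f (Complex c t)) \<le> C * exp (- \<bar>t\<bar> / 16)"
    and T: "filterlim T at_top sequentially"
  shows "(\<lambda>j. contour_integral (linepath (Complex c (- T j)) (Complex c (T j))) f) \<longlonglongrightarrow> vertical_line_integral c f"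
proof -
  let ?f = "\<lambda>t. f (Complex c t)"
  note int = line_integrable[OF cont bound]
  have "(\<lambda>j. LINT t|lborel. indicator {- T j..T j} t *\<^sub>R ?f t) \<longlonglongrightarrow> (LINT t|lborel. ?f t)"
  proof (rule integral_dominated_convergence)
    show "integrable lborel (\<lambda>t. norm (?f t))" using int by (rule integrable_norm)
    show "?f \<in> borel_measurable lborel" "\<And>j. (\<lambda>t. indicator {- T j..T j} t *\<^sub>R ?f t) \<in> borel_measurable lborel"
      using borel_measurable_integrable[OF int] by auto
    show "AE t in lborel. (\<lambda>j. indicator {- T j..T j} t *\<^sub>R ?f t) \<longlonglongrightarrow> ?f t"
    proof (intro AE_I2 tendsto_eventually)
      fix t :: real
      have "eventually (\<lambda>j. T j \<ge> \<bar>t\<bar>) sequentially" using T by (simp add: filterlim_at_top)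
      then show "eventually (\<lambda>j. indicator {- T j..T j} t *\<^sub>R ?f t = ?f t) sequentially"
        by eventually_elim (auto simp: indicator_def)
    qed
    show "\<And>j. AE t in lborel. norm (indicator {- T j..T j} t *\<^sub>R ?f t) \<le> norm (?f t)"
      by (intro AE_I2) (auto simp: indicator_def)
  qed
  then have "(\<lambda>j. (LINT t|lborel. indicator {- T j..T j} t *\<^sub>R ?f t) * \<i>) \<longlonglongrightarrow> (LINT t|lborel. ?f t) * \<i>"
    by (intro tendsto_intros)
  moreover have "(LINT t|lborel. ?f t) * \<i> = vertical_line_integral c f"
    unfolding vertical_line_integral_def by simp
  moreover have "eventually (\<lambda>j. contour_integral (linepath (Complex c (- T j)) (Complex c (T j))) f =
      (LINT t|lborel. indicator {- T j..T j} t *\<^sub>R ?f t) * \<i>) sequentially"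
  proof -
    have "eventually (\<lambda>j. T j > 0) sequentially" using T by (simp add: filterlim_at_top_dense)
    then show ?thesis
    proof eventually_elim
      case (elim j)
      have "set_integrable lborel {- T j..T j} ?f"
        unfolding set_integrable_def using int by (intro integrable_mult_indicator) auto
      from set_borel_integral_eq_integral(2)[OF this]
      show ?case
        using elim by (subst contour_integral_linepath_same_Re[where c = c and a = "- T j" and b = "T j"])
          (auto simp: set_lebesgue_integral_def)
    qed
  qed
  ultimately show ?thesis by (simp add: tendsto_cong)
qed


section \<open>The residue theorem on rectangles\<close>

lemma odd_neq_even: "- (2 * real N + 1) \<noteq> - 2 * real n"
proof
  assume "- (2 * real N + 1) = - 2 * real n"
  then have "real (2 * N + 1) = real (2 * n)" by simp
  then have "2 * N + 1 = 2 * n" by (simp only: of_nat_eq_iff)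
  then show False by presburger
qed

text \<open>The odd abscissa of the left side and the hypothesis on \<open>T\<close> keep
  singularities off the boundary. The residue theorem is applied in the rectangle enlarged by 1 on
  every side, where there are finitely many singularities; those outside the original rectangle have
  winding number 0.\<close>

lemma xi_raw_rectangle:
  fixes c T :: real and N :: nat
  assumes B: "finite B" "\<And>p. p \<in> B \<Longrightarrow> prime p" "B \<noteq> {}"
    and s: "s \<notin> imag_poles B" "s \<notin> even_poles" "- (2 * real N + 1) < Re s" "Re s < c" "\<bar>Im s\<bar> < T"
    and c: "c > 0" and T: "\<And>p n. p \<in> B \<Longrightarrow> \<bar>imag_height p n\<bar> \<noteq> T"
  defines "a \<equiv> Complex (- (2 * real N + 1)) (- T)" and "b \<equiv> Complex c T"
  shows "continuous_on (cbox a b - box a b) (\<lambda>w. xi_raw B w / (w - s))"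
    and "contour_integral (rectpath a b) (\<lambda>w. xi_raw B w / (w - s)) =
      2 * of_real pi * \<i> * (xi_raw B s
        - (\<Sum>p\<in>B. \<Sum>n | \<bar>imag_height p n\<bar> < T. imag_res B p n / (s - imag_pole p n))
        - (\<Sum>n=1..N. even_res B n / (s - (- 2 * of_nat n))))"
proof -
  let ?P = "(\<Sum>p\<in>B. \<Sum>n | \<bar>imag_height p n\<bar> < T. imag_res B p n / (s - imag_pole p n))" and ?Q = "(\<Sum>n=1..N. even_res B n / (s - (- 2 * of_nat n)))"
  define x where "x = - (2 * real N + 1)"
  define \<Phi> where "\<Phi> = (\<lambda>w. xi_raw B w / (w - s))"
  define S where "S = box (Complex (x - 1) (- T - 1)) (Complex (c + 1) (T + 1))"
  define sing where "sing = imag_poles B \<union> even_poles"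
  define pts where "pts = insert s (sing \<inter> S)"
  have x: "x < 0" by (simp add: x_def)
  have T0: "T > 0" using s by linarith
  have p2: "p \<ge> 2" if "p \<in> B" for p using B that prime_ge_2_nat by blast
  have in_box: "z \<in> box a b \<longleftrightarrow> x < Re z \<and> Re z < c \<and> - T < Im z \<and> Im z < T"
    and in_cbox: "z \<in> cbox a b \<longleftrightarrow> x \<le> Re z \<and> Re z \<le> c \<and> - T \<le> Im z \<and> Im z \<le> T" for z
    by (auto simp: in_box_complex_iff in_cbox_complex_iff a_def b_def x_def)
  have in_S: "z \<in> S \<longleftrightarrow> x - 1 < Re z \<and> Re z < c + 1 \<and> - T - 1 < Im z \<and> Im z < T + 1" for z
    by (auto simp: in_box_complex_iff S_def)
  have sbox: "s \<in> box a b" using s by (auto simp: in_box x_def)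
  have bd: "z \<notin> cbox a b - box a b" if z: "z \<in> sing" for z
  proof -
    consider p n where "p \<in> B" "z = imag_pole p n" | n where "n \<ge> 1" "z = - 2 * of_nat n"
      using z unfolding sing_def imag_poles_def even_poles_def by blast
    then show ?thesis
    proof cases
      case 1
      then have "\<bar>Im z\<bar> \<noteq> T" using T[of p n] by (simp add: imag_pole_eq_Complex)
      then show ?thesis using 1 x c by (auto simp: in_box in_cbox)
    next
      case 2
      then show ?thesis using odd_neq_even[of N n] c T0 by (auto simp: in_box in_cbox x_def)
    qed
  qed
  have holo: "\<Phi> holomorphic_on A" if "A \<inter> insert s sing = {}" for A
  proof -
    have "\<Phi> analytic_on {z}" if "z \<in> A" for z
      unfolding \<Phi>_def using B \<open>z \<in> A\<close> \<open>A \<inter> insert s sing = {}\<close>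
      by (intro analytic_intros xi_raw_analytic) (auto simp: sing_def)
    then show ?thesis by (intro analytic_imp_holomorphic) (auto simp: analytic_on_analytic_at[of _ A])
  qed
  show cont: "continuous_on (cbox a b - box a b) (\<lambda>w. xi_raw B w / (w - s))"
    using holo[of "cbox a b - box a b"] bd sbox unfolding \<Phi>_def by (intro holomorphic_on_imp_continuous_on) blast
  have "finite (sing \<inter> S)"
  proof -
    obtain R where "\<And>z. z \<in> S \<Longrightarrow> norm z \<le> R"
      using bounded_box[of "Complex (x - 1) (- T - 1)" "Complex (c + 1) (T + 1)"] by (auto simp: S_def bounded_iff)
    then have "sing \<inter> S \<subseteq> {z \<in> imag_poles B \<union> even_poles. norm z \<le> R}" by (auto simp: sing_def)
    moreover have "finite {z \<in> imag_poles B \<union> even_poles. norm z \<le> R}" by (rule finite_bounded_poles[OF B(1,2)])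
    ultimately show ?thesis by (rule finite_subset)
  qed
  then have fin: "finite pts" by (simp add: pts_def)
  have wind: "winding_number (rectpath a b) z = (if z \<in> box a b then 1 else 0)" if "z \<in> pts" for z
  proof (cases "z \<in> box a b")
    case True
    then show ?thesis by (simp add: winding_number_rectpath)
  next
    case False
    then have "z \<notin> cbox a b" using that bd sbox by (auto simp: pts_def)
    then show ?thesis
      using False c T0 winding_number_rectpath_outside[of a b z] by (simp add: a_def b_def)
  qed
  have "contour_integral (rectpath a b) \<Phi> = 2 * pi * \<i> * (\<Sum>z\<in>pts. winding_number (rectpath a b) z * residue \<Phi> z)"
  proof (rule Residue_theorem)
    show "open S" "connected S" by (auto simp: S_def intro: convex_connected)
    show "\<Phi> holomorphic_on S - pts" by (rule holo) (auto simp: pts_def)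
    have "path_image (rectpath a b) = cbox a b - box a b"
      using c T0 by (intro path_image_rectpath_cbox_minus_box) (auto simp: a_def b_def)
    then show "path_image (rectpath a b) \<subseteq> S - pts"
      using bd sbox by (auto simp: pts_def in_S in_cbox)
    show "\<forall>z. z \<notin> S \<longrightarrow> winding_number (rectpath a b) z = 0"
    proof (intro allI impI)
      fix z assume "z \<notin> S"
      then have "z \<notin> cbox a b" by (auto simp: in_S in_cbox)
      then show "winding_number (rectpath a b) z = 0"
        using c T0 by (intro winding_number_rectpath_outside) (auto simp: a_def b_def)
    qed
  qed (use fin in auto)
  also have "(\<Sum>z\<in>pts. winding_number (rectpath a b) z * residue \<Phi> z) = (\<Sum>z\<in>pts \<inter> box a b. residue \<Phi> z)"
  proof -
    have "(\<Sum>z\<in>pts. winding_number (rectpath a b) z * residue \<Phi> z) = (\<Sum>z\<in>pts. if z \<in> box a b then residue \<Phi> z else 0)"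
      by (intro sum.cong) (auto simp: wind)
    also have "\<dots> = (\<Sum>z\<in>pts \<inter> box a b. residue \<Phi> z)" using fin by (simp add: sum.inter_restrict)
    finally show ?thesis .
  qed
  also have "\<dots> = xi_raw B s
        - ?P
        - ?Q"
  proof -
    \<comment> \<open>All primes share the point 0. Without the index 0 the pairs (p, n) correspond
      one to one to points, and 0 is listed separately.\<close>
    define I where "I p = {n :: int. n \<noteq> 0 \<and> \<bar>imag_height p n\<bar> < T}" for p :: nat
    define P1 where "P1 = (\<lambda>(p, n). imag_pole p n) ` Sigma B I"
    define P2 where "P2 = (\<lambda>n. - 2 * of_nat n :: complex) ` {1..N}"
    have finI: "finite (I p)" "finite {n. \<bar>imag_height p n\<bar> < T}" if "p \<in> B" for p
      by (rule finite_subset[OF _ finite_bounded_imag_poles[OF p2[OF that], of T]]; force simp: I_def)+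
    have inj1: "inj_on (\<lambda>(p, n). imag_pole p n) (Sigma B I)"
    proof (rule inj_onI, clarify)
      fix p n q k assume "p \<in> B" "n \<in> I p" "q \<in> B" "k \<in> I q" and eq: "imag_pole p n = imag_pole q k"
      moreover from this have "p = q" using imag_pole_neq[of p q n k] B by (auto simp: I_def)
      ultimately show "p = q \<and> n = k" using imag_pole_inject p2 by auto
    qed
    have inj2: "inj_on (\<lambda>n. - 2 * of_nat n :: complex) {1..N}" by (auto simp: inj_on_def)
    have zero: "imag_pole p 0 = 0" for p by (simp add: imag_pole_def)
    have zero': "imag_pole p n = 0 \<longleftrightarrow> n = 0" if "p \<in> B" for p n
      using imag_pole_inject[OF p2[OF that], of n 0] zero by simp
    obtain p0 where p0: "p0 \<in> B" using B by blast
    have z0: "0 \<in> imag_poles B"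
      unfolding imag_poles_def using p0 zero[of p0] by (intro CollectI exI[of _ p0] exI[of _ 0]) simp
    have s0: "s \<noteq> 0" using s(1) z0 by blast
    have "pts \<inter> box a b = insert s (insert 0 (P1 \<union> P2))"
    proof (intro equalityI subsetI)
      fix z assume z: "z \<in> pts \<inter> box a b"
      then consider "z = s" | p n where "p \<in> B" "z = imag_pole p n" | n where "n \<ge> 1" "z = - 2 * of_nat n"
        unfolding pts_def sing_def imag_poles_def even_poles_def by blast
      then show "z \<in> insert s (insert 0 (P1 \<union> P2))"
      proof cases
        case (2 p n)
        have "\<bar>imag_height p n\<bar> < T"
        proof -
          have "imag_height p n = Im z" using 2 by (simp add: imag_pole_eq_Complex)
          then show ?thesis using z unfolding in_box Int_iff by linarith
        qed
        then have "z = 0 \<or> (p, n) \<in> Sigma B I" using 2 zero[of p] by (auto simp: I_def)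
        moreover have "z = (\<lambda>(p, n). imag_pole p n) (p, n)" using 2 by simp
        ultimately show ?thesis unfolding P1_def by blast
      next
        case (3 n)
        then have "n \<le> N" using z by (simp add: in_box x_def)
        then show ?thesis using 3 by (auto simp: P2_def)
      qed simp
    next
      fix z assume "z \<in> insert s (insert 0 (P1 \<union> P2))"
      then consider "z = s" | "z = 0" | p n where "p \<in> B" "z = imag_pole p n" "n \<in> I p" | n where "n \<ge> 1" "n \<le> N" "z = - 2 * of_nat n"
        unfolding P1_def P2_def by auto
      then show "z \<in> pts \<inter> box a b"
      proof cases
        case 1
        then show ?thesis using sbox by (simp add: pts_def)
      next
        case 2
        then show ?thesis using z0 x c T0 by (auto simp: pts_def sing_def in_box in_S)
      next
        case 3
        then have "imag_height p n = Im z" "\<bar>imag_height p n\<bar> < T"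
          by (auto simp: imag_pole_eq_Complex I_def)
        then have "- T < Im z" "Im z < T" by linarith+
        moreover have "z \<in> imag_poles B" using 3 by (auto simp: imag_poles_def)
        ultimately show ?thesis using 3 x c T0 by (auto simp: pts_def sing_def in_box in_S)
      next
        case 4
        moreover have "z \<in> even_poles" using 4 by (auto simp: even_poles_def)
        ultimately show ?thesis using c T0 by (auto simp: pts_def sing_def in_box in_S x_def)
      qed
    qed
    moreover have "s \<notin> insert 0 (P1 \<union> P2)"
      using s(1,2) s0 by (auto simp: P1_def P2_def imag_poles_def even_poles_def)
    moreover have "0 \<notin> P1 \<union> P2"
    proof
      assume "0 \<in> P1 \<union> P2"
      then consider p n where "p \<in> B" "n \<in> I p" "imag_pole p n = 0" | n :: nat where "n \<ge> 1" "- 2 * of_nat n = (0 :: complex)"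
        unfolding P1_def P2_def by auto
      then show False using zero' by cases (auto simp: I_def)
    qed
    moreover have "P1 \<inter> P2 = {}"
    proof -
      have "Re z = 0" if "z \<in> P1" for z using that by (auto simp: P1_def)
      moreover have "Re z \<noteq> 0" if "z \<in> P2" for z using that by (auto simp: P2_def)
      ultimately show ?thesis by blast
    qed
    moreover have "finite P1" "finite P2" using B finI by (auto simp: P1_def P2_def)
    ultimately have "(\<Sum>z\<in>pts \<inter> box a b. residue \<Phi> z) = residue \<Phi> s + (residue \<Phi> 0 + (sum (residue \<Phi>) P1 + sum (residue \<Phi>) P2))"
      by (simp add: sum.union_disjoint)
    moreover have "residue \<Phi> s = xi_raw B s"
      unfolding \<Phi>_def using B s by (intro residue_at_regular_point) auto
    moreover have "residue \<Phi> 0 = 0"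
      unfolding \<Phi>_def
    proof (rule residue_at_0)
      show "open (S - (pts - {0}))" unfolding S_def using fin by (intro open_Diff finite_imp_closed) auto
      show "0 \<in> S - (pts - {0})" using x c T0 by (auto simp: in_S)
      show "(\<lambda>w. xi_raw B w / (w - s)) holomorphic_on S - (pts - {0}) - {0}"
        using holo[of "S - (pts - {0}) - {0}"] z0 s0 unfolding \<Phi>_def by (auto simp: pts_def)
    qed (use B s0 in auto)
    moreover have "sum (residue \<Phi>) P1 = - ?P"
    proof -
      have "sum (residue \<Phi>) P1 = (\<Sum>(p, n)\<in>Sigma B I. residue \<Phi> (imag_pole p n))"
        unfolding P1_def by (subst sum.reindex[OF inj1]) (simp add: o_def case_prod_unfold)
      also have "\<dots> = (\<Sum>p\<in>B. \<Sum>n\<in>I p. residue \<Phi> (imag_pole p n))"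
        using B finI by (simp add: sum.Sigma)
      also have "\<dots> = (\<Sum>p\<in>B. \<Sum>n\<in>I p. - (imag_res B p n / (s - imag_pole p n)))"
      proof (intro sum.cong refl)
        fix p n assume "p \<in> B" "n \<in> I p"
        then show "residue \<Phi> (imag_pole p n) = - (imag_res B p n / (s - imag_pole p n))"
          unfolding \<Phi>_def using residue_at_imag_pole[of B p n s] B s(1) by (auto simp: I_def imag_poles_def)
      qed
      \<comment> \<open>The index 0 can be put back because
        \<open>imag_res B p 0 = 0\<close>.\<close>
      also have "\<dots> = (\<Sum>p\<in>B. \<Sum>n | \<bar>imag_height p n\<bar> < T. - (imag_res B p n / (s - imag_pole p n)))"
      proof (rule sum.cong[OF refl])
        fix p assume p: "p \<in> B"
        show "(\<Sum>n\<in>I p. - (imag_res B p n / (s - imag_pole p n))) =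
            (\<Sum>n | \<bar>imag_height p n\<bar> < T. - (imag_res B p n / (s - imag_pole p n)))"
          by (rule sum.mono_neutral_left[OF finI(2)[OF p]]) (auto simp: I_def imag_res_def)
      qed
      finally show ?thesis by (simp add: sum_negf)
    qed
    moreover have "sum (residue \<Phi>) P2 = - ?Q"
    proof -
      have "sum (residue \<Phi>) P2 = (\<Sum>n=1..N. residue \<Phi> (- 2 * of_nat n))"
        unfolding P2_def by (subst sum.reindex[OF inj2]) (simp add: o_def)
      also have "\<dots> = (\<Sum>n=1..N. - (even_res B n / (s - (- 2 * of_nat n))))"
      proof (intro sum.cong refl)
        fix n assume n: "n \<in> {1..N}"
        then have "s \<noteq> - 2 * of_nat n" using s(2) by (auto simp: even_poles_def)
        then show "residue \<Phi> (- 2 * of_nat n) = - (even_res B n / (s - (- 2 * of_nat n)))"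
          unfolding \<Phi>_def using residue_at_even_pole[of B n s] B n by simp
      qed
      finally show ?thesis by (simp only: sum_negf)
    qed
    ultimately show ?thesis by simp
  qed
  finally show "contour_integral (rectpath a b) (\<lambda>w. xi_raw B w / (w - s)) =
      2 * of_real pi * \<i> * (xi_raw B s
        - ?P
        - ?Q)"
    by (simp only: \<Phi>_def of_real_mult of_real_numeral)
qed


text \<open>An unordered sum is a limit over all finite index sets, so it may be computed along the
  exhaustion dictated by the heights of the contours.\<close>

lemma symmetric_sums_tendsto_infsum:
  fixes f :: "int \<Rightarrow> complex" and T :: "nat \<Rightarrow> real"
  assumes f: "f summable_on UNIV" and p: "p \<ge> 2" and T: "filterlim T at_top sequentially"
  shows "(\<lambda>j. \<Sum>n | \<bar>imag_height p n\<bar> < T j. f n) \<longlonglongrightarrow> (\<Sum>\<^sub>\<infinity>n. f n)"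
proof -
  define S where "S j = {n :: int. \<bar>imag_height p n\<bar> < T j}" for j
  have finS: "finite (S j)" for j
    by (rule finite_subset[OF _ finite_bounded_imag_poles[OF p, of "T j"]]) (force simp: S_def)
  have "filterlim S (finite_subsets_at_top UNIV) sequentially"
  proof (subst filterlim_finite_subsets_at_top, intro allI impI)
    fix X :: "int set" assume X: "finite X \<and> X \<subseteq> UNIV"
    define M where "M = Max (insert 0 ((\<lambda>n. \<bar>imag_height p n\<bar>) ` X))"
    have M: "\<bar>imag_height p n\<bar> \<le> M" if "n \<in> X" for n
      unfolding M_def using X that by (intro Max_ge) auto
    have "eventually (\<lambda>j. T j > M) sequentially" using T by (simp add: filterlim_at_top_dense)
    then show "eventually (\<lambda>j. finite (S j) \<and> X \<subseteq> S j \<and> S j \<subseteq> UNIV) sequentially"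
    proof eventually_elim
      case (elim j)
      then have "X \<subseteq> S j" unfolding S_def using M le_less_trans by blast
      then show ?case using finS by simp
    qed
  qed
  moreover have "(sum f \<longlongrightarrow> (\<Sum>\<^sub>\<infinity>n. f n)) (finite_subsets_at_top UNIV)"
    using has_sum_infsum[OF f] by (simp add: has_sum_def)
  ultimately have "((\<lambda>j. sum f (S j)) \<longlongrightarrow> (\<Sum>\<^sub>\<infinity>n. f n)) sequentially"
    by (rule filterlim_compose[rotated])
  then show ?thesis by (simp add: S_def)
qed

lemma initial_sums_tendsto_infsum:
  fixes f :: "nat \<Rightarrow> complex"
  assumes f: "f summable_on {1..}"
  shows "(\<lambda>N. \<Sum>n=1..N. f n) \<longlonglongrightarrow> (\<Sum>\<^sub>\<infinity>n\<in>{1..}. f n)"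
proof -
  have "filterlim (\<lambda>N. {1..N}) (finite_subsets_at_top {1..}) sequentially"
  proof (subst filterlim_finite_subsets_at_top, intro allI impI)
    fix X :: "nat set" assume X: "finite X \<and> X \<subseteq> {1..}"
    have "eventually (\<lambda>N. N \<ge> Max (insert 0 X)) sequentially" by (rule eventually_ge_at_top)
    then show "eventually (\<lambda>N. finite {1..N} \<and> X \<subseteq> {1..N} \<and> {1..N} \<subseteq> {1..}) sequentially"
      by eventually_elim (use X in auto)
  qed
  moreover have "(sum f \<longlongrightarrow> (\<Sum>\<^sub>\<infinity>n\<in>{1..}. f n)) (finite_subsets_at_top {1..})"
    using has_sum_infsum[OF f] by (simp add: has_sum_def)
  ultimately show ?thesis by (rule filterlim_compose[rotated])
qed

lemma continuous_on_vertical_line: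
  assumes "\<And>t. f analytic_on {Complex c t}"
  shows "continuous_on UNIV (\<lambda>t. f (Complex c t))"
proof -
  have "continuous_on (range (Complex c)) f"
    using assms by (intro continuous_at_imp_continuous_on) (auto dest!: analytic_at_imp_isCont)
  moreover have "continuous_on UNIV (Complex c)" unfolding Complex_eq by (intro continuous_intros)
  ultimately show ?thesis by (intro continuous_on_compose2[of _ f UNIV "Complex c"]) auto
qed

lemma xi_raw_vertical_line_analytic:
  assumes "\<And>p. p \<in> B \<Longrightarrow> prime p" "c \<noteq> 0" "\<And>n. n \<ge> 1 \<Longrightarrow> c \<noteq> - 2 * real n" "c \<noteq> Re s"
  shows "(\<lambda>w. xi_raw B w / (w - s)) analytic_on {Complex c t}"
proof (intro analytic_intros xi_raw_analytic not_in_poles_of_Re_neq_0 assms(1))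
  show "Complex c t \<notin> even_poles"
  proof
    assume "Complex c t \<in> even_poles"
    then obtain n where "n \<ge> 1" "Complex c t = - 2 * of_nat n" by (auto simp: even_poles_def)
    then have "c = - 2 * real n" by (simp add: complex_eq_iff)
    then show False using assms(3)[OF \<open>n \<ge> 1\<close>] by simp
  qed
  show "z - s \<noteq> 0" if "z \<in> {Complex c t}" for z using assms(4) that by auto
qed (use assms(2) in auto)

lemma norm_div_diff_le:
  fixes x w s :: complex
  assumes "norm x \<le> C" "d \<le> norm (w - s)" "d > 0" 
  shows "norm (x / (w - s)) \<le> C / d"
  using frac_le[OF order.trans[OF norm_ge_zero assms(1)] assms(1,3,2)] by (simp add: norm_divide)

lemma norm_xi_raw_div_le:
  assumes "norm (xi_kernel (card B) w) \<le> K" "norm (zeta_B B w) \<le> Z" "d \<le> \<bar>Re w - Re s\<bar>" "d > 0"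
  shows "norm (xi_raw B w / (w - s)) \<le> K * Z / d"
proof (rule norm_div_diff_le)
  show "norm (xi_raw B w) \<le> K * Z"
    unfolding xi_raw_def norm_mult
    by (rule mult_mono[OF assms(1,2) order.trans[OF norm_ge_zero assms(1)]]) simp
  show "d \<le> norm (w - s)" using abs_Re_le_cmod[of "w - s"] assms(3) by simp
qed (rule assms(4))

text \<open>Only the heights tend to infinity here. The vertical sides converge by dominated
  convergence, and the horizontal sides vanish because the Euler product grows there more slowly
  than the kernel decays.\<close>

lemma vertical_line_integral_shift:
  fixes c :: real and N :: nat
  assumes B: "finite B" "\<And>p. p \<in> B \<Longrightarrow> prime p" "B \<noteq> {}"
    and s: "s \<notin> imag_poles B" "s \<notin> even_poles" "- (2 * real N + 1) < Re s" "Re s < c" and c: "c \<ge> 1"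
  shows "vertical_line_integral c (\<lambda>w. xi_raw B w / (w - s)) -
      vertical_line_integral (- (2 * real N + 1)) (\<lambda>w. xi_raw B w / (w - s)) =
    2 * of_real pi * \<i> * (xi_raw B s - (\<Sum>p\<in>B. \<Sum>\<^sub>\<infinity>n. imag_res B p n / (s - imag_pole p n))
      - (\<Sum>n=1..N. even_res B n / (s - (- 2 * of_nat n))))"
proof -
  define x where "x = - (2 * real N + 1)"
  define \<Phi> where "\<Phi> = (\<lambda>w. xi_raw B w / (w - s))"
  obtain p0 where p0: "p0 \<in> B" using B by blast
  have p2: "p \<ge> 2" if "p \<in> B" for p using B that prime_ge_2_nat by blast
  define w where "w = ln (real p0)"
  have w: "w > 0" using p2[OF p0] by (simp add: w_def)
  \<comment> \<open>At the heights \<open>T j\<close>, halfway between two poles belonging to \<open>p0\<close>, the bound on linear forms in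
      logarithms keeps the other Euler factors away from zero as well.\<close>
  define T where "T j = pi * real (2 * j + 1) / w" for j :: nat
  have Tlim: "filterlim T at_top sequentially" unfolding T_def using w by real_asymp
  have x0: "x < 0" by (simp add: x_def)
  have x_even: "x \<noteq> - 2 * real n" for n unfolding x_def by (rule odd_neq_even)
  have pole: "\<bar>imag_height p n\<bar> \<noteq> T j" if p: "p \<in> B" for p n j
  proof
    assume eq: "\<bar>imag_height p n\<bar> = T j"
    define h where "h = imag_height p n"
    \<comment> \<open>The height is \<open>pi k / ln p0\<close> with \<open>k\<close> odd. A pole of
      the factor of \<open>p\<close> there would be a zero of \<open>1 - p^(-s)\<close> at a place
      where a positive lower bound is known.\<close>
    define k where "k = (if h \<ge> 0 then int (2 * j + 1) else - int (2 * j + 1))"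
    have k: "odd k" "k \<noteq> 0" by (auto simp: k_def)
    have "pi * of_int k / ln (real p0) = (if h \<ge> 0 then T j else - T j)"
      by (cases "h \<ge> 0") (simp_all only: k_def T_def w_def if_True if_False of_int_minus of_int_of_nat_eq
          mult_minus_right minus_divide_left)
    also have "\<dots> = h" using eq unfolding h_def[symmetric] by (simp add: abs_if split: if_splits)
    finally have "imag_height p n = pi * of_int k / ln (real p0)" by (simp only: h_def)
    then have "imag_pole p n = Complex 0 (pi * of_int k / ln (real p0))" by (simp add: imag_pole_eq_Complex)
    then have E0: "1 - of_nat p powr (- Complex 0 (pi * of_int k / ln (real p0))) = 0"
      using one_minus_powr_eq_0_iff[OF p2[OF p]] by metis
    obtain C where "C > 0" and "\<And>n :: int. \<And>\<sigma>. (if p0 = p then odd n else n \<noteq> 0) \<Longrightarrow>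
        C * exp (- 1 * \<bar>real_of_int n\<bar>) \<le> norm (1 - of_nat p powr (- Complex \<sigma> (pi * of_int n / ln (real p0))))"
      using norm_one_minus_prime_powr_ge[of p0 p 1] B p p0 by auto
    moreover have "if p0 = p then odd k else k \<noteq> 0" using k by simp
    ultimately have "C * exp (- 1 * \<bar>real_of_int k\<bar>) \<le> norm (0 :: complex)" using E0 by metis
    then show False using \<open>C > 0\<close> by (simp add: mult_le_0_iff)
  qed
  have ana: "\<Phi> analytic_on {Complex c t}" "\<Phi> analytic_on {Complex x t}" for t
    unfolding \<Phi>_def using B s c x0 x_even by (intro xi_raw_vertical_line_analytic; force simp: x_def)+
  obtain C1 where C1: "C1 > 0" "\<And>z. x \<le> Re z \<Longrightarrow> Re z \<le> c \<Longrightarrow> - 2 < x \<or> 2 \<le> \<bar>Im z\<bar> \<Longrightarrow>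
      norm (xi_kernel (card B) z) \<le> C1 * exp (- \<bar>Im z\<bar> / 16)"
    using xi_kernel_exp_decay[of x c "card B"] by blast
  obtain C2 where C2: "C2 > 0" "\<And>z. c \<le> Re z \<Longrightarrow> Re z \<le> c \<Longrightarrow> norm (xi_kernel (card B) z) \<le> C2 * exp (- \<bar>Im z\<bar> / 16)"
    using xi_kernel_exp_decay[of c c "card B"] c by auto
  obtain e where e: "\<And>t. norm (xi_kernel (card B) (Complex x t)) \<le> e * exp (- \<bar>t\<bar> / 16)"
    using xi_kernel_left_decay[of "card B"] unfolding x_def by blast
  have right: "norm (\<Phi> (Complex c t)) \<le> C2 * 2 ^ card B / (c - Re s) * exp (- \<bar>t\<bar> / 16)" for t
    using norm_xi_raw_div_le[of B "Complex c t" "C2 * exp (- \<bar>t\<bar> / 16)" "2 ^ card B" "c - Re s" s]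
      C2(2)[of "Complex c t"] norm_zeta_B_le_right[of B "Complex c t"] p2 c s by (simp add: \<Phi>_def mult_ac)
  have left: "norm (\<Phi> (Complex x t)) \<le> e / (Re s - x) * exp (- \<bar>t\<bar> / 16)" for t
    using norm_xi_raw_div_le[of B "Complex x t" "e * exp (- \<bar>t\<bar> / 16)" 1 "Re s - x" s]
      e[of t] norm_zeta_B_le_left[of B "Complex x t"] p2 s(3) by (simp add: \<Phi>_def x_def)
  \<comment> \<open>Chosen such that \<open>T j / 16 = 2 \<epsilon> (2 j + 1)\<close>: one half of
    the decay pays for the Euler product, the other half survives.\<close>
  define \<epsilon> where "\<epsilon> = pi / (32 * w)"
  have \<epsilon>: "\<epsilon> > 0" using w by (simp add: \<epsilon>_def)
  obtain C3 where C3: "C3 > 0" "\<And>n :: int. \<And>\<sigma>. odd n \<Longrightarrow>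
     norm (zeta_B B (Complex \<sigma> (pi * of_int n / w))) \<le> C3 * exp (\<epsilon> * \<bar>real_of_int n\<bar>)"
    using norm_zeta_B_le_exp[of B p0 \<epsilon>] B p0 \<epsilon> unfolding w_def by auto
  have horizontal: "(\<lambda>j. contour_integral (linepath (Complex x (\<delta> * T j)) (Complex c (\<delta> * T j))) \<Phi>) \<longlonglongrightarrow> 0"
    if \<delta>: "\<delta> = 1 \<or> \<delta> = -1" for \<delta> :: real
  proof (rule tendsto_0_le[where K = 1])
    have "(\<lambda>j. C1 * C3 * exp (- \<epsilon> * real (2 * j + 1)) * (c - x)) \<longlonglongrightarrow> C1 * C3 * 0 * (c - x)"
      by (intro tendsto_intros) (use \<epsilon> in real_asymp)
    then show "(\<lambda>j. C1 * C3 * exp (- \<epsilon> * real (2 * j + 1)) * (c - x)) \<longlonglongrightarrow> 0" by simp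
    \<comment> \<open>Height 2 reaches the region where the kernel is known to decay, and the excess
      over \<open>|Im s|\<close> gives \<open>|z - s| \<ge> 1\<close> on the segment.\<close>
    have "eventually (\<lambda>j. T j \<ge> 2 + \<bar>Im s\<bar>) sequentially" using Tlim by (simp add: filterlim_at_top)
    then show "eventually (\<lambda>j. norm (contour_integral (linepath (Complex x (\<delta> * T j)) (Complex c (\<delta> * T j))) \<Phi>) \<le>
        norm (C1 * C3 * exp (- \<epsilon> * real (2 * j + 1)) * (c - x)) * 1) sequentially"
    proof eventually_elim
      case (elim j)
      let ?l = "linepath (Complex x (\<delta> * T j)) (Complex c (\<delta> * T j))"
      have T0: "T j > 0" using elim by simp
      have bound: "norm (\<Phi> z) \<le> C1 * C3 * exp (- \<epsilon> * real (2 * j + 1))"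
        if "z \<in> closed_segment (Complex x (\<delta> * T j)) (Complex c (\<delta> * T j))" for z
      proof -
        have z: "Im z = \<delta> * T j" "x \<le> Re z" "Re z \<le> c"
          using that x0 c by (auto simp: closed_segment_same_Im closed_segment_eq_real_ivl split: if_splits)
        have absz: "\<bar>Im z\<bar> = T j" using z(1) \<delta> T0 by auto
        define k where "k = (if \<delta> = 1 then int (2 * j + 1) else - int (2 * j + 1))"
        have k: "odd k" "\<bar>real_of_int k\<bar> = real (2 * j + 1)" by (auto simp: k_def)
        have zk: "z = Complex (Re z) (pi * of_int k / w)"
        proof -
          have "real_of_int k = \<delta> * real (2 * j + 1)" using \<delta> by (auto simp: k_def)
          then have "pi * of_int k / w = \<delta> * T j" by (simp only: T_def times_divide_eq_right mult_ac)
          then show ?thesis using z(1) by (simp add: complex_eq_iff)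
        qed
        have "norm (zeta_B B z) \<le> C3 * exp (\<epsilon> * real (2 * j + 1))"
          using C3(2)[OF k(1), of "Re z"] zk k(2) by simp
        moreover have "norm (xi_kernel (card B) z) \<le> C1 * exp (- T j / 16)"
          using C1(2)[OF z(2,3)] unfolding absz using elim by fastforce
        ultimately have "norm (xi_raw B z) \<le> (C1 * exp (- T j / 16)) * (C3 * exp (\<epsilon> * real (2 * j + 1)))"
          unfolding xi_raw_def norm_mult using C1(1) by (intro mult_mono) auto
        also have "\<dots> = C1 * C3 * (exp (- T j / 16) * exp (\<epsilon> * real (2 * j + 1)))" by (simp only: mult_ac)
        also have "exp (- T j / 16) * exp (\<epsilon> * real (2 * j + 1)) = exp (- \<epsilon> * real (2 * j + 1))"
        proof -
          have "- T j / 16 = - \<epsilon> * real (2 * j + 1) - \<epsilon> * real (2 * j + 1)"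
            using w by (simp add: T_def \<epsilon>_def field_simps)
          then show ?thesis by (simp flip: exp_add)
        qed
        finally have "norm (xi_raw B z) \<le> C1 * C3 * exp (- \<epsilon> * real (2 * j + 1))" .
        moreover have "1 \<le> norm (z - s)" using abs_Im_le_cmod[of "z - s"] absz elim by simp
        ultimately have "norm (\<Phi> z) \<le> C1 * C3 * exp (- \<epsilon> * real (2 * j + 1)) / 1"
          unfolding \<Phi>_def by (intro norm_div_diff_le) auto
        then show ?thesis by simp
      qed
      have len: "norm (Complex c (\<delta> * T j) - Complex x (\<delta> * T j)) = c - x"
      proof -
        have "Complex c (\<delta> * T j) - Complex x (\<delta> * T j) = of_real (c - x)" by (simp add: complex_eq_iff)
        then show ?thesis using x0 c by (simp only: norm_of_real)
      qed
      have "norm (contour_integral ?l \<Phi>) \<le> C1 * C3 * exp (- \<epsilon> * real (2 * j + 1)) * (c - x)"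
      \<comment> \<open>Where integrability fails the contour integral is 0 by convention, which
        satisfies the bound as well.\<close>
      proof (cases "\<Phi> contour_integrable_on ?l")
        case True
        then show ?thesis using contour_integral_bound_linepath[OF True _ bound] C1(1) C3(1) len by simp
      next
        case False
        then show ?thesis using C1(1) C3(1) x0 c by (simp add: not_integrable_contour_integral)
      qed
      then show ?case by simp
    qed
  qed
  have R: "(\<lambda>j. contour_integral (linepath (Complex c (- T j)) (Complex c (T j))) \<Phi>) \<longlonglongrightarrow> vertical_line_integral c \<Phi>"
    by (rule contour_integral_tendsto_vertical_line_integral[OF continuous_on_vertical_line[OF ana(1)] right Tlim])
  have L: "(\<lambda>j. contour_integral (linepath (Complex x (- T j)) (Complex x (T j))) \<Phi>) \<longlonglongrightarrow> vertical_line_integral x \<Phi>"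
    by (rule contour_integral_tendsto_vertical_line_integral[OF continuous_on_vertical_line[OF ana(2)] left Tlim])
  let ?res = "\<lambda>j. 2 * of_real pi * \<i> * (xi_raw B s
        - (\<Sum>p\<in>B. \<Sum>n | \<bar>imag_height p n\<bar> < T j. imag_res B p n / (s - imag_pole p n))
        - (\<Sum>n=1..N. even_res B n / (s - (- 2 * of_nat n))))"
  let ?int = "\<lambda>j. contour_integral (linepath (Complex x (-1 * T j)) (Complex c (-1 * T j))) \<Phi> +
      contour_integral (linepath (Complex c (- T j)) (Complex c (T j))) \<Phi> -
      contour_integral (linepath (Complex x (1 * T j)) (Complex c (1 * T j))) \<Phi> -
      contour_integral (linepath (Complex x (- T j)) (Complex x (T j))) \<Phi>"
  have l1: "?int \<longlonglongrightarrow>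
      0 + vertical_line_integral c \<Phi> - 0 - vertical_line_integral x \<Phi>"
    by (intro tendsto_intros R L horizontal) auto
  have l2: "?res \<longlonglongrightarrow>
      2 * of_real pi * \<i> * (xi_raw B s - (\<Sum>p\<in>B. \<Sum>\<^sub>\<infinity>n. imag_res B p n / (s - imag_pole p n))
      - (\<Sum>n=1..N. even_res B n / (s - (- 2 * of_nat n))))"
    using B s(1) p2
    by (intro tendsto_intros symmetric_sums_tendsto_infsum imag_series_summable Tlim) (auto simp: imag_poles_def)
  have ev: "eventually (\<lambda>j. ?int j = ?res j) sequentially"
  proof -
    have "eventually (\<lambda>j. T j > \<bar>Im s\<bar>) sequentially" using Tlim by (simp add: filterlim_at_top_dense)
    then show ?thesis
    proof eventually_elim
      case (elim j)
      have c0: "c > 0" using c by simp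
      note rect = xi_raw_rectangle[OF B s elim c0 pole]
      have "x \<le> c" "- T j \<le> T j" using x0 c elim by linarith+
      from contour_integral_rectpath_split[OF this rect(1)[folded x_def]] rect(2)
      show ?case unfolding \<Phi>_def x_def by simp
    qed
  qed
  from LIMSEQ_unique[OF l1 iffD2[OF tendsto_cong[OF ev] l2]] show ?thesis
    by (simp add: \<Phi>_def x_def)
qed

section \<open>The regular part and the limit\<close>

text \<open>Now the left edge recedes. There the Euler product is at most 1 and the kernel is a null
  sequence times a fixed integrable function, so the left integral disappears while the sums over
  the even poles fill up. The series over the imaginary poles are already complete for every
  \<open>N\<close>.\<close>

lemma vertical_line_integral_eq_xi_colon_diff:
  fixes c :: real
  assumes B: "finite B" "\<And>p. p \<in> B \<Longrightarrow> prime p" "B \<noteq> {}"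
    and s: "s \<notin> imag_poles B" "s \<notin> even_poles" "Re s < c" and c: "c \<ge> 1"
  shows "vertical_line_integral c (\<lambda>w. xi_raw B w / (w - s)) =
    2 * of_real pi * \<i> * (xi_colon B s - xi_colon_pp B s)"
proof -
  define x where "x N = - (2 * real N + 1)" for N
  define J where "J = (LINT t|lborel. exp (- \<bar>t\<bar> / 16 :: real))"
  let ?\<Phi> = "\<lambda>w. xi_raw B w / (w - s)"
  have p2: "p \<ge> 2" if "p \<in> B" for p using B that prime_ge_2_nat by blast
  obtain e where e: "e \<longlonglongrightarrow> 0" "\<And>N t. norm (xi_kernel (card B) (Complex (x N) t)) \<le> e N * exp (- \<bar>t\<bar> / 16)"
    using xi_kernel_left_decay[of "card B"] unfolding x_def by blast
  have large: "eventually (\<lambda>N. x N \<le> Re s - 1) sequentially"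
    unfolding x_def by real_asymp
  have left: "(\<lambda>N. vertical_line_integral (x N) ?\<Phi>) \<longlonglongrightarrow> 0"
  proof (rule tendsto_0_le[OF e(1), where K = J])
    from large show "eventually (\<lambda>N. norm (vertical_line_integral (x N) ?\<Phi>) \<le> norm (e N) * J) sequentially"
    proof eventually_elim
      case (elim N)
      have "norm (?\<Phi> (Complex (x N) t)) \<le> norm (e N) * exp (- \<bar>t\<bar> / 16)" for t
      proof -
        have "e N * exp (- \<bar>t\<bar> / 16) \<le> norm (e N) * exp (- \<bar>t\<bar> / 16)" by (intro mult_right_mono) auto
        then have "norm (xi_kernel (card B) (Complex (x N) t)) \<le> norm (e N) * exp (- \<bar>t\<bar> / 16)"
          using e(2)[of N t] by linarith
        moreover have "norm (zeta_B B (Complex (x N) t)) \<le> 1"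
          using p2 by (intro norm_zeta_B_le_left) (auto simp: x_def)
        ultimately show ?thesis
          using norm_xi_raw_div_le[of B "Complex (x N) t" "norm (e N) * exp (- \<bar>t\<bar> / 16)" 1 1 s] elim by simp
      qed
      moreover have "?\<Phi> analytic_on {Complex (x N) t}" for t
      proof (rule xi_raw_vertical_line_analytic)
        show "x N \<noteq> - 2 * real n" for n unfolding x_def by (rule odd_neq_even)
      qed (use B elim in \<open>auto simp: x_def\<close>)
      ultimately show ?case
        unfolding J_def by (intro norm_vertical_line_integral_le continuous_on_vertical_line)
    qed
  qed
  have "(\<lambda>N. vertical_line_integral c ?\<Phi> - vertical_line_integral (x N) ?\<Phi>) \<longlonglongrightarrow> vertical_line_integral c ?\<Phi> - 0"
    by (intro tendsto_intros left)
  moreover have "(\<lambda>N. 2 * of_real pi * \<i> * (xi_raw B s - (\<Sum>p\<in>B. \<Sum>\<^sub>\<infinity>n. imag_res B p n / (s - imag_pole p n))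
      - (\<Sum>n=1..N. even_res B n / (s - (- 2 * of_nat n))))) \<longlonglongrightarrow>
      2 * of_real pi * \<i> * (xi_raw B s - (\<Sum>p\<in>B. \<Sum>\<^sub>\<infinity>n. imag_res B p n / (s - imag_pole p n))
      - (\<Sum>\<^sub>\<infinity>n\<in>{1..}. even_res B n / (s - (- 2 * of_nat n))))"
    using B s by (intro tendsto_intros initial_sums_tendsto_infsum even_series_summable) (auto simp: even_poles_def)
  moreover have "eventually (\<lambda>N. 2 * of_real pi * \<i> * (xi_raw B s - (\<Sum>p\<in>B. \<Sum>\<^sub>\<infinity>n. imag_res B p n / (s - imag_pole p n))
      - (\<Sum>n=1..N. even_res B n / (s - (- 2 * of_nat n)))) =
      vertical_line_integral c ?\<Phi> - vertical_line_integral (x N) ?\<Phi>) sequentially"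
    using large
  proof eventually_elim
    case (elim N)
    then have "- (2 * real N + 1) < Re s" by (simp add: x_def)
    from vertical_line_integral_shift[OF B s(1,2) this s(3) c] show ?case by (simp only: x_def)
  qed
  ultimately have "vertical_line_integral c ?\<Phi> - 0 = 2 * of_real pi * \<i> * (xi_raw B s -
      (\<Sum>p\<in>B. \<Sum>\<^sub>\<infinity>n. imag_res B p n / (s - imag_pole p n))
      - (\<Sum>\<^sub>\<infinity>n\<in>{1..}. even_res B n / (s - (- 2 * of_nat n))))"
    using LIMSEQ_unique tendsto_cong by fast
  moreover have "xi_colon_pp B s = (\<Sum>p\<in>B. \<Sum>\<^sub>\<infinity>n. imag_res B p n / (s - imag_pole p n)) +
      (\<Sum>\<^sub>\<infinity>n\<in>{1..}. even_res B n / (s - (- 2 * of_nat n)))"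
    by (rule xi_colon_pp_eq[OF B(1,2)])
  moreover have "xi_colon B s = xi_raw B s" by (rule xi_colon_eq_xi_raw[OF B(2) s(1,2)])
  ultimately show ?thesis by (simp only: diff_diff_eq diff_0_right)
qed

section \<open>Extension of the integral formula across the poles\<close>

lemma eventually_not_pole:
  assumes B: "finite B" "\<And>p. p \<in> B \<Longrightarrow> prime p"
  shows "eventually (\<lambda>s. s \<notin> imag_poles B \<and> s \<notin> even_poles) (at s1)"
proof -
  define S where "S = {z \<in> imag_poles B \<union> even_poles. dist s1 z < 1}"
  have "finite S"
  proof (rule finite_subset)
    show "S \<subseteq> {z \<in> imag_poles B \<union> even_poles. norm z \<le> norm s1 + 1}"
    proof
      fix z assume z: "z \<in> S"
      have "norm z \<le> norm s1 + dist s1 z" using norm_triangle_ineq3[of s1 z] by (simp add: dist_norm)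
      then show "z \<in> {z \<in> imag_poles B \<union> even_poles. norm z \<le> norm s1 + 1}" using z by (simp add: S_def)
    qed
    show "finite {z \<in> imag_poles B \<union> even_poles. norm z \<le> norm s1 + 1}"
      by (rule finite_bounded_poles[OF B])
  qed
  then obtain d where d: "d > 0" "\<And>z. z \<in> S \<Longrightarrow> z \<noteq> s1 \<Longrightarrow> d \<le> dist s1 z"
    using finite_set_avoid[of S s1] by blast
  have "eventually (\<lambda>s. s \<in> ball s1 (min 1 d) - {s1}) (at s1)"
    using d(1) by (intro eventually_at_in_open) auto
  then show ?thesis
  proof eventually_elim
    case (elim s)
    then have "s \<notin> S" using d(2)[of s] by auto
    then show ?case using elim by (auto simp: S_def)
  qed
qed

lemma vertical_line_integral_diff:
  fixes f g :: "complex \<Rightarrow> complex"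
  assumes "integrable lborel (\<lambda>t. f (Complex c t))" "integrable lborel (\<lambda>t. g (Complex c t))"
  shows "vertical_line_integral c (\<lambda>w. f w - g w) = vertical_line_integral c f - vertical_line_integral c g"
  unfolding vertical_line_integral_def using assms by (simp add: left_diff_distrib)

lemma vertical_line_integral_add:
  fixes f g :: "complex \<Rightarrow> complex"
  assumes "integrable lborel (\<lambda>t. f (Complex c t))" "integrable lborel (\<lambda>t. g (Complex c t))"
  shows "vertical_line_integral c (\<lambda>w. f w + g w) = vertical_line_integral c f + vertical_line_integral c g"
  unfolding vertical_line_integral_def using assms by (simp add: distrib_right)

lemma xi_raw_right_line:
  assumes B: "finite B" "\<And>p. p \<in> B \<Longrightarrow> prime p" and c: "c \<ge> 1"
  shows "\<exists>C>0. \<forall>t. norm (xi_raw B (Complex c t)) \<le> C * exp (- \<bar>t\<bar> / 16)"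
proof -
  obtain C where C: "C > 0" "\<And>z. c \<le> Re z \<Longrightarrow> Re z \<le> c \<Longrightarrow> norm (xi_kernel (card B) z) \<le> C * exp (- \<bar>Im z\<bar> / 16)"
    using xi_kernel_exp_decay[of c c "card B"] c by auto
  have "norm (xi_raw B (Complex c t)) \<le> (C * exp (- \<bar>t\<bar> / 16)) * 2 ^ card B" for t
    unfolding xi_raw_def norm_mult using C(2)[of "Complex c t"] B c C(1)
    by (intro mult_mono norm_zeta_B_le_right) (auto simp: prime_ge_2_nat)
  then show ?thesis using C(1) by (intro exI[of _ "C * 2 ^ card B"]) (auto simp: mult_ac)
qed

lemma xi_raw_right_line_integrable:
  assumes B: "finite B" "\<And>p. p \<in> B \<Longrightarrow> prime p" and c: "c \<ge> 1" and s: "Re s < c"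
  shows "integrable lborel (\<lambda>t. xi_raw B (Complex c t) / (Complex c t - s))"
proof -
  obtain C where C: "C > 0" "\<And>t. norm (xi_raw B (Complex c t)) \<le> C * exp (- \<bar>t\<bar> / 16)"
    using xi_raw_right_line[OF B c] by blast
  have "norm (xi_raw B (Complex c t) / (Complex c t - s)) \<le> C / (c - Re s) * exp (- \<bar>t\<bar> / 16)" for t
  proof -
    have "c - Re s \<le> norm (Complex c t - s)" using abs_Re_le_cmod[of "Complex c t - s"] by simp
    then show ?thesis using norm_div_diff_le[OF C(2)[of t], of "c - Re s" "Complex c t" s] s by simp
  qed
  moreover have "(\<lambda>w. xi_raw B w / (w - s)) analytic_on {Complex c t}" for t
    using B c s by (intro xi_raw_vertical_line_analytic) auto
  ultimately show ?thesis
    by (intro line_integrable[where f = "\<lambda>w. xi_raw B w / (w - s)"] continuous_on_vertical_line)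
qed

text \<open>Near \<open>s1\<close> the formula is known off the exceptional points. Its right side
  is continuous in \<open>s\<close> to the left of the line, so the limit defining
  \<open>remove_sings\<close> exists, whether or not \<open>s1\<close> is exceptional. The margin
  \<open>Re s1 + 1 \<le> c\<close> keeps nearby points at distance at least 1/2 from the
  line.\<close>

lemma xi_colon_reg_eq_line_integral:
  fixes c :: real
  assumes B: "finite B" "\<And>p. p \<in> B \<Longrightarrow> prime p" "B \<noteq> {}" and c: "c \<ge> 1" "Re s1 + 1 \<le> c"
  shows "xi_colon_reg B s1 = vertical_line_integral c (\<lambda>w. xi_raw B w / (w - s1)) / (2 * of_real pi * \<i>)"
proof -
  define V where "V s = vertical_line_integral c (\<lambda>w. xi_raw B w / (w - s))" for s
  define J where "J = (LINT t|lborel. exp (- \<bar>t\<bar> / 16 :: real))"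
  obtain C where C: "C > 0" "\<And>t. norm (xi_raw B (Complex c t)) \<le> C * exp (- \<bar>t\<bar> / 16)"
    using xi_raw_right_line[OF B(1,2) c(1)] by blast
  have near: "eventually (\<lambda>s. dist s s1 < 1 / 2) (at s1)"
    using eventually_at[of "\<lambda>s. dist s s1 < 1 / 2" s1 UNIV] by (auto intro!: exI[of _ "1 / 2"])
  have Re_near: "Re s < c - 1 / 2" if "dist s s1 < 1 / 2" for s
    using that abs_Re_le_cmod[of "s - s1"] c(2) by (simp add: dist_norm abs_le_iff)
  have "(V \<longlongrightarrow> V s1) (at s1)"
  proof (rule LIM_zero_cancel, rule tendsto_0_le[where K = "2 * C * J"])
    show "((\<lambda>s. s - s1) \<longlongrightarrow> 0) (at s1)" by (intro LIM_zero tendsto_ident_at)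
    from near show "eventually (\<lambda>s. norm (V s - V s1) \<le> norm (s - s1) * (2 * C * J)) (at s1)"
    proof eventually_elim
      case (elim s)
      have Re: "Re s < c - 1 / 2" "Re s1 < c" using Re_near[OF elim] c by auto
      have "V s - V s1 = vertical_line_integral c (\<lambda>w. xi_raw B w / (w - s) - xi_raw B w / (w - s1))"
        unfolding V_def using B c Re by (subst vertical_line_integral_diff) (auto intro!: xi_raw_right_line_integrable)
      also have "norm \<dots> \<le> (2 * C * norm (s - s1)) * J"
        unfolding J_def
      proof (rule norm_vertical_line_integral_le)
        show "continuous_on UNIV (\<lambda>t. xi_raw B (Complex c t) / (Complex c t - s) - xi_raw B (Complex c t) / (Complex c t - s1))"
          using B c Re
          by (intro continuous_on_diff continuous_on_vertical_line[where f = "\<lambda>w. xi_raw B w / (w - _)"]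
              xi_raw_vertical_line_analytic) auto
        fix t
        define w where "w = Complex c t"
        have d: "1 / 2 \<le> norm (w - s)" "1 \<le> norm (w - s1)"
          using abs_Re_le_cmod[of "w - s"] abs_Re_le_cmod[of "w - s1"] Re c by (auto simp: w_def)
        then have ne: "w - s \<noteq> 0" "w - s1 \<noteq> 0" by auto
        \<comment> \<open>The distances 1/2 and 1 of \<open>s\<close> and \<open>s1\<close> from the
          line produce the factor 2 in the Lipschitz bound.\<close>
        have "xi_raw B w / (w - s) - xi_raw B w / (w - s1) = (xi_raw B w * (s - s1) / (w - s)) / (w - s1)"
          using ne by (simp add: field_simps)
        moreover have "norm (xi_raw B w * (s - s1) / (w - s)) \<le> (C * exp (- \<bar>t\<bar> / 16) * norm (s - s1)) / (1 / 2)"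
          using C d(1) by (intro norm_div_diff_le) (auto simp: norm_mult w_def intro!: mult_right_mono)
        then have "norm ((xi_raw B w * (s - s1) / (w - s)) / (w - s1)) \<le> (C * exp (- \<bar>t\<bar> / 16) * norm (s - s1)) / (1 / 2) / 1"
          by (rule norm_div_diff_le) (use d(2) in simp_all)
        ultimately show "norm (xi_raw B (Complex c t) / (Complex c t - s) - xi_raw B (Complex c t) / (Complex c t - s1))
            \<le> 2 * C * norm (s - s1) * exp (- \<bar>t\<bar> / 16)"
          by (simp add: w_def mult_ac)
      qed
      finally show ?case by (simp add: mult_ac)
    qed
  qed
  then have "((\<lambda>s. V s / (2 * of_real pi * \<i>)) \<longlongrightarrow> V s1 / (2 * of_real pi * \<i>)) (at s1)"
    by (intro tendsto_intros) auto
  moreover have "eventually (\<lambda>s. xi_colon B s - xi_colon_pp B s = V s / (2 * of_real pi * \<i>)) (at s1)"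
  proof -
    have "eventually (\<lambda>s. s \<notin> imag_poles B \<and> s \<notin> even_poles) (at s1)"
      by (rule eventually_not_pole[OF B(1,2)])
    with near show ?thesis
    proof eventually_elim
      case (elim s)
      have "V s = 2 * of_real pi * \<i> * (xi_colon B s - xi_colon_pp B s)"
        unfolding V_def using Re_near[OF elim(1)] elim(2) c
        by (intro vertical_line_integral_eq_xi_colon_diff B) auto
      then show ?case by simp
    qed
  qed
  ultimately have "((\<lambda>s. xi_colon B s - xi_colon_pp B s) \<longlongrightarrow> V s1 / (2 * of_real pi * \<i>)) (at s1)"
    by (simp add: tendsto_cong)
  then show ?thesis unfolding xi_colon_reg_def V_def by (rule remove_sings_eqI)
qed

text \<open>\<open>a_fun\<close> is the sum of the Cauchy kernels at \<open>s0\<close> and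
  \<open>1 - s0\<close>, one for each summand of \<open>xi_approx\<close>. The abscissa |Re s0| + 2
  exceeds the real parts of both points by at least 1, so one line serves both.\<close>

lemma zeta_approx_eq_line_integral:
  fixes s0 :: complex
  assumes B: "finite B" "\<And>p. p \<in> B \<Longrightarrow> prime p" "B \<noteq> {}"
  shows "zeta_approx B s0 = 1 / (s0 ^ card B * (1 - s0) ^ card B * g_fun s0) *
    (1 / (2 * of_real pi * \<i>) * vertical_line_integral (\<bar>Re s0\<bar> + 2) (\<lambda>w. xi_raw B w * a_fun w s0))"
proof -
  define c where "c = \<bar>Re s0\<bar> + 2"
  have c: "c \<ge> 1" "Re s0 + 1 \<le> c" "Re (1 - s0) + 1 \<le> c" by (auto simp: c_def)
  have "(\<lambda>w. xi_raw B w * a_fun w s0) = (\<lambda>w. xi_raw B w / (w - s0) + xi_raw B w / (w - (1 - s0)))"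
    by (rule ext) (simp add: a_fun_def distrib_left algebra_simps)
  then have sum_eq: "vertical_line_integral c (\<lambda>w. xi_raw B w * a_fun w s0) =
      vertical_line_integral c (\<lambda>w. xi_raw B w / (w - s0)) + vertical_line_integral c (\<lambda>w. xi_raw B w / (w - (1 - s0)))"
    using B c by (simp only:) (intro vertical_line_integral_add xi_raw_right_line_integrable; simp)
  have "xi_colon_reg B s0 + xi_colon_reg B (1 - s0) =
      1 / (2 * of_real pi * \<i>) * vertical_line_integral c (\<lambda>w. xi_raw B w * a_fun w s0)"
  proof -
    have "xi_colon_reg B s0 = vertical_line_integral c (\<lambda>w. xi_raw B w / (w - s0)) / (2 * of_real pi * \<i>)"
      by (rule xi_colon_reg_eq_line_integral[OF B c(1,2)])
    moreover have "xi_colon_reg B (1 - s0) = vertical_line_integral c (\<lambda>w. xi_raw B w / (w - (1 - s0))) / (2 * of_real pi * \<i>)"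
      by (rule xi_colon_reg_eq_line_integral[OF B c(1,3)])
    ultimately show ?thesis using sum_eq by (simp add: add_divide_distrib)
  qed
  then show ?thesis
    unfolding zeta_approx_def xi_approx_def c_def by simp
qed

text \<open>Each Euler factor is 1 + f p with |f p| \<le> (1/N) / (1/2), and the deviation of a
  product from 1 is at most that of the product of the 1 + |f p|. The bound is uniform on the line
  and depends on \<open>B\<close> only through \<open>N\<close> and its cardinality.\<close>

lemma norm_zeta_B_minus_1_le:
  fixes N :: nat
  assumes "\<And>p. p \<in> B \<Longrightarrow> N \<le> p" "N \<ge> 2" "Re w \<ge> 1"
  shows "norm (zeta_B B w - 1) \<le> (1 + 2 / real N) ^ card B - 1"
proof -
  define f where "f p = 1 / (1 - of_nat p powr (- w)) - 1" for p :: nat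
  have "norm (f p) \<le> 2 / real N" if "p \<in> B" for p
  proof -
    have p: "N \<le> p" "p \<ge> 2" using assms(1)[OF that] assms(2) by auto
    have d: "1 / 2 \<le> norm (1 - of_nat p powr (- w))"
      using norm_one_minus_powr_bounds(2)[OF p(2) assms(3)] .
    then have "1 - of_nat p powr (- w) \<noteq> 0" by auto
    then have "f p = of_nat p powr (- w) / (1 - of_nat p powr (- w))"
      unfolding f_def by (simp add: divide_diff_eq_iff)
    moreover have "norm (of_nat p powr (- w)) \<le> 1 / real N"
    proof -
      have "1 * ln (real p) \<le> Re w * ln (real p)" using assms(3) p by (intro mult_right_mono) auto
      then have "norm (of_nat p powr (- w)) \<le> exp (- ln (real p))" using p by (simp add: of_nat_powr_minus)
      also have "\<dots> = 1 / real p" using p by (simp add: exp_minus divide_inverse)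
      also have "\<dots> \<le> 1 / real N" using p assms(2) by (intro divide_left_mono) auto
      finally show ?thesis .
    qed
    ultimately have "norm (f p) \<le> (1 / real N) / (1 / 2)"
      using d frac_le[of "1 / real N" "norm (of_nat p powr (- w))" "1 / 2" "norm (1 - of_nat p powr (- w))"]
      by (simp add: norm_divide)
    then show ?thesis by simp
  qed
  then have "(\<Prod>p\<in>B. 1 + norm (f p)) \<le> (\<Prod>p\<in>B. 1 + 2 / real N)"
    by (intro prod_mono) (auto intro: add_nonneg_nonneg)
  moreover have "zeta_B B w = (\<Prod>p\<in>B. 1 + f p)" by (simp add: zeta_B_def f_def)
  ultimately show ?thesis using norm_prod_minus1_le_prod_minus1[of f B] by simp
qed

theorem theorem1p5:
  fixes m :: nat and s0 :: complex
  assumes "m \<ge> 1" and "s0 \<noteq> 0" and "s0 \<noteq> 1"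
  shows "((\<lambda>B. zeta_approx B s0) \<longlongrightarrow> zeta_bracket m s0) (prime_sets_at_top m) \<and>
         zeta_bracket m s0 =
           1 / (s0 ^ m * (1 - s0) ^ m * g_fun s0) *
           (1 / (2 * of_real pi * \<i>) *
            vertical_line_integral (\<bar>Re s0\<bar> + 2)
              (\<lambda>s. s ^ m * (1 - s) ^ m * g_fun s * a_fun s s0))"
proof -
  define c where "c = \<bar>Re s0\<bar> + 2"
  define J where "J = (LINT t|lborel. exp (- \<bar>t\<bar> / 16 :: real))"
  \<comment> \<open>At \<open>s0 = - 2 n\<close> the value \<open>g_fun s0 = 0\<close> makes this
    factor 0, in the approximants as in the limit, in accordance with the convention 1/g =
    0.\<close>
  let ?K = "1 / (s0 ^ m * (1 - s0) ^ m * g_fun s0)"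
  define V where "V f = vertical_line_integral c (\<lambda>s. f s * a_fun s s0)" for f :: "complex \<Rightarrow> complex"
  have c: "c \<ge> 1" "Re s0 + 1 \<le> c" "Re (1 - s0) + 1 \<le> c" by (auto simp: c_def)
  obtain C where C: "C > 0" "\<And>z. c \<le> Re z \<Longrightarrow> Re z \<le> c \<Longrightarrow> norm (xi_kernel m z) \<le> C * exp (- \<bar>Im z\<bar> / 16)"
    using xi_kernel_exp_decay[of c c m] c by auto
  have a_le: "norm (a_fun (Complex c t) s0) \<le> 2" for t
  proof -
    define w where "w = Complex c t"
    have d: "1 \<le> norm (w - s0)" "1 \<le> norm (w - (1 - s0))"
      using abs_Re_le_cmod[of "w - s0"] abs_Re_le_cmod[of "w - (1 - s0)"] c by (auto simp: w_def)
    have "norm (a_fun w s0) \<le> norm (1 / (w - s0)) + norm (1 / (w - (1 - s0)))"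
      unfolding a_fun_def using norm_triangle_ineq[of "1 / (w - s0)" "1 / (w - (1 - s0))"] by (simp add: algebra_simps)
    also have "\<dots> \<le> 1 / 1 + 1 / 1" using d by (intro add_mono norm_div_diff_le) auto
    finally show ?thesis by (simp add: w_def)
  qed
  have a_cont: "continuous_on UNIV (\<lambda>t. a_fun (Complex c t) s0)"
  proof (rule continuous_on_vertical_line)
    fix t
    have "Complex c t - s0 \<noteq> 0" "Complex c t - 1 + s0 \<noteq> 0"
      using c by (auto simp: complex_eq_iff)
    then show "(\<lambda>s. a_fun s s0) analytic_on {Complex c t}"
      unfolding a_fun_def by (intro analytic_intros) auto
  qed
  have even: "Complex c t \<notin> even_poles" for t
    using c by (auto simp: even_poles_def complex_eq_iff)
  have k_cont: "continuous_on UNIV (\<lambda>t. xi_kernel m (Complex c t) * a_fun (Complex c t) s0)"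
    by (intro continuous_on_mult a_cont continuous_on_vertical_line[where f = "xi_kernel m"] xi_kernel_analytic even)
  have k_le: "norm (xi_kernel m (Complex c t) * a_fun (Complex c t) s0) \<le> (2 * C) * exp (- \<bar>t\<bar> / 16)" for t
    using mult_mono[OF C(2)[of "Complex c t"] a_le[of t]] C(1) by (simp add: norm_mult mult_ac)
  have k_int: "integrable lborel (\<lambda>t. xi_kernel m (Complex c t) * a_fun (Complex c t) s0)"
    by (rule line_integrable[where f = "\<lambda>s. xi_kernel m s * a_fun s s0", OF k_cont k_le])
  \<comment> \<open>The kernel depends on \<open>B\<close> only through \<open>m\<close>, so one
    integrable majorant serves all sets, and the uniform distance of the Euler product from 1 can be
    taken out of the integral.\<close>
  have diff: "norm (V (xi_raw B) - V (xi_kernel m)) \<le> ((1 + 2 / real N) ^ m - 1) * (2 * C * J)"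
    if B: "finite B" "card B = m" "\<And>p. p \<in> B \<Longrightarrow> prime p" and N: "N \<ge> 2" "\<And>p. p \<in> B \<Longrightarrow> N \<le> p" for B N
  proof -
    define \<delta> where "\<delta> = (1 + 2 / real N) ^ m - 1"
    have \<delta>: "\<delta> \<ge> 0" by (simp add: \<delta>_def)
    have z_cont: "continuous_on UNIV (\<lambda>t. zeta_B B (Complex c t))"
      using B c by (intro continuous_on_vertical_line zeta_B_analytic not_in_poles_of_Re_neq_0) auto
    have z_le: "norm (zeta_B B (Complex c t) - 1) \<le> \<delta>" for t
      using norm_zeta_B_minus_1_le[of B N "Complex c t"] B N c by (simp add: \<delta>_def)
    define h where "h w = xi_kernel m w * a_fun w s0 * (zeta_B B w - 1)" for w
    have h_cont: "continuous_on UNIV (\<lambda>t. h (Complex c t))"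
      unfolding h_def by (intro continuous_on_mult continuous_on_diff continuous_on_const k_cont z_cont)
    have h_le: "norm (h (Complex c t)) \<le> (2 * C * \<delta>) * exp (- \<bar>t\<bar> / 16)" for t
    proof -
      have "norm (h (Complex c t)) \<le> ((2 * C) * exp (- \<bar>t\<bar> / 16)) * \<delta>"
        unfolding h_def norm_mult[of "_ * _"] using k_le[of t] z_le[of t] C(1) by (intro mult_mono) auto
      then show ?thesis by (simp only: mult_ac)
    qed
    have "(\<lambda>w. xi_raw B w * a_fun w s0) = (\<lambda>w. xi_kernel m w * a_fun w s0 + h w)"
      by (rule ext) (simp add: xi_raw_def B(2) h_def algebra_simps)
    then have "V (xi_raw B) = V (xi_kernel m) + vertical_line_integral c h"
      unfolding V_def using k_int line_integrable[OF h_cont h_le] by (simp add: vertical_line_integral_add)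
    then have "norm (V (xi_raw B) - V (xi_kernel m)) = norm (vertical_line_integral c h)" by simp
    also have "\<dots> \<le> (2 * C * \<delta>) * J"
      unfolding J_def by (rule norm_vertical_line_integral_le[OF h_cont h_le])
    finally show ?thesis by (simp only: \<delta>_def mult_ac)
  qed
  have "((\<lambda>B. V (xi_raw B)) \<longlongrightarrow> V (xi_kernel m)) (prime_sets_at_top m)"
  proof (rule tendstoI)
    fix e :: real assume e: "e > 0"
    have "((\<lambda>N. ((1 + 2 / real N) ^ m - 1) * (2 * C * J)) \<longlongrightarrow> ((1 + 0) ^ m - 1) * (2 * C * J)) sequentially"
      by (intro tendsto_intros)
    then have "eventually (\<lambda>N. ((1 + 2 / real N) ^ m - 1) * (2 * C * J) < e) sequentially"
      using e by (intro order_tendstoD(2)) auto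
    then have "eventually (\<lambda>N. ((1 + 2 / real N) ^ m - 1) * (2 * C * J) < e \<and> N \<ge> 2) sequentially"
      using eventually_ge_at_top[of "2 :: nat"] by (rule eventually_conj)
    then obtain N where N: "((1 + 2 / real N) ^ m - 1) * (2 * C * J) < e" "N \<ge> 2"
      by (auto simp: eventually_sequentially)
    show "eventually (\<lambda>B. dist (V (xi_raw B)) (V (xi_kernel m)) < e) (prime_sets_at_top m)"
      unfolding eventually_prime_sets_at_top
    proof (intro exI[of _ N] allI impI)
      fix B :: "nat set" assume B: "finite B \<and> card B = m \<and> (\<forall>p\<in>B. prime p) \<and> N \<le> Min B"
      then have "N \<le> p" if "p \<in> B" for p using that Min_le[of B p] by (meson order.trans)
      then show "dist (V (xi_raw B)) (V (xi_kernel m)) < e"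
        using diff[of B N] B N unfolding dist_norm by fastforce
    qed
  qed
  then have "((\<lambda>B. ?K * (1 / (2 * of_real pi * \<i>) * V (xi_raw B))) \<longlongrightarrow>
      ?K * (1 / (2 * of_real pi * \<i>) * V (xi_kernel m))) (prime_sets_at_top m)"
    by (intro tendsto_mult tendsto_const)
  moreover have "eventually (\<lambda>B. zeta_approx B s0 =
      ?K * (1 / (2 * of_real pi * \<i>) * V (xi_raw B))) (prime_sets_at_top m)"
    unfolding eventually_prime_sets_at_top
  proof (intro exI[of _ 0] allI impI)
    fix B :: "nat set" assume B: "finite B \<and> card B = m \<and> (\<forall>p\<in>B. prime p) \<and> 0 \<le> Min B"
    then have "B \<noteq> {}" using assms(1) by auto
    then show "zeta_approx B s0 =
      ?K * (1 / (2 * of_real pi * \<i>) * V (xi_raw B))"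
      using zeta_approx_eq_line_integral[of B s0] B by (simp add: V_def c_def)
  qed
  ultimately have lim: "((\<lambda>B. zeta_approx B s0) \<longlongrightarrow>
      ?K * (1 / (2 * of_real pi * \<i>) * V (xi_kernel m))) (prime_sets_at_top m)"
    by (simp only: tendsto_cong)
  \<comment> \<open>For \<open>m \<ge> 1\<close> the filter is nontrivial, so the limit is unique
    and \<open>Lim\<close> picks it.\<close>
  then have "zeta_bracket m s0 = ?K * (1 / (2 * of_real pi * \<i>) * V (xi_kernel m))"
    unfolding zeta_bracket_def by (rule tendsto_Lim[OF prime_sets_at_top_neq_bot[OF assms(1)]])
  moreover have "V (xi_kernel m) = vertical_line_integral (\<bar>Re s0\<bar> + 2) (\<lambda>s. s ^ m * (1 - s) ^ m * g_fun s * a_fun s s0)"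
    by (simp add: V_def c_def xi_kernel_def g_fun_eq_g_kernel)
  ultimately show ?thesis using lim by simp
qed

end
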